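(* Let $G$ be a finitely generated virtually abelian group, let $S \subset G$ be a finite subset, and let $\omega : S \to \mathbb{Z}_{>0}$ be a positive integer weight. Let $d$ be a positive integer. Then, for any algebraic subset $U \subset G^d$, the multivariate growth series $$\mathbb{S}_{U,S,\omega}(\mathbf{z}) = \sum_{\mathbf{x}=(x_1,\ldots,x_d) \in U} z_1^{\omega(x_1)} z_2^{\omega(x_2)} \cdots z_d^{\omega(x_d)} \in \mathbb{Z}[[z_1,\ldots,z_d]]$$ is a rational function.
   Context: A group $G$ is virtually abelian if it has an abelian subgroup $H$ of finite index. Weights. Let $S^*$ be the set of all words from $S$ (including the empty word, which represents $1_G$ and has weight $0$; inverses of elements of $S$ are not allowed unless they lie in $S$). For a word $\sigma = s_1 \cdots s_\ell \in S^*$ put $\omega(\sigma) := \sum_{i=1}^{\ell} \omega(s_i)$. For $g \in G$, $\omega(g)$ is the smallest $\omega(\sigma)$ among all words $\sigma \in S^*$ representing $g$, and $\omega(g) = \infty$ if $g$ is represented by no word in $S^*$. It is not assumed that $S$ generates $G$. In the definition of $\mathbb{S}_{U,S,\omega}(\mathbf{z})$, the convention is $z_i^{\omega(x_i)} = 0$ if $\omega(x_i) = \infty$. Algebraic sets. Let $F_d$ be the free group on $\{X_1,\ldots,X_d\}$. A finite system of equations in $G$ is a finite subset $W$ of the free product $G * F_d$. For $w \in G * F_d$ and $(g_1,\ldots,g_d) \in G^d$, $w(g_1,\ldots,g_d) \in G$ denotes the image of $w$ under the unique group homomorphism $G * F_d \to G$ that is the identity on $G$ and sends $X_i \mapsto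 g_i$ for each $1 \le i \le d$. A tuple $(g_1,\ldots,g_d) \in G^d$ is a solution of $W$ if $w(g_1,\ldots,g_d) = 1_G$ for all $w \in W$. A subset $U \subset G^d$ is algebraic if it is the set of solutions of some finite system $W$ of equations in $G$. A formal power series in $\mathbb{Z}[[z_1,\ldots,z_d]]$ is a rational function if it is a quotient $P/Q$ of polynomials in $z_1,\ldots,z_d$ with $Q \neq 0$ (i.e. $Q$ times the series equals $P$). *)

theory Defs
  imports
    "HOL-Algebra.Coset"
    "HOL-Algebra.Generated_Groups"
    "HOL-Library.FuncSet"
    "HOL-Library.Poly_Mapping"
    "HOL-Library.Extended_Nat"
begin

section \<open>Virtually abelian groups\<close>

definition finitely_generated :: "('a, 'b) monoid_scheme \<Rightarrow> bool" where
  "finitely_generated G \<longleftrightarrow> (\<exists>T. finite T \<and> T \<subseteq> carrier G \<and> generate G T = carrier G)"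

definition virtually_abelian :: "('a, 'b) monoid_scheme \<Rightarrow> bool" where
  "virtually_abelian G \<longleftrightarrow>
     (\<exists>H. subgroup H G \<and> comm_group (G\<lparr>carrier := H\<rparr>) \<and> finite (rcosets\<^bsub>G\<^esub> H))"

definition word_prod :: "('a, 'b) monoid_scheme \<Rightarrow> 'a list \<Rightarrow> 'a" where
  "word_prod G ws = foldr (\<otimes>\<^bsub>G\<^esub>) ws \<one>\<^bsub>G\<^esub>"


section \<open>Monoids given by generators and relations\<close>

inductive word_cong :: "'x set \<Rightarrow> ('x list \<times> 'x list) set \<Rightarrow> 'x list \<Rightarrow> 'x list \<Rightarrow> bool"
  for A R where
  word_cong_refl: "u \<in> lists A \<Longrightarrow> word_cong A R u u"
| word_cong_sym: "word_cong A R u v \<Longrightarrow> word_cong A R v u"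
| word_cong_trans: "word_cong A R u v \<Longrightarrow> word_cong A R v w \<Longrightarrow> word_cong A R u w"
| word_cong_step: "(l, r) \<in> R \<Longrightarrow> l \<in> lists A \<Longrightarrow> r \<in> lists A \<Longrightarrow> u \<in> lists A \<Longrightarrow> v \<in> lists A
    \<Longrightarrow> word_cong A R (u @ l @ v) (u @ r @ v)"

definition word_rel :: "'x set \<Rightarrow> ('x list \<times> 'x list) set \<Rightarrow> ('x list \<times> 'x list) set" where
  "word_rel A R = {(u, v). word_cong A R u v}"

definition word_class :: "'x set \<Rightarrow> ('x list \<times> 'x list) set \<Rightarrow> 'x list \<Rightarrow> 'x list set" where
  "word_class A R u = word_rel A R `` {u}"

definition presented :: "'x set \<Rightarrow> ('x list \<times> 'x list) set \<Rightarrow> 'x list set monoid" where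
  "presented A R =
     \<lparr>carrier = lists A // word_rel A R,
      mult = (\<lambda>X Y. \<Union>u\<in>X. \<Union>v\<in>Y. word_class A R (u @ v)),
      one = word_class A R []\<rparr>"

lemma word_cong_lists: "word_cong A R u v \<Longrightarrow> u \<in> lists A \<and> v \<in> lists A"
  by (induction rule: word_cong.induct) auto

lemma equiv_word_rel: "equiv (lists A) (word_rel A R)"
  unfolding word_rel_def
  by (rule equivI)
    (auto simp: refl_on_def sym_def trans_def dest: word_cong_lists
      intro: word_cong_refl word_cong_sym word_cong_trans)

lemma word_class_in_carrier: "u \<in> lists A \<Longrightarrow> word_class A R u \<in> carrier (presented A R)"
  by (simp add: presented_def word_class_def quotientI)

lemma presented_carrierE:
  assumes "X \<in> carrier (presented A R)"
  obtains u where "u \<in> lists A" "X = word_class A R u"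
  using assms that unfolding presented_def word_class_def by (auto elim!: quotientE simp del: in_lists_conv_set)

lemma word_class_eq_iff:
  "u \<in> lists A \<Longrightarrow> v \<in> lists A \<Longrightarrow> word_class A R u = word_class A R v \<longleftrightarrow> word_cong A R u v"
  using eq_equiv_class_iff[OF equiv_word_rel] by (simp add: word_class_def word_rel_def)

lemma word_cong_append_left:
  assumes "word_cong A R u v" "w \<in> lists A" shows "word_cong A R (w @ u) (w @ v)"
  using assms
proof (induction rule: word_cong.induct)
  case (word_cong_refl u)
  then show ?case by (intro word_cong.word_cong_refl) simp
next
  case (word_cong_step l r u v)
  then show ?case using word_cong.word_cong_step[of l r R A "w @ u" v] by simp
qed (blast intro: word_cong_sym word_cong_trans)+

lemma word_cong_append_right:
  assumes "word_cong A R u v" "w \<in> lists A" shows "word_cong A R (u @ w) (v @ w)"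
  using assms
proof (induction rule: word_cong.induct)
  case (word_cong_refl u)
  then show ?case by (intro word_cong.word_cong_refl) simp
next
  case (word_cong_step l r u v)
  then show ?case using word_cong.word_cong_step[of l r R A u "v @ w"] by simp
qed (blast intro: word_cong_sym word_cong_trans)+

lemma presented_mult:
  assumes "u \<in> lists A" "v \<in> lists A"
  shows "word_class A R u \<otimes>\<^bsub>presented A R\<^esub> word_class A R v = word_class A R (u @ v)"
proof -
  have "congruent2 (word_rel A R) (word_rel A R) (\<lambda>u v. word_class A R (u @ v))"
  proof (rule congruent2I[OF equiv_word_rel equiv_word_rel])
    fix y z w assume "w \<in> lists A" "(y, z) \<in> word_rel A R"
    then show "word_class A R (y @ w) = word_class A R (z @ w)"
      by (subst word_class_eq_iff)
        (auto simp: word_rel_def intro: word_cong_append_right dest: word_cong_lists)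
  next
    fix y z w assume "w \<in> lists A" "(y, z) \<in> word_rel A R"
    then show "word_class A R (w @ y) = word_class A R (w @ z)"
      by (subst word_class_eq_iff)
        (auto simp: word_rel_def intro: word_cong_append_left dest: word_cong_lists)
  qed
  from UN_equiv_class2[OF equiv_word_rel equiv_word_rel this assms]
  show ?thesis by (simp add: presented_def word_class_def)
qed

lemma presented_one: "\<one>\<^bsub>presented A R\<^esub> = word_class A R []"
  by (simp add: presented_def)

lemma monoid_presented: "Group.monoid (presented A R)"
proof (rule monoidI)
  fix X Y Z
  assume "X \<in> carrier (presented A R)" "Y \<in> carrier (presented A R)" "Z \<in> carrier (presented A R)"
  then obtain u v w where "u \<in> lists A" "X = word_class A R u" "v \<in> lists A" "Y = word_class A R v"
    "w \<in> lists A" "Z = word_class A R w"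
    by (metis presented_carrierE)
  then show "X \<otimes>\<^bsub>presented A R\<^esub> Y \<otimes>\<^bsub>presented A R\<^esub> Z
      = X \<otimes>\<^bsub>presented A R\<^esub> (Y \<otimes>\<^bsub>presented A R\<^esub> Z)"
    by (simp add: presented_mult)
next
  fix X Y assume "X \<in> carrier (presented A R)" "Y \<in> carrier (presented A R)"
  then obtain u v where "u \<in> lists A" "X = word_class A R u" "v \<in> lists A" "Y = word_class A R v"
    by (metis presented_carrierE)
  then show "X \<otimes>\<^bsub>presented A R\<^esub> Y \<in> carrier (presented A R)"
    by (simp add: presented_mult word_class_in_carrier)
next
  fix X assume "X \<in> carrier (presented A R)"
  then obtain u where "u \<in> lists A" "X = word_class A R u" by (metis presented_carrierE)
  then show "\<one>\<^bsub>presented A R\<^esub> \<otimes>\<^bsub>presented A R\<^esub> X = X" "X \<otimes>\<^bsub>presented A R\<^esub> \<one>\<^bsub>presented A R\<^esub> = X"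
    by (simp_all add: presented_one presented_mult)
qed (simp add: presented_one word_class_in_carrier)

lemma group_presented:
  assumes inv: "\<And>a. a \<in> A \<Longrightarrow> \<exists>w \<in> lists A. word_cong A R (w @ [a]) []"
  shows "Group.group (presented A R)"
proof -
  have "\<exists>w \<in> lists A. word_cong A R (w @ u) []" if "u \<in> lists A" for u
    using that
  proof (induction u)
    case Nil
    then show ?case by (auto intro!: bexI[of _ "[]"] word_cong_refl)
  next
    case (Cons a u)
    obtain w where w: "w \<in> lists A" "word_cong A R (w @ u) []" using Cons by auto
    obtain v where v: "v \<in> lists A" "word_cong A R (v @ [a]) []" using inv Cons.hyps by blast
    have "word_cong A R (w @ ((v @ [a]) @ u)) (w @ ([] @ u))"
      using w v Cons by (intro word_cong_append_left word_cong_append_right) auto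
    then have "word_cong A R ((w @ v) @ (a # u)) []" using w(2) by (auto intro: word_cong_trans)
    then show ?case using w v by (intro bexI[of _ "w @ v"]) auto
  qed
  note inv_word = this
  show ?thesis
  proof (rule monoid.group_l_invI[OF monoid_presented])
    fix X assume "X \<in> carrier (presented A R)"
    then obtain u where u: "u \<in> lists A" "X = word_class A R u" by (metis presented_carrierE)
    obtain w where w: "w \<in> lists A" "word_cong A R (w @ u) []" using inv_word[OF u(1)] by blast
    have "word_class A R w \<otimes>\<^bsub>presented A R\<^esub> X = \<one>\<^bsub>presented A R\<^esub>"
      unfolding u(2) presented_mult[OF w(1) u(1)] presented_one
      using w u(1) by (subst word_class_eq_iff) auto
    with word_class_in_carrier[OF w(1)]
    show "\<exists>Y \<in> carrier (presented A R). Y \<otimes>\<^bsub>presented A R\<^esub> X = \<one>\<^bsub>presented A R\<^esub>" by blast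
  qed
qed

lemma word_prod_closed:
  assumes "Group.monoid K" "ws \<in> lists (carrier K)" shows "word_prod K ws \<in> carrier K"
  using assms(2) by (induction ws) (auto simp: word_prod_def monoid.m_closed monoid.one_closed assms(1))

lemma word_prod_append:
  assumes "Group.monoid K" "us \<in> lists (carrier K)" "vs \<in> lists (carrier K)"
  shows "word_prod K (us @ vs) = word_prod K us \<otimes>\<^bsub>K\<^esub> word_prod K vs"
proof -
  interpret Group.monoid K by fact
  have *: "foldr (\<otimes>\<^bsub>K\<^esub>) ws \<one>\<^bsub>K\<^esub> \<in> carrier K" if "ws \<in> lists (carrier K)" for ws
    using word_prod_closed[OF assms(1) that] by (simp add: word_prod_def)
  show ?thesis
    using assms(2,3) by (induction us) (auto simp: word_prod_def m_assoc *)
qed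

lemma presented_lift:
  assumes K: "Group.monoid K" and f: "f \<in> A \<rightarrow> carrier K"
    and R: "\<And>l r. (l, r) \<in> R \<Longrightarrow> l \<in> lists A \<Longrightarrow> r \<in> lists A \<Longrightarrow>
      word_prod K (map f l) = word_prod K (map f r)"
  obtains h where "h \<in> hom (presented A R) K"
    "\<And>u. u \<in> lists A \<Longrightarrow> h (word_class A R u) = word_prod K (map f u)"
proof -
  have fl: "map f u \<in> lists (carrier K)" if "u \<in> lists A" for u
    using that f by (auto simp: Pi_iff)
  have resp: "word_prod K (map f u) = word_prod K (map f v)" if "word_cong A R u v" for u v
    using that
  proof (induction rule: word_cong.induct)
    case (word_cong_step l r u v)
    then show ?case using R fl by (simp add: word_prod_append[OF K] del: in_lists_conv_set)
  qed auto
  define h where "h = (\<lambda>X. word_prod K (map f (SOME u. u \<in> X)))"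
  have h: "h (word_class A R u) = word_prod K (map f u)" if "u \<in> lists A" for u
  proof -
    have "u \<in> word_class A R u" using that
      by (auto simp: word_class_def word_rel_def intro: word_cong_refl)
    then have "(SOME v. v \<in> word_class A R u) \<in> word_class A R u" by (rule someI)
    then have "word_cong A R u (SOME v. v \<in> word_class A R u)"
      by (simp add: word_class_def word_rel_def)
    from resp[OF this] show ?thesis by (simp add: h_def)
  qed
  have "h \<in> hom (presented A R) K"
  proof (rule homI)
    fix X assume "X \<in> carrier (presented A R)"
    then obtain u where u: "u \<in> lists A" "X = word_class A R u" by (metis presented_carrierE)
    show "h X \<in> carrier K" unfolding u(2) h[OF u(1)] by (rule word_prod_closed[OF K fl[OF u(1)]])
  next
    fix X Y assume "X \<in> carrier (presented A R)" "Y \<in> carrier (presented A R)"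
    then obtain u v where u: "u \<in> lists A" "X = word_class A R u"
      and v: "v \<in> lists A" "Y = word_class A R v" by (metis presented_carrierE)
    have "u @ v \<in> lists A" using u v by simp
    then show "h (X \<otimes>\<^bsub>presented A R\<^esub> Y) = h X \<otimes>\<^bsub>K\<^esub> h Y"
      using u v h[of "u @ v"] by (simp only: presented_mult h map_append word_prod_append[OF K fl fl])
  qed
  with h that show thesis by blast
qed

lemma presented_hom_eqI:
  assumes K: "Group.group K" and P: "Group.group (presented A R)"
    and h: "h \<in> hom (presented A R) K" and h': "h' \<in> hom (presented A R) K"
    and eq: "\<And>a. a \<in> A \<Longrightarrow> h (word_class A R [a]) = h' (word_class A R [a])"
    and X: "X \<in> carrier (presented A R)"
  shows "h X = h' X"
proof -
  obtain u where u: "u \<in> lists A" "X = word_class A R u" using X by (metis presented_carrierE)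
  have "h (word_class A R u) = h' (word_class A R u)" using u(1)
  proof (induction u)
    case Nil
    then show ?case using hom_one[OF h P K] hom_one[OF h' P K] by (simp add: presented_one)
  next
    case (Cons a u)
    have "word_class A R (a # u) = word_class A R [a] \<otimes>\<^bsub>presented A R\<^esub> word_class A R u"
      using Cons by (subst presented_mult) auto
    moreover have "word_class A R [a] \<in> carrier (presented A R)" "word_class A R u \<in> carrier (presented A R)"
      using Cons by (auto intro!: word_class_in_carrier)
    ultimately show ?case using Cons eq h h' by (simp add: hom_mult)
  qed
  then show ?thesis by (simp add: u)
qed


section \<open>Free groups and free products\<close>

text \<open>The letter \<open>(x, True)\<close> stands for the generator \<open>x\<close>, and \<open>(x, False)\<close> for its inverse.\<close>

definition free_group_rels :: "'x set \<Rightarrow> (('x \<times> bool) list \<times> ('x \<times> bool) list) set" where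
  "free_group_rels I = {([(x, b), (x, \<not> b)], []) | x b. x \<in> I}"

definition free_group :: "'x set \<Rightarrow> ('x \<times> bool) list set monoid" where
  "free_group I = presented (I \<times> UNIV) (free_group_rels I)"

definition free_group_gen :: "'x set \<Rightarrow> 'x \<Rightarrow> ('x \<times> bool) list set" where
  "free_group_gen I x = word_class (I \<times> UNIV) (free_group_rels I) [(x, True)]"

definition free_product_rels ::
  "('a, 'm) monoid_scheme \<Rightarrow> ('b, 'n) monoid_scheme \<Rightarrow> (('a + 'b) list \<times> ('a + 'b) list) set" where
  "free_product_rels G H =
     {([Inl a, Inl a'], [Inl (a \<otimes>\<^bsub>G\<^esub> a')]) | a a'. a \<in> carrier G \<and> a' \<in> carrier G} \<union>
     {([Inr b, Inr b'], [Inr (b \<otimes>\<^bsub>H\<^esub> b')]) | b b'. b \<in> carrier H \<and> b' \<in> carrier H} \<union>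
     {([Inl \<one>\<^bsub>G\<^esub>], []), ([Inr \<one>\<^bsub>H\<^esub>], [])}"

definition free_product ::
  "('a, 'm) monoid_scheme \<Rightarrow> ('b, 'n) monoid_scheme \<Rightarrow> ('a + 'b) list set monoid" where
  "free_product G H = presented (carrier G <+> carrier H) (free_product_rels G H)"

definition free_product_inl ::
  "('a, 'm) monoid_scheme \<Rightarrow> ('b, 'n) monoid_scheme \<Rightarrow> 'a \<Rightarrow> ('a + 'b) list set" where
  "free_product_inl G H a = word_class (carrier G <+> carrier H) (free_product_rels G H) [Inl a]"

definition free_product_inr ::
  "('a, 'm) monoid_scheme \<Rightarrow> ('b, 'n) monoid_scheme \<Rightarrow> 'b \<Rightarrow> ('a + 'b) list set" where
  "free_product_inr G H b = word_class (carrier G <+> carrier H) (free_product_rels G H) [Inr b]"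

lemma group_free_group: "Group.group (free_group I)"
  unfolding free_group_def
proof (rule group_presented)
  fix a assume "a \<in> I \<times> (UNIV :: bool set)"
  then obtain x b where a: "a = (x, b)" "x \<in> I" by auto
  have "([(x, \<not> b), (x, \<not> \<not> b)], []) \<in> free_group_rels I" using a unfolding free_group_rels_def by blast
  from word_cong_step[OF this, of "I \<times> UNIV" "[]" "[]"]
  show "\<exists>w \<in> lists (I \<times> UNIV). word_cong (I \<times> UNIV) (free_group_rels I) (w @ [a]) []"
    using a by (intro bexI[of _ "[(x, \<not> b)]"]) auto
qed

lemma free_group_gen_closed: "x \<in> I \<Longrightarrow> free_group_gen I x \<in> carrier (free_group I)"
  by (auto simp: free_group_gen_def free_group_def intro!: word_class_in_carrier)

lemma free_group_lift:
  assumes K: "Group.group K" and g: "g \<in> I \<rightarrow> carrier K"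
  obtains h where "h \<in> hom (free_group I) K" "\<And>x. x \<in> I \<Longrightarrow> h (free_group_gen I x) = g x"
proof -
  interpret K: Group.group K by fact
  let ?f = "\<lambda>(x, b). if b then g x else inv\<^bsub>K\<^esub> g x"
  obtain h where h: "h \<in> hom (free_group I) K"
    and h': "\<And>u. u \<in> lists (I \<times> UNIV) \<Longrightarrow>
      h (word_class (I \<times> UNIV) (free_group_rels I) u) = word_prod K (map ?f u)"
    unfolding free_group_def
  proof (rule presented_lift[OF K.is_monoid, of ?f "I \<times> UNIV" "free_group_rels I"])
    show "?f \<in> I \<times> UNIV \<rightarrow> carrier K" using g by (auto simp: Pi_iff)
  next
    fix l r assume "(l, r) \<in> free_group_rels I"
    then obtain x b where x: "x \<in> I" "l = [(x, b), (x, \<not> b)]" "r = []"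
      by (auto simp: free_group_rels_def)
    have "g x \<in> carrier K" using g x by auto
    with x show "word_prod K (map ?f l) = word_prod K (map ?f r)"
      by (cases b) (simp_all add: word_prod_def)
  qed blast
  have "h (free_group_gen I x) = g x" if "x \<in> I" for x
  proof -
    have "g x \<in> carrier K" using g that by auto
    with that h'[of "[(x, True)]"] show ?thesis by (simp add: free_group_gen_def word_prod_def)
  qed
  with h that show thesis by blast
qed

lemma free_group_hom_eqI:
  assumes K: "Group.group K" and h: "h \<in> hom (free_group I) K" and h': "h' \<in> hom (free_group I) K"
    and eq: "\<And>x. x \<in> I \<Longrightarrow> h (free_group_gen I x) = h' (free_group_gen I x)"
    and X: "X \<in> carrier (free_group I)"
  shows "h X = h' X"
proof -
  interpret K: Group.group K by fact
  interpret F: Group.group "free_group I" by (rule group_free_group)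
  let ?c = "word_class (I \<times> UNIV) (free_group_rels I)"
  have inv: "?c [(x, False)] = inv\<^bsub>free_group I\<^esub> free_group_gen I x" if "x \<in> I" for x
  proof -
    have "([(x, False), (x, \<not> False)], []) \<in> free_group_rels I"
      using that unfolding free_group_rels_def by blast
    from word_cong_step[OF this, of "I \<times> UNIV" "[]" "[]"]
    have "?c [(x, False), (x, True)] = ?c []" using that by (subst word_class_eq_iff) auto
    then have "?c [(x, False)] \<otimes>\<^bsub>free_group I\<^esub> free_group_gen I x = \<one>\<^bsub>free_group I\<^esub>"
      using that by (simp add: free_group_def free_group_gen_def presented_mult presented_one)
    then show ?thesis
      using that by (intro F.inv_equality[symmetric] free_group_gen_closed)
        (auto simp: free_group_def intro!: word_class_in_carrier)
  qed
  show ?thesis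
  proof (rule presented_hom_eqI[OF K, of "I \<times> UNIV" "free_group_rels I", folded free_group_def,
        OF group_free_group h h' _ X])
    fix a assume "a \<in> I \<times> (UNIV :: bool set)"
    then obtain x b where a: "a = (x, b)" "x \<in> I" by auto
    show "h (?c [a]) = h' (?c [a])"
    proof (cases b)
      case True
      then show ?thesis using a eq by (simp add: free_group_gen_def)
    next
      case False
      have "group_hom (free_group I) K h" "group_hom (free_group I) K h'"
        using h h' by (auto intro!: group_hom.intro group_hom_axioms.intro K group_free_group)
      with False show ?thesis
        using a eq by (simp add: inv group_hom.hom_inv free_group_gen_closed)
    qed
  qed
qed

lemma group_free_product:
  assumes G: "Group.group G" and H: "Group.group H"
  shows "Group.group (free_product G H)"
  unfolding free_product_def
proof (rule group_presented)
  interpret G: Group.group G by fact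
  interpret H: Group.group H by fact
  let ?A = "carrier G <+> carrier H" and ?R = "free_product_rels G H"
  note st = word_cong_step[of _ _ ?R ?A "[]" "[]"]
  fix a assume "a \<in> ?A"
  then consider x where "a = Inl x" "x \<in> carrier G" | y where "a = Inr y" "y \<in> carrier H" by auto
  then show "\<exists>w \<in> lists ?A. word_cong ?A ?R (w @ [a]) []"
  proof cases
    case 1
    have "([Inl (inv\<^bsub>G\<^esub> x), Inl x], [Inl (inv\<^bsub>G\<^esub> x \<otimes>\<^bsub>G\<^esub> x)]) \<in> ?R"
      unfolding free_product_rels_def using 1 by blast
    from st[OF this] have "word_cong ?A ?R [Inl (inv\<^bsub>G\<^esub> x), Inl x] [Inl \<one>\<^bsub>G\<^esub>]"
      using 1 by (simp add: InlI)
    moreover have "word_cong ?A ?R [Inl \<one>\<^bsub>G\<^esub>] []"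
      using st[of "[Inl \<one>\<^bsub>G\<^esub>]" "[]"] by (simp add: free_product_rels_def InlI)
    ultimately show ?thesis using 1
      by (intro bexI[of _ "[Inl (inv\<^bsub>G\<^esub> x)]"]) (auto intro: word_cong_trans)
  next
    case 2
    have "([Inr (inv\<^bsub>H\<^esub> y), Inr y], [Inr (inv\<^bsub>H\<^esub> y \<otimes>\<^bsub>H\<^esub> y)]) \<in> ?R"
      unfolding free_product_rels_def using 2 by blast
    from st[OF this] have "word_cong ?A ?R [Inr (inv\<^bsub>H\<^esub> y), Inr y] [Inr \<one>\<^bsub>H\<^esub>]"
      using 2 by (simp add: InrI)
    moreover have "word_cong ?A ?R [Inr \<one>\<^bsub>H\<^esub>] []"
      using st[of "[Inr \<one>\<^bsub>H\<^esub>]" "[]"] by (simp add: free_product_rels_def InrI)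
    ultimately show ?thesis using 2
      by (intro bexI[of _ "[Inr (inv\<^bsub>H\<^esub> y)]"]) (auto intro: word_cong_trans)
  qed
qed

lemma free_product_inl_hom:
  assumes "Group.group G" shows "free_product_inl G H \<in> hom G (free_product G H)"
proof (rule homI)
  interpret G: Group.group G by fact
  fix x assume x: "x \<in> carrier G"
  then show "free_product_inl G H x \<in> carrier (free_product G H)"
    by (auto simp: free_product_inl_def free_product_def intro!: word_class_in_carrier)
  fix y assume y: "y \<in> carrier G"
  let ?A = "carrier G <+> carrier H" and ?R = "free_product_rels G H"
  have "([Inl x, Inl y], [Inl (x \<otimes>\<^bsub>G\<^esub> y)]) \<in> ?R"
    unfolding free_product_rels_def using x y by blast
  from word_cong_step[OF this, of ?A "[]" "[]"] x y
  show "free_product_inl G H (x \<otimes>\<^bsub>G\<^esub> y) =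
      free_product_inl G H x \<otimes>\<^bsub>free_product G H\<^esub> free_product_inl G H y"
    by (simp add: free_product_inl_def free_product_def presented_mult InlI word_class_eq_iff
        word_cong_sym)
qed

lemma free_product_inr_hom:
  assumes "Group.group H" shows "free_product_inr G H \<in> hom H (free_product G H)"
proof (rule homI)
  interpret H: Group.group H by fact
  fix x assume x: "x \<in> carrier H"
  then show "free_product_inr G H x \<in> carrier (free_product G H)"
    by (auto simp: free_product_inr_def free_product_def intro!: word_class_in_carrier)
  fix y assume y: "y \<in> carrier H"
  let ?A = "carrier G <+> carrier H" and ?R = "free_product_rels G H"
  have "([Inr x, Inr y], [Inr (x \<otimes>\<^bsub>H\<^esub> y)]) \<in> ?R"
    unfolding free_product_rels_def using x y by blast
  from word_cong_step[OF this, of ?A "[]" "[]"] x y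
  show "free_product_inr G H (x \<otimes>\<^bsub>H\<^esub> y) =
      free_product_inr G H x \<otimes>\<^bsub>free_product G H\<^esub> free_product_inr G H y"
    by (simp add: free_product_inr_def free_product_def presented_mult InrI word_class_eq_iff
        word_cong_sym)
qed

lemma free_product_lift:
  assumes G: "Group.group G" and H: "Group.group H" and K: "Group.group K"
    and f: "f \<in> hom G K" and g: "g \<in> hom H K"
  obtains h where "h \<in> hom (free_product G H) K"
    "\<And>x. x \<in> carrier G \<Longrightarrow> h (free_product_inl G H x) = f x"
    "\<And>y. y \<in> carrier H \<Longrightarrow> h (free_product_inr G H y) = g y"
proof -
  interpret K: Group.group K by fact
  let ?A = "carrier G <+> carrier H" and ?R = "free_product_rels G H"
  have fc: "\<And>x. x \<in> carrier G \<Longrightarrow> f x \<in> carrier K" and gc: "\<And>y. y \<in> carrier H \<Longrightarrow> g y \<in> carrier K"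
    using f g by (auto simp: hom_def)
  obtain h where h: "h \<in> hom (free_product G H) K"
    and h': "\<And>u. u \<in> lists ?A \<Longrightarrow> h (word_class ?A ?R u) = word_prod K (map (case_sum f g) u)"
    unfolding free_product_def
  proof (rule presented_lift[OF K.is_monoid, of "case_sum f g" ?A ?R])
    show "case_sum f g \<in> ?A \<rightarrow> carrier K" using fc gc by auto
  next
    fix l r assume "(l, r) \<in> ?R"
    then show "word_prod K (map (case_sum f g) l) = word_prod K (map (case_sum f g) r)"
      using f g fc gc hom_one[OF f G K] hom_one[OF g H K]
      by (auto simp: free_product_rels_def word_prod_def hom_mult)
  qed blast
  have "h (free_product_inl G H x) = f x" if "x \<in> carrier G" for x
    using h'[of "[Inl x]"] that fc by (auto simp: free_product_inl_def word_prod_def)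
  moreover have "h (free_product_inr G H y) = g y" if "y \<in> carrier H" for y
    using h'[of "[Inr y]"] that gc by (auto simp: free_product_inr_def word_prod_def)
  ultimately show thesis using h that by blast
qed

lemma free_product_hom_eqI:
  assumes G: "Group.group G" and H: "Group.group H" and K: "Group.group K"
    and h: "h \<in> hom (free_product G H) K" and h': "h' \<in> hom (free_product G H) K"
    and eq: "\<And>x. x \<in> carrier G \<Longrightarrow> h (free_product_inl G H x) = h' (free_product_inl G H x)"
      "\<And>y. y \<in> carrier H \<Longrightarrow> h (free_product_inr G H y) = h' (free_product_inr G H y)"
    and X: "X \<in> carrier (free_product G H)"
  shows "h X = h' X"
proof (rule presented_hom_eqI[OF K, of "carrier G <+> carrier H" "free_product_rels G H",
      folded free_product_def, OF group_free_product[OF G H] h h' _ X])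
  let ?c = "word_class (carrier G <+> carrier H) (free_product_rels G H)"
  fix a assume "a \<in> carrier G <+> carrier H"
  then show "h (?c [a]) = h' (?c [a])"
  proof (rule PlusE)
    fix x assume "x \<in> carrier G" "a = Inl x"
    then show ?thesis using eq(1) by (simp add: free_product_inl_def)
  next
    fix y assume "y \<in> carrier H" "a = Inr y"
    then show ?thesis using eq(2) by (simp add: free_product_inr_def)
  qed
qed


section \<open>Systems of equations and algebraic sets\<close>

text \<open>The group \<open>G * F\<^sub>d\<close>, with the free group \<open>F\<^sub>d\<close> on \<open>X\<^sub>1, \<dots>, X\<^sub>d\<close>.\<close>

definition equation_group ::
  "('a, 'b) monoid_scheme \<Rightarrow> nat \<Rightarrow> ('a + (nat \<times> bool) list set) list set monoid" where
  "equation_group G d = free_product G (free_group {1..d})"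

definition equation_const ::
  "('a, 'b) monoid_scheme \<Rightarrow> nat \<Rightarrow> 'a \<Rightarrow> ('a + (nat \<times> bool) list set) list set" where
  "equation_const G d = free_product_inl G (free_group {1..d})"

definition equation_var ::
  "('a, 'b) monoid_scheme \<Rightarrow> nat \<Rightarrow> nat \<Rightarrow> ('a + (nat \<times> bool) list set) list set" where
  "equation_var G d i = free_product_inr G (free_group {1..d}) (free_group_gen {1..d} i)"

text \<open>\<open>substitution G d g\<close> is the homomorphism \<open>w \<mapsto> w(g\<^sub>1, \<dots>, g\<^sub>d)\<close>. It is made unique as a HOL
  function by requiring it to be \<^const>\<open>undefined\<close> outside the carrier.\<close>

definition is_substitution ::
  "('a, 'b) monoid_scheme \<Rightarrow> nat \<Rightarrow> (nat \<Rightarrow> 'a) \<Rightarrow>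
    (('a + (nat \<times> bool) list set) list set \<Rightarrow> 'a) \<Rightarrow> bool" where
  "is_substitution G d g h \<longleftrightarrow>
     h \<in> hom (equation_group G d) G \<and> h \<in> extensional (carrier (equation_group G d)) \<and>
     (\<forall>a \<in> carrier G. h (equation_const G d a) = a) \<and>
     (\<forall>i \<in> {1..d}. h (equation_var G d i) = g i)"

definition substitution ::
  "('a, 'b) monoid_scheme \<Rightarrow> nat \<Rightarrow> (nat \<Rightarrow> 'a) \<Rightarrow>
    ('a + (nat \<times> bool) list set) list set \<Rightarrow> 'a" where
  "substitution G d g = (THE h. is_substitution G d g h)"

lemma ex1_substitution:
  assumes G: "Group.group G" and g: "g \<in> {1..d} \<rightarrow> carrier G"
  shows "\<exists>!h. is_substitution G d g h"
proof -
  let ?F = "free_group {1..d}"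
  note F = group_free_group[of "{1..d}"]
  obtain k where k: "k \<in> hom ?F G" "\<And>i. i \<in> {1..d} \<Longrightarrow> k (free_group_gen {1..d} i) = g i"
    using free_group_lift[OF G g] by blast
  have "(\<lambda>x. x) \<in> hom G G" by (auto simp: hom_def)
  from free_product_lift[OF G F G this k(1)] obtain h where h: "h \<in> hom (equation_group G d) G"
    "\<And>x. x \<in> carrier G \<Longrightarrow> h (equation_const G d x) = x"
    "\<And>y. y \<in> carrier ?F \<Longrightarrow> h (free_product_inr G ?F y) = k y"
    unfolding equation_group_def equation_const_def by metis
  have const: "equation_const G d x \<in> carrier (equation_group G d)" if "x \<in> carrier G" for x
    using hom_in_carrier[OF free_product_inl_hom[OF G] that]
    by (simp add: equation_const_def equation_group_def)
  have var: "equation_var G d i \<in> carrier (equation_group G d)" if "i \<in> {1..d}" for i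
    using hom_in_carrier[OF free_product_inr_hom[OF F] free_group_gen_closed[OF that]]
    by (simp add: equation_var_def equation_group_def)
  have E: "Group.group (equation_group G d)"
    unfolding equation_group_def by (rule group_free_product[OF G F])
  show ?thesis
  proof (rule ex1I)
    show "is_substitution G d g (restrict h (carrier (equation_group G d)))"
      unfolding is_substitution_def
    proof (intro conjI ballI)
      show "restrict h (carrier (equation_group G d)) \<in> hom (equation_group G d) G"
        using h(1) group.is_monoid[OF E] by (auto simp: hom_def monoid.m_closed)
      fix i assume i: "i \<in> {1..d}"
      have "h (equation_var G d i) = g i"
        unfolding equation_var_def using h(3) k(2)[OF i] free_group_gen_closed[OF i] by metis
      then show "restrict h (carrier (equation_group G d)) (equation_var G d i) = g i"
        using var[OF i] by simp
    qed (use h const in auto)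
  next
    fix h1 assume h1: "is_substitution G d g h1"
    have "h1 X = h X" if X: "X \<in> carrier (equation_group G d)" for X
    proof (rule free_product_hom_eqI[OF G F G])
      show "h1 \<in> hom (free_product G ?F) G" "h \<in> hom (free_product G ?F) G"
        "X \<in> carrier (free_product G ?F)"
        using h1 h(1) X by (auto simp: is_substitution_def equation_group_def)
      show "h1 (free_product_inl G ?F x) = h (free_product_inl G ?F x)" if "x \<in> carrier G" for x
        using h1 h(2) that by (auto simp: is_substitution_def equation_const_def)
      have "h1 \<in> hom (free_product G ?F) G" using h1 by (auto simp: is_substitution_def equation_group_def)
      from hom_compose[OF free_product_inr_hom[OF F] this]
      have c: "(\<lambda>y. h1 (free_product_inr G ?F y)) \<in> hom ?F G" by (simp add: o_def)
      fix y assume y: "y \<in> carrier ?F"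
      have "h1 (free_product_inr G ?F y) = k y"
        by (rule free_group_hom_eqI[OF G c k(1) _ y])
          (use h1 k(2) in \<open>auto simp: is_substitution_def equation_var_def\<close>)
      with h(3)[OF y] show "h1 (free_product_inr G ?F y) = h (free_product_inr G ?F y)" by simp
    qed
    then show "h1 = restrict h (carrier (equation_group G d))"
      using h1 by (auto simp: is_substitution_def intro: extensionalityI)
  qed
qed

text \<open>\<open>G\<^sup>d\<close> consists of the functions \<open>{1..d} \<rightarrow>\<^sub>E carrier G\<close>.\<close>

definition solutions ::
  "('a, 'b) monoid_scheme \<Rightarrow> nat \<Rightarrow> ('a + (nat \<times> bool) list set) list set set \<Rightarrow> (nat \<Rightarrow> 'a) set" where
  "solutions G d W =
     {g \<in> {1..d} \<rightarrow>\<^sub>E carrier G. \<forall>w \<in> W. substitution G d g w = \<one>\<^bsub>G\<^esub>}"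

definition algebraic_set :: "('a, 'b) monoid_scheme \<Rightarrow> nat \<Rightarrow> (nat \<Rightarrow> 'a) set \<Rightarrow> bool" where
  "algebraic_set G d U \<longleftrightarrow>
     (\<exists>W. finite W \<and> W \<subseteq> carrier (equation_group G d) \<and> U = solutions G d W)"


section \<open>Weights\<close>

definition weight ::
  "('a, 'b) monoid_scheme \<Rightarrow> 'a set \<Rightarrow> ('a \<Rightarrow> nat) \<Rightarrow> 'a \<Rightarrow> enat" where
  "weight G S \<omega> g = (INF ws \<in> {ws \<in> lists S. word_prod G ws = g}. enat (sum_list (map \<omega> ws)))"

lemma weight_eq_enatE:
  assumes "weight G S \<omega> g = enat n"
  obtains ws where "ws \<in> lists S" "word_prod G ws = g" "sum_list (map \<omega> ws) = n"
proof -
  let ?E = "(\<lambda>ws. enat (sum_list (map \<omega> ws))) ` {ws \<in> lists S. word_prod G ws = g}"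
  have W: "Inf ?E = enat n" using assms unfolding weight_def .
  have "?E \<noteq> {}"
  proof
    assume E: "?E = {}"
    show False using W unfolding E by (simp add: Inf_enat_def)
  qed
  then have "Inf ?E = (LEAST m. m \<in> ?E)" by (simp only: Inf_enat_def if_False)
  moreover obtain m where "m \<in> ?E" using \<open>?E \<noteq> {}\<close> by blast
  ultimately have "Inf ?E \<in> ?E" using LeastI[of "\<lambda>m. m \<in> ?E" m] by simp
  then obtain ws where "ws \<in> lists S" "word_prod G ws = g" "enat n = enat (sum_list (map \<omega> ws))"
    unfolding W by blast
  then show thesis using that by simp
qed

lemma finite_weight_eq_enat:
  assumes S: "finite S" and \<omega>: "\<And>s. s \<in> S \<Longrightarrow> 0 < \<omega> s"
  shows "finite {g. weight G S \<omega> g = enat n}"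
proof (rule finite_subset)
  have len: "length ws \<le> sum_list (map \<omega> ws)" if "ws \<in> lists S" for ws
    using that by (induction ws) (auto dest: \<omega>)
  show "{g. weight G S \<omega> g = enat n} \<subseteq> word_prod G ` {ws. set ws \<subseteq> S \<and> length ws \<le> n}"
  proof
    fix g assume "g \<in> {g. weight G S \<omega> g = enat n}"
    then obtain ws where "ws \<in> lists S" "word_prod G ws = g" "sum_list (map \<omega> ws) = n"
      by (auto elim: weight_eq_enatE)
    with len[of ws] show "g \<in> word_prod G ` {ws. set ws \<subseteq> S \<and> length ws \<le> n}" by auto
  qed
  show "finite (word_prod G ` {ws. set ws \<subseteq> S \<and> length ws \<le> n})"
    using finite_lists_length_le[OF S] by simp
qed


section \<open>Multivariate power series\<close>

text \<open>A monomial \<open>\<Prod>i. z\<^sub>i ^ e\<^sub>i\<close> is given by its exponent vector \<open>e :: nat \<Rightarrow>\<^sub>0 nat\<close>. Polynomials are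
  elements of the ring \<open>(nat \<Rightarrow>\<^sub>0 nat) \<Rightarrow>\<^sub>0 int\<close>, whose multiplication is convolution; power series are
  arbitrary coefficient functions.\<close>

abbreviation (input) "lookup \<equiv> Poly_Mapping.lookup"
abbreviation (input) "keys \<equiv> Poly_Mapping.keys"

type_synonym mseries = "(nat \<Rightarrow>\<^sub>0 nat) \<Rightarrow> int"
type_synonym mpolynomial = "(nat \<Rightarrow>\<^sub>0 nat) \<Rightarrow>\<^sub>0 int"

definition mseries_times :: "mseries \<Rightarrow> mseries \<Rightarrow> mseries" where
  "mseries_times f g e = (\<Sum>(a, b) | a + b = e. f a * g b)"

definition in_variables :: "nat \<Rightarrow> mpolynomial \<Rightarrow> bool" where
  "in_variables d P \<longleftrightarrow> (\<forall>e \<in> keys P. keys e \<subseteq> {1..d})"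

definition rational_series :: "nat \<Rightarrow> mseries \<Rightarrow> bool" where
  "rational_series d f \<longleftrightarrow>
     (\<exists>P Q :: mpolynomial. in_variables d P \<and> in_variables d Q \<and> Q \<noteq> 0 \<and>
        mseries_times (lookup Q) f = lookup P)"

lemma finite_exponent_splits: "finite {(a, b). a + b = (e :: nat \<Rightarrow>\<^sub>0 nat)}"
proof -
  let ?B = "\<Union>i \<in> keys e. {..lookup e i}"
  let ?F = "{f. \<forall>i. (i \<in> keys e \<longrightarrow> f i \<in> ?B) \<and> (i \<notin> keys e \<longrightarrow> f i = 0)}"
  have F: "finite ?F" by (rule finite_set_of_finite_funs) auto
  have le: "lookup a \<in> ?F" if a: "\<And>i. lookup a i \<le> lookup e i" for a :: "nat \<Rightarrow>\<^sub>0 nat"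
  proof -
    have "lookup a i \<in> ?B" if "i \<in> keys e" for i
      using that a[of i] by blast
    moreover have "lookup a i = 0" if "i \<notin> keys e" for i
      using that a[of i] by (simp add: in_keys_iff)
    ultimately show ?thesis by blast
  qed
  have "finite (lookup -` ?F)" using F
    by (rule finite_vimageI) (rule injI, simp only: lookup_inject)
  then have "finite (lookup -` ?F \<times> lookup -` ?F)"
    by (intro finite_cartesian_product)
  moreover have "{(a, b). a + b = e} \<subseteq> lookup -` ?F \<times> lookup -` ?F"
  proof (rule subrelI)
    fix a b assume "(a, b) \<in> {(a, b). a + b = e}"
    then have e: "e = a + b" by simp
    have "lookup a \<in> ?F" by (rule le) (simp add: e lookup_add)
    moreover have "lookup b \<in> ?F" by (rule le) (simp add: e lookup_add)
    ultimately show "(a, b) \<in> lookup -` ?F \<times> lookup -` ?F" by (intro SigmaI vimageI2)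
  qed
  ultimately show ?thesis by (rule finite_subset[rotated])
qed

lemma mseries_times_lookup:
  "mseries_times (lookup P) (lookup Q) = lookup (P * Q)" for P Q :: mpolynomial
proof
  fix e
  have "lookup (P * Q) e = (\<Sum>(a, b). lookup P a * lookup Q b when e = a + b)"
    by (transfer fixing: e) (rule prod_fun_unfold_prod)
  also have "\<dots> = (\<Sum>(a, b) | a + b = e. lookup P a * lookup Q b when e = a + b)"
    by (rule Sum_any.expand_superset[OF finite_exponent_splits]) auto
  also have "\<dots> = mseries_times (lookup P) (lookup Q) e"
    unfolding mseries_times_def by (rule sum.cong) auto
  finally show "mseries_times (lookup P) (lookup Q) e = lookup (P * Q) e" by simp
qed


section \<open>The multivariate growth series\<close>

fun var_power :: "nat \<Rightarrow> enat \<Rightarrow> mpolynomial" where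
  "var_power i (enat n) = Poly_Mapping.single (Poly_Mapping.single i n) 1"
| "var_power i \<infinity> = 0"

definition growth_monomial ::
  "('a, 'b) monoid_scheme \<Rightarrow> 'a set \<Rightarrow> ('a \<Rightarrow> nat) \<Rightarrow> nat \<Rightarrow> (nat \<Rightarrow> 'a) \<Rightarrow> mpolynomial" where
  "growth_monomial G S \<omega> d x = (\<Prod>i = 1..d. var_power i (weight G S \<omega> (x i)))"

text \<open>The sum over \<open>U\<close> is taken coefficientwise; lemma \<open>finite_growth_support\<close> below shows that each
  coefficient receives only finitely many nonzero contributions.\<close>

definition growth_series ::
  "('a, 'b) monoid_scheme \<Rightarrow> 'a set \<Rightarrow> ('a \<Rightarrow> nat) \<Rightarrow> nat \<Rightarrow> (nat \<Rightarrow> 'a) set \<Rightarrow> mseries" where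
  "growth_series G S \<omega> d U e =
     (\<Sum>x | x \<in> U \<and> lookup (growth_monomial G S \<omega> d x) e \<noteq> 0.
        lookup (growth_monomial G S \<omega> d x) e)"

lemma growth_monomial_infinite:
  "i \<in> {1..d} \<Longrightarrow> weight G S \<omega> (x i) = \<infinity> \<Longrightarrow> growth_monomial G S \<omega> d x = 0"
  unfolding growth_monomial_def by (rule prod_zero) (auto intro: bexI[of _ i])

lemma growth_monomial_finite:
  assumes "\<And>i. i \<in> {1..d} \<Longrightarrow> weight G S \<omega> (x i) = enat (n i)"
  shows "growth_monomial G S \<omega> d x = Poly_Mapping.single (\<Sum>i = 1..d. Poly_Mapping.single i (n i)) 1"
proof -
  have *: "(\<Prod>i \<in> I. var_power i (enat (n i))) = Poly_Mapping.single (\<Sum>i \<in> I. Poly_Mapping.single i (n i)) 1"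
    if "finite I" for I :: "nat set"
    using that by (induction I) (auto simp: Poly_Mapping.mult_single)
  have "growth_monomial G S \<omega> d x = (\<Prod>i = 1..d. var_power i (enat (n i)))"
    unfolding growth_monomial_def by (rule prod.cong) (simp_all only: assms)
  also note *[OF finite_atLeastAtMost]
  finally show ?thesis .
qed

lemma lookup_growth_monomial:
  "lookup (growth_monomial G S \<omega> d x) e =
     (if keys e \<subseteq> {1..d} \<and> (\<forall>i \<in> {1..d}. weight G S \<omega> (x i) = enat (lookup e i)) then 1 else 0)"
proof (cases "\<exists>i \<in> {1..d}. weight G S \<omega> (x i) = \<infinity>")
  case True
  then show ?thesis by (auto simp: growth_monomial_infinite)
next
  case False
  then have "\<exists>n. \<forall>i \<in> {1..d}. weight G S \<omega> (x i) = enat (n i)"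
    by (intro bchoice) auto
  then obtain n where n: "\<And>i. i \<in> {1..d} \<Longrightarrow> weight G S \<omega> (x i) = enat (n i)" by blast
  have lk: "lookup (\<Sum>i = 1..d. Poly_Mapping.single i (n i)) j = (if j \<in> {1..d} then n j else 0)" for j
    by (simp add: Poly_Mapping.lookup_sum lookup_single when_def)
  have "(\<Sum>i = 1..d. Poly_Mapping.single i (n i)) = e \<longleftrightarrow>
      keys e \<subseteq> {1..d} \<and> (\<forall>i \<in> {1..d}. n i = lookup e i)"
    unfolding poly_mapping_eq_iff fun_eq_iff lk by (simp only: subset_iff in_keys_iff) metis
  moreover have "lookup (growth_monomial G S \<omega> d x) e =
      (if (\<Sum>i = 1..d. Poly_Mapping.single i (n i)) = e then 1 else 0)"
    by (simp only: growth_monomial_finite[OF n] lookup_single when_def)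
  moreover have "(\<forall>i \<in> {1..d}. weight G S \<omega> (x i) = enat (lookup e i)) \<longleftrightarrow>
      (\<forall>i \<in> {1..d}. n i = lookup e i)"
  proof (rule ball_cong[OF refl])
    fix i assume "i \<in> {1..d}"
    then show "weight G S \<omega> (x i) = enat (lookup e i) \<longleftrightarrow> n i = lookup e i"
      unfolding n[OF \<open>i \<in> {1..d}\<close>] by simp
  qed
  ultimately show ?thesis by (simp only:)
qed

lemma finite_growth_support:
  assumes "finite S" "\<And>s. s \<in> S \<Longrightarrow> 0 < \<omega> s" "U \<subseteq> {1..d} \<rightarrow>\<^sub>E carrier G"
  shows "finite {x \<in> U. lookup (growth_monomial G S \<omega> d x) e \<noteq> 0}"
proof (rule finite_subset)
  show "{x \<in> U. lookup (growth_monomial G S \<omega> d x) e \<noteq> 0} \<subseteq>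
      (\<Pi>\<^sub>E i \<in> {1..d}. {g. weight G S \<omega> g = enat (lookup e i)})"
  proof
    fix x assume x: "x \<in> {x \<in> U. lookup (growth_monomial G S \<omega> d x) e \<noteq> 0}"
    then have "\<forall>i \<in> {1..d}. weight G S \<omega> (x i) = enat (lookup e i)"
      by (simp add: lookup_growth_monomial split: if_splits)
    moreover have "x \<in> extensional {1..d}" using x assms(3) unfolding PiE_def by blast
    ultimately show "x \<in> (\<Pi>\<^sub>E i \<in> {1..d}. {g. weight G S \<omega> g = enat (lookup e i)})"
      by (simp add: PiE_iff)
  qed
  show "finite (\<Pi>\<^sub>E i \<in> {1..d}. {g. weight G S \<omega> g = enat (lookup e i)})"
    using assms(1,2) by (intro finite_PiE finite_weight_eq_enat) auto
qed

lemma growth_series_eq_card: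
  "growth_series G S \<omega> d U e =
     (if keys e \<subseteq> {1..d}
      then int (card {x \<in> U. \<forall>i \<in> {1..d}. weight G S \<omega> (x i) = enat (lookup e i)}) else 0)"
proof (cases "keys e \<subseteq> {1..d}")
  case True
  have "growth_series G S \<omega> d U e =
      (\<Sum>x | x \<in> U \<and> (\<forall>i \<in> {1..d}. weight G S \<omega> (x i) = enat (lookup e i)). 1)"
    unfolding growth_series_def using True
    by (intro sum.cong) (auto simp add: lookup_growth_monomial split: if_splits)
  with True show ?thesis by simp
qed (simp add: growth_series_def lookup_growth_monomial)

end

theory Submission
  imports Defs "HOL-Library.Multiset" "HOL-Algebra.Divisibility"
    "HOL-Algebra.FiniteProduct" "HOL-Algebra.Product_Groups"
begin

text \<open>
  Let \<open>N\<close> be an abelian normal subgroup of finite index in \<open>G\<close>. All coordinates are treated at once,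
  in the group \<open>G\<^sup>d\<close> with its abelian normal subgroup \<open>N\<^sup>d\<close> of finite index. Choose
  representatives of the cosets of \<open>N\<^sup>d\<close>, and let \<open>M\<close> be the commutative cancellative monoid of
  the pairs \<open>(n, a)\<close> of an exponent vector \<open>n\<close> and some \<open>a \<in> N\<^sup>d\<close>, where \<open>n = 0\<close> only if \<open>a = 1\<close>.

  \<^emph>\<open>Words become walks.\<close> Multiplying a tuple by a letter in one coordinate moves it from the
  coset of a representative \<open>q\<close> to the coset of another representative \<open>q'\<close> and changes its
  \<open>N\<^sup>d\<close>-part by the factor \<open>q s q'\<^sup>-\<^sup>1\<close>. Hence the pairs \<open>(n, a)\<close> such that \<open>a q\<close> is represented by
  words of weights \<open>n\<close> are the labels of the walks from \<open>1\<close> to \<open>q\<close> in a finite graph with edge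
  labels in \<open>M\<close>. By Kleene's algorithm these labels form a rational subset of \<open>M\<close>, and because
  \<open>M\<close> is commutative the star of a finite union of linear sets is again one: the set of labels is
  semilinear (\<open>semilinear_paths\<close>).

  \<^emph>\<open>Equations become linear.\<close> Conjugation by an element of \<open>G\<close> is an automorphism of the abelian
  group \<open>N\<close>, so for fixed \<open>x\<close> every word \<open>w\<close> with constants satisfies \<open>w(a x) = \<delta>(a) w(x)\<close> with a
  homomorphism \<open>\<delta>\<close> from \<open>N\<^sup>d\<close> to \<open>N\<close> (\<open>substitution_displacement\<close>). Within one coset the
  solutions, if there are any, therefore form a coset of a subgroup of \<open>N\<^sup>d\<close>. Intersecting with such a set preserves
  semilinearity, because by Dickson's lemma the solutions of a linear system in nonnegative integers
  form a finitely generated module over the finitely generated monoid of the homogeneous solutions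
  (\<open>fg_set_parametrized\<close>).

  \<^emph>\<open>Minimal weights are a set difference.\<close> If \<open>X\<close> is the semilinear set of all \<open>(n, a)\<close> with
  \<open>a q \<in> U\<close> represented by words of weights \<open>n\<close>, then the weight of the tuple \<open>a q\<close> is \<open>n\<close> exactly
  if \<open>(n, a)\<close> lies in \<open>X\<close> but not in the product of \<open>X\<close> with \<open>{(m, 1) | m \<noteq> 0}\<close>. So the growth series
  is a finite sum of generating functions of differences of two semilinear sets.

  \<^emph>\<open>Counting.\<close> Call a set of the form \<open>F P\<^sup>*\<close>, with \<open>F\<close> and \<open>P\<close> finite, finitely generated. These
  sets are closed under intersection, again by Dickson's lemma. Hence the indicator function of
  a difference of semilinear sets is an integer combination of indicator functions of finitely
  generated sets, and only the generating function of one such set \<open>X\<close> is needed. It is rational by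
  the argument of the Hilbert--Serre theorem (\<open>rational_series_stable_diff\<close>): multiplication by
  \<open>p \<in> P\<close> is injective and multiplies the generating function by a monomial, and what is left of
  \<open>X\<close> outside \<open>p X\<close> is generated without \<open>p\<close>.
\<close>

section \<open>Rational power series\<close>

text \<open>Convolution of a series with polynomials is an action of the polynomial ring; this is what
  allows fractions to be added by cross-multiplication.\<close>
lemma mseries_times_assoc:
  "mseries_times (lookup P) (mseries_times (lookup Q) f) = mseries_times (lookup (P * Q)) f"
  for P Q :: mpolynomial
proof
  fix e :: "nat \<Rightarrow>\<^sub>0 nat"
  let ?T = "{(a, b, c). a + b + c = e}"
  have "mseries_times (lookup P) (mseries_times (lookup Q) f) e =
      (\<Sum>(a, y) | a + y = e. \<Sum>(b, c) | b + c = y. lookup P a * (lookup Q b * f c))"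
    by (simp add: mseries_times_def sum_distrib_left case_prod_unfold)
  also have "\<dots> = (\<Sum>(a, b, c)\<in>?T. lookup P a * (lookup Q b * f c))"
    unfolding case_prod_unfold
    by (subst sum.Sigma)
      (auto intro!: finite_exponent_splits[unfolded case_prod_unfold] finite_exponent_splits
        sum.reindex_bij_witness[where i = "\<lambda>(a, b, c). ((a, b + c), (b, c))"
          and j = "\<lambda>((a, y), (b, c)). (a, b, c)"] simp: add.assoc)
  also have "\<dots> = (\<Sum>(x, c) | x + c = e. \<Sum>(a, b) | a + b = x. lookup P a * lookup Q b * f c)"
    unfolding case_prod_unfold
    by (subst sum.Sigma)
      (auto intro!: finite_exponent_splits[unfolded case_prod_unfold] finite_exponent_splits
        sum.reindex_bij_witness[where j = "\<lambda>(a, b, c). ((a + b, c), (a, b))"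
          and i = "\<lambda>((x, c), (a, b)). (a, b, c)"] simp: add.assoc)
  also have "\<dots> = mseries_times (lookup (P * Q)) f e"
    by (simp add: mseries_times_def sum_distrib_right case_prod_unfold flip: mseries_times_lookup)
  finally show "mseries_times (lookup P) (mseries_times (lookup Q) f) e =
      mseries_times (lookup (P * Q)) f e" .
qed

lemma mseries_times_diff_right:
  "mseries_times f (\<lambda>e. g e - h e) = (\<lambda>e. mseries_times f g e - mseries_times f h e)"
  by (simp add: mseries_times_def sum_subtractf case_prod_unfold algebra_simps fun_eq_iff)

lemma mseries_times_lookup_diff:
  "mseries_times (lookup (P - Q)) f =
     (\<lambda>e. mseries_times (lookup P) f e - mseries_times (lookup Q) f e)" for P Q :: mpolynomial
  by (simp add: mseries_times_def lookup_minus sum_subtractf case_prod_unfold algebra_simps fun_eq_iff)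

lemma mseries_times_monomial:
  "mseries_times (lookup (Poly_Mapping.single m 1)) f e =
     (if \<exists>b. m + b = e then f (THE b. m + b = e) else 0)"
proof -
  have "mseries_times (lookup (Poly_Mapping.single m 1)) f e =
      (\<Sum>(a, b) | a + b = e \<and> a = m. f b)"
    unfolding mseries_times_def
    by (rule sum.mono_neutral_cong_right)
      (auto simp: finite_exponent_splits lookup_single when_def split: if_splits)
  also have "\<dots> = (if \<exists>b. m + b = e then f (THE b. m + b = e) else 0)"
  proof (cases "\<exists>b. m + b = e")
    case True
    then obtain b where b: "m + b = e" by blast
    then have "{(a, b). a + b = e \<and> a = m} = {(m, b)}" "(THE b. m + b = e) = b"
      by (auto simp: b[symmetric])
    with b show ?thesis by auto
  next
    case False
    then have "{(a, b). a + b = e \<and> a = m} = {}" by auto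
    then show ?thesis unfolding if_not_P[OF False] by (simp only: sum.empty)
  qed
  finally show ?thesis .
qed

lemma mseries_times_one: "mseries_times (lookup (1 :: mpolynomial)) f = f"
  using mseries_times_monomial[of 0 f] by (simp add: fun_eq_iff)

lemma in_variables_diff: "in_variables d P \<Longrightarrow> in_variables d Q \<Longrightarrow> in_variables d (P - Q)"
  unfolding in_variables_def using keys_diff[of P Q] by blast

lemma in_variables_mult:
  assumes "in_variables d P" "in_variables d Q" shows "in_variables d (P * Q)"
  unfolding in_variables_def
proof
  fix e assume "e \<in> keys (P * Q)"
  then obtain a b where "a \<in> keys P" "b \<in> keys Q" "e = a + b"
    using Poly_Mapping.keys_mult[of P Q] by blast
  then show "keys e \<subseteq> {1..d}"
    using assms Poly_Mapping.keys_add[of a b] unfolding in_variables_def by blast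
qed

lemma in_variables_single: "keys m \<subseteq> {1..d} \<Longrightarrow> in_variables d (Poly_Mapping.single m c)"
  by (simp add: in_variables_def)

lemma in_variables_one: "in_variables d 1"
  using in_variables_single[of 0 d 1] by simp

lemma rational_series_lookup: "in_variables d P \<Longrightarrow> rational_series d (lookup P)"
  unfolding rational_series_def using in_variables_one mseries_times_one zero_neq_one by metis

lemma rational_series_zero: "rational_series d (\<lambda>e. 0)"
  using rational_series_lookup[of d 0] by (simp add: in_variables_def zero_poly_mapping.rep_eq)

lemma rational_series_times_cancel:
  assumes "in_variables d Q" "Q \<noteq> 0" "rational_series d (mseries_times (lookup Q) f)"
  shows "rational_series d f"
proof -
  obtain P Q' where *: "in_variables d P" "in_variables d Q'" "Q' \<noteq> 0"
    "mseries_times (lookup Q') (mseries_times (lookup Q) f) = lookup P"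
    using assms(3) unfolding rational_series_def by blast
  then have "mseries_times (lookup (Q' * Q)) f = lookup P" by (simp only: mseries_times_assoc)
  moreover have "in_variables d (Q' * Q)" "Q' * Q \<noteq> 0" using * assms by (auto intro: in_variables_mult)
  ultimately show ?thesis unfolding rational_series_def using * by blast
qed

lemma rational_series_times:
  assumes "in_variables d R" "rational_series d f"
  shows "rational_series d (mseries_times (lookup R) f)"
proof -
  obtain P Q where *: "in_variables d P" "in_variables d Q" "Q \<noteq> 0"
    "mseries_times (lookup Q) f = lookup P"
    using assms(2) unfolding rational_series_def by blast
  have "mseries_times (lookup Q) (mseries_times (lookup R) f) =
      mseries_times (lookup R) (mseries_times (lookup Q) f)"
    by (simp only: mseries_times_assoc mult.commute)
  also have "\<dots> = lookup (R * P)" by (simp only: * mseries_times_lookup)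
  finally show ?thesis
    unfolding rational_series_def using * assms(1) in_variables_mult by blast
qed

lemma rational_series_diff:
  assumes "rational_series d f" "rational_series d g"
  shows "rational_series d (\<lambda>e. f e - g e)"
proof -
  obtain P Q where P: "in_variables d P" "in_variables d Q" "Q \<noteq> 0"
    "mseries_times (lookup Q) f = lookup P"
    using assms(1) unfolding rational_series_def by blast
  obtain P' Q' where P': "in_variables d P'" "in_variables d Q'" "Q' \<noteq> 0"
    "mseries_times (lookup Q') g = lookup P'"
    using assms(2) unfolding rational_series_def by blast
  have "mseries_times (lookup (Q' * Q)) f = lookup (Q' * P)"
    by (simp only: P mseries_times_lookup flip: mseries_times_assoc)
  moreover have "mseries_times (lookup (Q' * Q)) g = lookup (Q * P')"
    by (subst mult.commute) (simp only: P' mseries_times_lookup flip: mseries_times_assoc)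
  ultimately have "mseries_times (lookup (Q' * Q)) (\<lambda>e. f e - g e) = lookup (Q' * P - Q * P')"
    by (simp add: mseries_times_diff_right fun_eq_iff lookup_minus)
  moreover have "in_variables d (Q' * Q)" "in_variables d (Q' * P - Q * P')" "Q' * Q \<noteq> 0"
    using P P' by (auto intro!: in_variables_mult in_variables_diff)
  ultimately show ?thesis unfolding rational_series_def by blast
qed

lemma rational_series_add:
  assumes "rational_series d f" "rational_series d g"
  shows "rational_series d (\<lambda>e. f e + g e)"
  using rational_series_diff[OF assms(1) rational_series_diff[OF rational_series_zero assms(2)]] by simp

lemma rational_series_sum:
  assumes "\<And>i. i \<in> I \<Longrightarrow> rational_series d (f i)"
  shows "rational_series d (\<lambda>e. \<Sum>i\<in>I. f i e)"
  using assms by (induction I rule: infinite_finite_induct) (auto intro: rational_series_zero rational_series_add)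

text \<open>The denominator gained here is \<open>1 - z\<^sup>m\<close>; it is nonzero precisely because \<open>m \<noteq> 0\<close>.\<close>
lemma rational_series_geometric:
  assumes "keys m \<subseteq> {1..d}" "m \<noteq> 0"
    and "rational_series d (\<lambda>e. f e - mseries_times (lookup (Poly_Mapping.single m 1)) f e)"
  shows "rational_series d f"
proof (rule rational_series_times_cancel)
  let ?Q = "1 - Poly_Mapping.single m 1 :: mpolynomial"
  show "in_variables d ?Q" by (intro in_variables_diff in_variables_one in_variables_single assms)
  have "lookup ?Q 0 = 1" using assms(2) by (simp add: lookup_minus lookup_single when_def lookup_one)
  then show "?Q \<noteq> 0" by force
  show "rational_series d (mseries_times (lookup ?Q) f)"
    using assms(3) by (simp add: mseries_times_lookup_diff mseries_times_one)
qed

section \<open>Finitely generated subsets of a commutative monoid\<close>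

text \<open>Dickson's lemma: multisets over \<open>I\<close> are vectors of natural numbers indexed by \<open>I\<close>. In the
  induction step the coordinate \<open>i\<close> is forgotten. Up to that coordinate, every vector then lies above
  one of finitely many vectors \<open>B\<close>; if \<open>K\<close> bounds their \<open>i\<close>-th coordinates, only vectors whose
  \<open>i\<close>-th coordinate takes one of the finitely many values below \<open>K\<close> remain, and for each value the
  induction hypothesis applies again.\<close>
lemma dickson_multiset:
  assumes "finite I" "\<And>u. u \<in> Z \<Longrightarrow> set_mset u \<subseteq> I"
  shows "\<exists>B. finite B \<and> B \<subseteq> Z \<and> (\<forall>u\<in>Z. \<exists>b\<in>B. b \<subseteq># u)"
  using assms
proof (induction I arbitrary: Z)
  case empty
  then have "\<And>u. u \<in> Z \<Longrightarrow> u = {#}" by auto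
  then show ?case by (intro exI[of _ Z]) (auto intro: finite_subset[of _ "{{#}}"])
next
  case (insert i I)
  let ?r = "filter_mset (\<lambda>j. j \<noteq> i)"
  have le: "u \<subseteq># v" if "?r u \<subseteq># ?r v" "count u i \<le> count v i" for u v
  proof (rule mset_subset_eqI)
    fix j show "count u j \<le> count v j"
      using that mset_subset_eq_count[OF that(1), of j] by (cases "j = i") auto
  qed
  have restr: "\<exists>B. finite B \<and> B \<subseteq> Y \<and> (\<forall>u\<in>Y. \<exists>b\<in>B. ?r b \<subseteq># ?r u)" if "Y \<subseteq> Z" for Y
  proof -
    have "\<exists>B. finite B \<and> B \<subseteq> ?r ` Y \<and> (\<forall>u\<in>?r ` Y. \<exists>b\<in>B. b \<subseteq># u)"
    proof (rule insert.IH)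
      fix u assume "u \<in> ?r ` Y"
      then obtain v where "v \<in> Z" "u = ?r v" using \<open>Y \<subseteq> Z\<close> by blast
      then show "set_mset u \<subseteq> I" using insert.prems(1)[of v] by auto
    qed
    then obtain B where "finite B" "B \<subseteq> ?r ` Y" "\<forall>u\<in>Y. \<exists>b\<in>B. b \<subseteq># ?r u" by auto
    moreover from finite_subset_image[OF this(1,2)]
    obtain C where "C \<subseteq> Y" "finite C" "B = ?r ` C" by blast
    ultimately show ?thesis by (intro exI[of _ C]) auto
  qed
  obtain B where B: "finite B" "B \<subseteq> Z" "\<And>u. u \<in> Z \<Longrightarrow> \<exists>b\<in>B. ?r b \<subseteq># ?r u"
    using restr[of Z] by blast
  obtain K where K: "\<And>b. b \<in> B \<Longrightarrow> count b i \<le> K"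
    using Max_ge[OF finite_imageI[OF B(1)], of _ "\<lambda>b. count b i"] by blast
  \<comment> \<open>Used only for the finitely many \<open>k < K\<close>; within one such set the coordinate \<open>i\<close> is constant.\<close>
  have "\<forall>k. \<exists>C. finite C \<and> C \<subseteq> {u \<in> Z. count u i = k} \<and>
      (\<forall>u\<in>{u \<in> Z. count u i = k}. \<exists>b\<in>C. ?r b \<subseteq># ?r u)"
    by (intro allI restr) auto
  from choice[OF this] obtain C where C0: "\<forall>k. finite (C k) \<and> C k \<subseteq> {u \<in> Z. count u i = k} \<and>
      (\<forall>u\<in>{u \<in> Z. count u i = k}. \<exists>b\<in>C k. ?r b \<subseteq># ?r u)"
    ..
  have C: "finite (C k)" "C k \<subseteq> {u \<in> Z. count u i = k}"
    "\<forall>u\<in>{u \<in> Z. count u i = k}. \<exists>b\<in>C k. ?r b \<subseteq># ?r u" for k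
    by (rule spec[OF C0, of k, THEN conjunct1] spec[OF C0, of k, THEN conjunct2, THEN conjunct1]
        spec[OF C0, of k, THEN conjunct2, THEN conjunct2])+
  let ?D = "B \<union> (\<Union>k<K. C k)"
  have "\<exists>b\<in>?D. b \<subseteq># u" if u: "u \<in> Z" for u
  proof (cases "count u i < K")
    case True
    have "u \<in> {v \<in> Z. count v i = count u i}" using u by simp
    from bspec[OF C(3) this] obtain b where b: "b \<in> C (count u i)" "?r b \<subseteq># ?r u" ..
    have "count b i = count u i" using subsetD[OF C(2) b(1)] by simp
    then have "b \<subseteq># u" using b(2) by (simp add: le)
    moreover have "b \<in> ?D" using b(1) True by blast
    ultimately show ?thesis ..
  next
    case False
    obtain b where b: "b \<in> B" "?r b \<subseteq># ?r u" using B(3)[OF u] ..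
    have "b \<subseteq># u" using K[OF b(1)] False by (simp add: le[OF b(2)])
    moreover have "b \<in> ?D" using b(1) by simp
    ultimately show ?thesis ..
  qed
  moreover have "finite ?D" by (intro finite_UnI finite_UN_I B(1) C(1) finite_lessThan)
  moreover have "?D \<subseteq> Z" by (intro Un_least UN_least B(2) order.trans[OF C(2)]) simp
  ultimately show ?case by (intro exI[of _ ?D]) simp
qed

context comm_monoid
begin

text \<open>The value of a vector of exponents \<open>u\<close> under the homomorphism from the free commutative monoid that
  sends the generator \<open>i\<close> to \<open>p i\<close>.\<close>
definition mset_prod :: "('i \<Rightarrow> 'a) \<Rightarrow> 'i multiset \<Rightarrow> 'a" where
  "mset_prod p u = (\<Otimes>i\<in>set_mset u. p i [^] count u i)"

lemma mset_prod_empty [simp]: "mset_prod p {#} = \<one>"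
  by (simp add: mset_prod_def)

lemma mset_prod_add_mset:
  assumes p: "p \<in> I \<rightarrow> carrier G" and u: "set_mset u \<subseteq> I" "i \<in> I"
  shows "mset_prod p (add_mset i u) = p i \<otimes> mset_prod p u"
proof -
  let ?S = "set_mset u - {i}"
  let ?t = "\<Otimes>j\<in>?S. p j [^] count u j"
  have pc: "\<And>j. j \<in> I \<Longrightarrow> p j \<in> carrier G" using p by auto
  have c: "(\<lambda>j. p j [^] count v j) \<in> ?S \<rightarrow> carrier G" for v
    using pc u by auto
  have t: "?t \<in> carrier G" using c by (rule finprod_closed)
  have "mset_prod p (add_mset i u) = (\<Otimes>j\<in>insert i ?S. p j [^] count (add_mset i u) j)"
    by (simp add: mset_prod_def)
  also have "\<dots> = p i [^] Suc (count u i) \<otimes> (\<Otimes>j\<in>?S. p j [^] count (add_mset i u) j)"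
    by (subst finprod_insert) (use c pc u in auto)
  also have "(\<Otimes>j\<in>?S. p j [^] count (add_mset i u) j) = ?t"
    by (rule finprod_cong') (use c in auto)
  finally have 1: "mset_prod p (add_mset i u) = p i [^] Suc (count u i) \<otimes> ?t" .
  have 2: "mset_prod p u = p i [^] count u i \<otimes> ?t"
  proof (cases "i \<in># u")
    case True
    then have "mset_prod p u = (\<Otimes>j\<in>insert i ?S. p j [^] count u j)"
      by (simp add: mset_prod_def insert_absorb)
    also have "\<dots> = p i [^] count u i \<otimes> ?t"
      by (subst finprod_insert) (use c pc u in auto)
    finally show ?thesis .
  next
    case False
    then have "?S = set_mset u" "count u i = 0" by (auto simp: not_in_iff)
    then show ?thesis using t by (simp add: mset_prod_def)
  qed
  show ?thesis unfolding 1 2 using pc[OF u(2)] t by (simp add: m_ac)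
qed

lemma mset_prod_closed:
  assumes "p \<in> I \<rightarrow> carrier G" "set_mset u \<subseteq> I" shows "mset_prod p u \<in> carrier G"
  unfolding mset_prod_def by (rule finprod_closed) (use assms in auto)

lemma mset_prod_union:
  assumes p: "p \<in> I \<rightarrow> carrier G" and u: "set_mset u \<subseteq> I" "set_mset w \<subseteq> I"
  shows "mset_prod p (u + w) = mset_prod p u \<otimes> mset_prod p w"
  using u(1)
proof (induction u)
  case empty
  then show ?case using mset_prod_closed[OF p u(2)] by simp
next
  case (add i u)
  have "mset_prod p (add_mset i (u + w)) = p i \<otimes> mset_prod p (u + w)"
    using add.prems u by (intro mset_prod_add_mset[OF p]) auto
  also have "\<dots> = p i \<otimes> (mset_prod p u \<otimes> mset_prod p w)" using add by simp
  also have "\<dots> = p i \<otimes> mset_prod p u \<otimes> mset_prod p w"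
    using add.prems p mset_prod_closed[OF p u(2)] mset_prod_closed[OF p, of u] by (subst m_assoc) auto
  also have "p i \<otimes> mset_prod p u = mset_prod p (add_mset i u)"
    using add.prems by (intro mset_prod_add_mset[OF p, symmetric]) auto
  finally show ?case by simp
qed

text \<open>The submonoid generated by \<open>P\<close>; the name reflects that it is used like the set of the nonnegative
  integer combinations of \<open>P\<close>.\<close>
inductive_set cone :: "'a set \<Rightarrow> 'a set" for P where
  cone_one: "\<one> \<in> cone P"
| cone_step: "x \<in> P \<Longrightarrow> y \<in> cone P \<Longrightarrow> x \<otimes> y \<in> cone P"

lemma cone_closed:
  assumes "P \<subseteq> carrier G" "x \<in> cone P" shows "x \<in> carrier G"
  using assms(2) by induction (use assms(1) in auto)

lemma cone_mono:
  assumes "x \<in> cone P" "P \<subseteq> Q" shows "x \<in> cone Q"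
  using assms(1) by induction (use assms(2) in \<open>auto intro: cone.intros\<close>)

lemma cone_base: "P \<subseteq> carrier G \<Longrightarrow> x \<in> P \<Longrightarrow> x \<in> cone P"
  using cone_step[OF _ cone_one, of x P] by (metis r_one subsetD)

lemma cone_mult:
  assumes P: "P \<subseteq> carrier G" and x: "x \<in> cone P" and y: "y \<in> cone P"
  shows "x \<otimes> y \<in> cone P"
  using x
proof induction
  case cone_one
  then show ?case using cone_closed[OF P y] y by simp
next
  case (cone_step a x)
  then have "a \<in> carrier G" "x \<in> carrier G" using P cone_closed[OF P] by auto
  then have "a \<otimes> x \<otimes> y = a \<otimes> (x \<otimes> y)" using cone_closed[OF P y] by (simp add: m_assoc)
  then show ?case using cone_step by (simp add: cone.cone_step)
qed

lemma cone_insert_one: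
  assumes P: "P \<subseteq> carrier G" shows "cone (insert \<one> P) = cone P"
proof (intro equalityI subsetI)
  fix x assume "x \<in> cone (insert \<one> P)"
  then show "x \<in> cone P"
    by induction (use cone_closed[OF P] in \<open>auto intro: cone.intros\<close>)
qed (auto intro: cone_mono)

lemma cone_image:
  assumes p: "p \<in> I \<rightarrow> carrier G"
  shows "cone (p ` I) = mset_prod p ` {u. set_mset u \<subseteq> I}"
proof (intro equalityI subsetI)
  fix x assume "x \<in> cone (p ` I)"
  then show "x \<in> mset_prod p ` {u. set_mset u \<subseteq> I}"
  proof induction
    case cone_one
    then show ?case by (auto intro: image_eqI[of _ _ "{#}"])
  next
    case (cone_step x y)
    then obtain i u where "i \<in> I" "x = p i" "set_mset u \<subseteq> I" "y = mset_prod p u" by blast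
    then show ?case by (intro image_eqI[of _ _ "add_mset i u"]) (auto simp: mset_prod_add_mset[OF p])
  qed
next
  fix x assume "x \<in> mset_prod p ` {u. set_mset u \<subseteq> I}"
  then obtain u where "set_mset u \<subseteq> I" "x = mset_prod p u" by blast
  then show "x \<in> cone (p ` I)"
  proof (induction u arbitrary: x)
    case empty
    then show ?case by (simp add: cone_one)
  next
    case (add i u)
    then have "x = p i \<otimes> mset_prod p u" by (simp add: mset_prod_add_mset[OF p])
    moreover have "mset_prod p u \<in> cone (p ` I)" using add by simp
    ultimately show ?case using add.prems(1) by (simp add: cone_step)
  qed
qed

lemma cone_eq_mset_prod: "P \<subseteq> carrier G \<Longrightarrow> cone P = mset_prod (\<lambda>x. x) ` {u. set_mset u \<subseteq> P}"
  using cone_image[of "\<lambda>x. x" P] by auto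

text \<open>Gordan's lemma in the form used for homogeneous linear systems. Saturation says that \<open>Z0\<close> is closed
  under sums and under those differences that are nonnegative, as is the solution set of such a
  system. A minimal nonzero element below \<open>u\<close> can thus be subtracted from \<open>u\<close> within \<open>Z0\<close>, and by
  Dickson's lemma there are only finitely many minimal elements.\<close>
lemma saturated_finitely_generated:
  assumes I: "finite I" and Z0: "\<And>u. u \<in> Z0 \<Longrightarrow> set_mset u \<subseteq> I" "{#} \<in> Z0"
    and sat: "\<And>u w. u \<in> Z0 \<Longrightarrow> set_mset w \<subseteq> I \<Longrightarrow> u + w \<in> Z0 \<longleftrightarrow> w \<in> Z0"
  obtains B where "finite B" "B \<subseteq> Z0" "\<And>p. p \<in> I \<rightarrow> carrier G \<Longrightarrow> mset_prod p ` Z0 = cone (mset_prod p ` B)"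
proof -
  have "\<exists>B. finite B \<and> B \<subseteq> Z0 - {{#}} \<and> (\<forall>u\<in>Z0 - {{#}}. \<exists>b\<in>B. b \<subseteq># u)"
    using Z0(1) by (intro dickson_multiset[OF I]) simp
  then obtain B where B: "finite B" "B \<subseteq> Z0 - {{#}}" "\<forall>u\<in>Z0 - {{#}}. \<exists>b\<in>B. b \<subseteq># u"
    by (elim exE conjE) (rule that)
  have "mset_prod p ` Z0 = cone (mset_prod p ` B)" if p: "p \<in> I \<rightarrow> carrier G" for p
  proof (intro equalityI subsetI)
    fix x assume "x \<in> mset_prod p ` Z0"
    then obtain u where "u \<in> Z0" "x = mset_prod p u" by blast
    then show "x \<in> cone (mset_prod p ` B)"
    proof (induction "size u" arbitrary: u x rule: less_induct)
      case less
      show ?case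
      proof (cases "u = {#}")
        case True
        with less show ?thesis by (simp add: cone_one)
      next
        case False
        then obtain b where b: "b \<in> B" "b \<subseteq># u" using bspec[OF B(3), of u] less.prems by blast
        then have bZ: "b \<in> Z0" "b \<noteq> {#}" using B(2) by auto
        have u: "u = b + (u - b)" using b(2) by simp
        have uI: "set_mset (u - b) \<subseteq> I" using Z0(1)[OF less.prems(1)] by (meson in_diffD subset_iff)
        have "u - b \<in> Z0" using sat[OF bZ(1) uI] u less.prems by simp
        moreover have "size (u - b) < size u"
          using b(2) bZ(2) by (metis size_Diff_submset diff_less nonempty_has_size size_mset_mono order_less_le_trans)
        ultimately have "mset_prod p (u - b) \<in> cone (mset_prod p ` B)" using less.hyps by blast
        moreover have "x = mset_prod p b \<otimes> mset_prod p (u - b)"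
          using less.prems(2) u mset_prod_union[OF p Z0(1)[OF bZ(1)] uI] by simp
        ultimately show ?thesis using b(1) by (auto intro: cone_step)
      qed
    qed
  next
    fix x assume "x \<in> cone (mset_prod p ` B)"
    then show "x \<in> mset_prod p ` Z0"
    proof induction
      case cone_one
      show ?case using Z0(2) by (auto intro: image_eqI[of _ _ "{#}"])
    next
      case (cone_step x y)
      then obtain b u where *: "b \<in> Z0" "x = mset_prod p b" "u \<in> Z0" "y = mset_prod p u" using B(2) by blast
      then have "b + u \<in> Z0" using sat Z0(1) by blast
      moreover have "mset_prod p (b + u) = x \<otimes> y" using * Z0(1) by (simp add: mset_prod_union[OF p])
      ultimately show ?case by (metis imageI)
    qed
  qed
  with B show thesis by (intro that[of B]) auto
qed

text \<open>The inhomogeneous counterpart: every solution is a minimal solution plus a homogeneous one.\<close>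
lemma saturated_module_finitely_generated:
  assumes I: "finite I" and Z: "\<And>u. u \<in> Z \<Longrightarrow> set_mset u \<subseteq> I" "\<And>u. u \<in> Z0 \<Longrightarrow> set_mset u \<subseteq> I"
    and sat: "\<And>u w. u \<in> Z \<Longrightarrow> set_mset w \<subseteq> I \<Longrightarrow> u + w \<in> Z \<longleftrightarrow> w \<in> Z0"
  obtains B where "finite B" "B \<subseteq> Z"
    "\<And>p. p \<in> I \<rightarrow> carrier G \<Longrightarrow> mset_prod p ` Z = mset_prod p ` B <#> mset_prod p ` Z0"
proof -
  have "\<exists>B. finite B \<and> B \<subseteq> Z \<and> (\<forall>u\<in>Z. \<exists>b\<in>B. b \<subseteq># u)"
    using Z(1) by (intro dickson_multiset[OF I]) simp
  then obtain B where B: "finite B" "B \<subseteq> Z" "\<forall>u\<in>Z. \<exists>b\<in>B. b \<subseteq># u"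
    by (elim exE conjE) (rule that)
  have "mset_prod p ` Z = mset_prod p ` B <#> mset_prod p ` Z0" if p: "p \<in> I \<rightarrow> carrier G" for p
  proof (intro equalityI subsetI)
    fix x assume "x \<in> mset_prod p ` Z"
    then obtain u where u: "u \<in> Z" "x = mset_prod p u" by blast
    then obtain b where b: "b \<in> B" "b \<subseteq># u" using bspec[OF B(3)] by blast
    then have bZ: "b \<in> Z" and ub: "u = b + (u - b)" using B(2) by auto
    have uI: "set_mset (u - b) \<subseteq> I" using Z(1)[OF u(1)] by (meson in_diffD subset_iff)
    then have "u - b \<in> Z0" using sat[OF bZ uI] ub u by simp
    moreover have "x = mset_prod p b \<otimes> mset_prod p (u - b)"
      using u(2) ub mset_prod_union[OF p Z(1)[OF bZ] uI] by simp
    ultimately show "x \<in> mset_prod p ` B <#> mset_prod p ` Z0" using b(1) unfolding set_mult_def by blast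
  next
    fix x assume "x \<in> mset_prod p ` B <#> mset_prod p ` Z0"
    then obtain b u where *: "b \<in> Z" "u \<in> Z0" "x = mset_prod p b \<otimes> mset_prod p u"
      using B(2) unfolding set_mult_def by blast
    then have "b + u \<in> Z" using sat Z(2) by blast
    moreover have "mset_prod p (b + u) = x" using * Z by (simp add: mset_prod_union[OF p])
    ultimately show "x \<in> mset_prod p ` Z" by blast
  qed
  with B show thesis by (intro that[of B]) auto
qed

text \<open>The finitely generated modules over finitely generated submonoids: one monoid \<open>cone P\<close> acts, and there
  are finitely many generators \<open>F\<close>. Admitting several generators over the same monoid, and not only
  one, is what makes this class closed under intersection.\<close>
definition fg_set :: "'a set \<Rightarrow> bool" where
  "fg_set X \<longleftrightarrow> (\<exists>F P. finite F \<and> F \<subseteq> carrier G \<and> finite P \<and> P \<subseteq> carrier G \<and> X = F <#> cone P)"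

lemma fg_setI:
  "finite F \<Longrightarrow> F \<subseteq> carrier G \<Longrightarrow> finite P \<Longrightarrow> P \<subseteq> carrier G \<Longrightarrow> X = F <#> cone P \<Longrightarrow> fg_set X"
  unfolding fg_set_def by blast

text \<open>The common source of the closure properties below: a family of inhomogeneous systems \<open>Z l\<close> that share
  the homogeneous system \<open>Z0\<close> has a finitely generated set of values, because all its members are
  modules over the same monoid.\<close>
lemma fg_set_parametrized:
  assumes L: "finite L" "f \<in> L \<rightarrow> carrier G" and I: "finite I" "p \<in> I \<rightarrow> carrier G"
    and Z0: "\<And>u. u \<in> Z0 \<Longrightarrow> set_mset u \<subseteq> I" "{#} \<in> Z0"
    and sat0: "\<And>u w. u \<in> Z0 \<Longrightarrow> set_mset w \<subseteq> I \<Longrightarrow> u + w \<in> Z0 \<longleftrightarrow> w \<in> Z0"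
    and Z: "\<And>l u. l \<in> L \<Longrightarrow> u \<in> Z l \<Longrightarrow> set_mset u \<subseteq> I"
    and sat: "\<And>l u w. l \<in> L \<Longrightarrow> u \<in> Z l \<Longrightarrow> set_mset w \<subseteq> I \<Longrightarrow> u + w \<in> Z l \<longleftrightarrow> w \<in> Z0"
  shows "fg_set {f l \<otimes> mset_prod p u | l u. l \<in> L \<and> u \<in> Z l}"
proof -
  obtain B0 where B0: "finite B0" "B0 \<subseteq> Z0" "mset_prod p ` Z0 = cone (mset_prod p ` B0)"
    using saturated_finitely_generated[OF I(1) Z0 sat0] I(2) by metis
  have "\<forall>l\<in>L. \<exists>B. finite B \<and> B \<subseteq> Z l \<and> mset_prod p ` Z l = mset_prod p ` B <#> mset_prod p ` Z0"
  proof
    fix l assume l: "l \<in> L"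
    show "\<exists>B. finite B \<and> B \<subseteq> Z l \<and> mset_prod p ` Z l = mset_prod p ` B <#> mset_prod p ` Z0"
      using saturated_module_finitely_generated[OF I(1) Z[OF l] Z0(1) sat[OF l]] I(2) by metis
  qed
  then obtain B where B: "\<And>l. l \<in> L \<Longrightarrow> finite (B l)" "\<And>l. l \<in> L \<Longrightarrow> B l \<subseteq> Z l"
    "\<And>l. l \<in> L \<Longrightarrow> mset_prod p ` Z l = mset_prod p ` B l <#> mset_prod p ` Z0"
    by (metis (no_types))
  have mc: "mset_prod p u \<in> carrier G" if "set_mset u \<subseteq> I" for u using mset_prod_closed[OF I(2) that] .
  have fc: "f l \<in> carrier G" if "l \<in> L" for l using L(2) that by auto
  let ?F = "\<Union>l\<in>L. (\<lambda>b. f l \<otimes> mset_prod p b) ` B l"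
  have "{f l \<otimes> mset_prod p u | l u. l \<in> L \<and> u \<in> Z l} = ?F <#> mset_prod p ` Z0"
  proof (intro equalityI subsetI)
    fix x assume "x \<in> {f l \<otimes> mset_prod p u | l u. l \<in> L \<and> u \<in> Z l}"
    then obtain l u where l: "l \<in> L" "u \<in> Z l" "x = f l \<otimes> mset_prod p u" by blast
    then have "mset_prod p u \<in> mset_prod p ` B l <#> mset_prod p ` Z0" using B(3)[OF l(1)] by blast
    then obtain b w where b: "b \<in> B l" "w \<in> Z0" "mset_prod p u = mset_prod p b \<otimes> mset_prod p w"
      unfolding set_mult_def by blast
    have "x = f l \<otimes> mset_prod p b \<otimes> mset_prod p w"
      using l b B(2)[OF l(1)] Z[OF l(1)] Z0(1) by (subst m_assoc) (auto intro!: fc mc)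
    then show "x \<in> ?F <#> mset_prod p ` Z0" using l b unfolding set_mult_def by blast
  next
    fix x assume "x \<in> ?F <#> mset_prod p ` Z0"
    then obtain l b w where l: "l \<in> L" "b \<in> B l" "w \<in> Z0" "x = f l \<otimes> mset_prod p b \<otimes> mset_prod p w"
      unfolding set_mult_def by blast
    then have "x = f l \<otimes> (mset_prod p b \<otimes> mset_prod p w)"
      using B(2)[OF l(1)] Z[OF l(1)] Z0(1) by (subst m_assoc[symmetric]) (auto intro!: fc mc)
    moreover have "mset_prod p b \<otimes> mset_prod p w \<in> mset_prod p ` Z l"
      unfolding B(3)[OF l(1)] set_mult_def using l by blast
    then obtain u where "u \<in> Z l" "mset_prod p b \<otimes> mset_prod p w = mset_prod p u" by blast
    ultimately show "x \<in> {f l \<otimes> mset_prod p u | l u. l \<in> L \<and> u \<in> Z l}" using l(1) by auto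
  qed
  then show ?thesis unfolding B0(3)
  proof (rule fg_setI[rotated 4])
    show "finite ?F" using L B by blast
    have "f l \<otimes> mset_prod p b \<in> carrier G" if "l \<in> L" "b \<in> B l" for l b
      using that B(2)[OF that(1)] Z[OF that(1), of b] by (auto intro!: fc mc)
    then show "?F \<subseteq> carrier G" by blast
    show "finite (mset_prod p ` B0)" "mset_prod p ` B0 \<subseteq> carrier G" using B0 Z0 by (auto intro!: mc)
  qed
qed

lemma fg_set_closed: assumes "fg_set X" shows "X \<subseteq> carrier G"
proof -
  obtain F P where "F \<subseteq> carrier G" "P \<subseteq> carrier G" "X = F <#> cone P"
    using assms unfolding fg_set_def by blast
  then show ?thesis using cone_closed[of P] unfolding set_mult_def by (auto intro!: m_closed)
qed

text \<open>Here \<open>V\<close> plays the role of a coset of a subgroup and \<open>K\<close> that of the subgroup itself, both intersected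
  with the monoid.\<close>
lemma fg_set_Int_saturated:
  assumes X: "fg_set X" and K: "K \<subseteq> carrier G" "\<one> \<in> K"
    and K_sat: "\<And>k l. k \<in> K \<Longrightarrow> l \<in> carrier G \<Longrightarrow> k \<otimes> l \<in> K \<longleftrightarrow> l \<in> K"
    and V_sat: "\<And>x k. x \<in> V \<Longrightarrow> k \<in> carrier G \<Longrightarrow> x \<otimes> k \<in> V \<longleftrightarrow> k \<in> K"
  shows "fg_set (X \<inter> V)"
proof -
  obtain F P where F: "finite F" "F \<subseteq> carrier G" "finite P" "P \<subseteq> carrier G" "X = F <#> cone P"
    using assms(1) unfolding fg_set_def by blast
  let ?v = "mset_prod (\<lambda>x. x)" and ?N = "{u. set_mset u \<subseteq> P}"
  have p: "(\<lambda>x. x) \<in> P \<rightarrow> carrier G" using F by auto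
  note mc = mset_prod_closed[OF p] and mu = mset_prod_union[OF p]
  have fc: "f \<in> carrier G" if "f \<in> F" for f using F that by auto
  have "X \<inter> V = {f \<otimes> ?v u | f u. f \<in> F \<and> u \<in> {u \<in> ?N. f \<otimes> ?v u \<in> V}}"
    unfolding F(5) cone_eq_mset_prod[OF F(4)] set_mult_def by blast
  moreover have "fg_set \<dots>"
  proof (rule fg_set_parametrized[where I = P and ?Z0.0 = "{u \<in> ?N. ?v u \<in> K}"])
    fix f u w assume *: "f \<in> F" "u \<in> {u \<in> ?N. f \<otimes> ?v u \<in> V}" "set_mset w \<subseteq> P"
    then have "f \<otimes> ?v (u + w) = (f \<otimes> ?v u) \<otimes> ?v w" by (simp add: mu m_assoc mc fc)
    with * V_sat[of "f \<otimes> ?v u" "?v w"]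
    show "u + w \<in> {u \<in> ?N. f \<otimes> ?v u \<in> V} \<longleftrightarrow> w \<in> {u \<in> ?N. ?v u \<in> K}" by (auto simp: mc)
  qed (use F K K_sat in \<open>auto simp: mc mu\<close>)
  ultimately show ?thesis by simp
qed

section \<open>Semilinear sets\<close>

lemma set_multI: "x \<in> A \<Longrightarrow> y \<in> B \<Longrightarrow> x \<otimes> y \<in> A <#> B"
  unfolding set_mult_def by blast

lemma set_multE:
  assumes "z \<in> A <#> B" obtains x y where "x \<in> A" "y \<in> B" "z = x \<otimes> y"
  using assms unfolding set_mult_def by blast

lemma cone_empty: "cone {} = {\<one>}"
  by (auto intro: cone_one elim: cone.cases)

lemma set_mult_one: "A \<subseteq> carrier G \<Longrightarrow> A <#> {\<one>} = A"
  by (force simp: set_mult_def)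

lemma fg_set_finite:
  assumes "finite F" "F \<subseteq> carrier G" shows "fg_set F"
proof (rule fg_setI)
  show "F = F <#> cone {}" unfolding cone_empty using set_mult_one[OF assms(2)] by (rule sym)
qed (use assms in auto)

lemma cone_Un:
  assumes P: "P \<subseteq> carrier G" and Q: "Q \<subseteq> carrier G"
  shows "cone (P \<union> Q) = cone P <#> cone Q"
proof (intro equalityI subsetI)
  fix x assume "x \<in> cone (P \<union> Q)"
  then show "x \<in> cone P <#> cone Q"
  proof induction
    case cone_one
    show ?case using set_multI[OF cone.cone_one cone.cone_one] by simp
  next
    case (cone_step x y)
    obtain a b where y: "a \<in> cone P" "b \<in> cone Q" "y = a \<otimes> b" using cone_step(3) by (rule set_multE)
    have c: "a \<in> carrier G" "b \<in> carrier G" using y cone_closed P Q by auto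
    show ?case
    proof (cases "x \<in> P")
      case True
      then have "x \<otimes> y = (x \<otimes> a) \<otimes> b" using c P y by (auto simp: m_assoc)
      then show ?thesis using True y by (simp add: set_multI cone.cone_step)
    next
      case False
      then have "x \<in> Q" using cone_step by auto
      then have "x \<otimes> y = a \<otimes> (x \<otimes> b)" using c Q y by (auto simp: m_lcomm)
      then show ?thesis using \<open>x \<in> Q\<close> y by (simp add: set_multI cone.cone_step)
    qed
  qed
next
  fix x assume "x \<in> cone P <#> cone Q"
  then obtain a b where "a \<in> cone P" "b \<in> cone Q" "x = a \<otimes> b" by (rule set_multE)
  then show "x \<in> cone (P \<union> Q)" using P Q by (auto intro!: cone_mult intro: cone_mono)
qed

lemma fg_set_mult:
  assumes "fg_set X" "fg_set Y" shows "fg_set (X <#> Y)"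
proof -
  obtain F P where F: "finite F" "F \<subseteq> carrier G" "finite P" "P \<subseteq> carrier G" "X = F <#> cone P"
    using assms(1) unfolding fg_set_def by blast
  obtain F' P' where F': "finite F'" "F' \<subseteq> carrier G" "finite P'" "P' \<subseteq> carrier G" "Y = F' <#> cone P'"
    using assms(2) unfolding fg_set_def by blast
  note c = subsetD[OF F(2)] subsetD[OF F'(2)] cone_closed[OF F(4)] cone_closed[OF F'(4)]
  have "X <#> Y = (F <#> F') <#> cone (P \<union> P')"
  proof (intro equalityI subsetI)
    fix z assume "z \<in> X <#> Y"
    then obtain f a f' b where z: "f \<in> F" "a \<in> cone P" "f' \<in> F'" "b \<in> cone P'"
      "z = (f \<otimes> a) \<otimes> (f' \<otimes> b)"
      unfolding F(5) F'(5) by (metis set_multE)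
    then have "z = (f \<otimes> f') \<otimes> (a \<otimes> b)" using c by (simp add: m_ac)
    then show "z \<in> (F <#> F') <#> cone (P \<union> P')"
      unfolding cone_Un[OF F(4) F'(4)] using z by (simp add: set_multI)
  next
    fix z assume "z \<in> (F <#> F') <#> cone (P \<union> P')"
    then obtain f a f' b where z: "f \<in> F" "a \<in> cone P" "f' \<in> F'" "b \<in> cone P'"
      "z = (f \<otimes> f') \<otimes> (a \<otimes> b)"
      unfolding cone_Un[OF F(4) F'(4)] by (metis set_multE)
    then have "z = (f \<otimes> a) \<otimes> (f' \<otimes> b)" using c by (simp add: m_ac)
    then show "z \<in> X <#> Y" unfolding F(5) F'(5) using z by (simp add: set_multI)
  qed
  then show ?thesis
    by (rule fg_setI[rotated 4])
      (use F F' in \<open>auto simp: set_mult_def\<close>)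
qed

inductive semilinear :: "'a set \<Rightarrow> bool" where
  semilinear_empty: "semilinear {}"
| semilinear_insert: "fg_set X \<Longrightarrow> semilinear Y \<Longrightarrow> semilinear (X \<union> Y)"

lemma semilinear_fg_set: "fg_set X \<Longrightarrow> semilinear X"
  using semilinear_insert[OF _ semilinear_empty] by simp

lemma semilinear_closed: "semilinear X \<Longrightarrow> X \<subseteq> carrier G"
  by (induction rule: semilinear.induct) (use fg_set_closed in blast)+

lemma semilinear_Un: "semilinear X \<Longrightarrow> semilinear Y \<Longrightarrow> semilinear (X \<union> Y)"
  by (induction rule: semilinear.induct) (simp_all add: Un_assoc semilinear_insert)

lemma set_mult_Un_left: "(A \<union> B) <#> C = (A <#> C) \<union> (B <#> C)"
  and set_mult_Un_right: "C <#> (A \<union> B) = (C <#> A) \<union> (C <#> B)"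
  and set_mult_empty_left: "{} <#> C = {}" and set_mult_empty_right: "C <#> {} = {}"
  by (auto simp: set_mult_def)

lemma semilinear_mult:
  assumes "semilinear X" "semilinear Y" shows "semilinear (X <#> Y)"
proof -
  have *: "semilinear (A <#> Y)" if A: "fg_set A" for A
    using assms(2)
    by induction (auto simp: set_mult_Un_right set_mult_empty_right semilinear_empty
        intro!: semilinear_insert fg_set_mult A)
  from assms(1) show ?thesis
    by induction (auto simp: set_mult_Un_left set_mult_empty_left semilinear_empty
        intro!: semilinear_Un *)
qed

text \<open>In a commutative monoid a nonempty product of elements of \<open>f P\<^sup>*\<close> is \<open>f\<close> times an arbitrary product of
  factors \<open>f\<close> and elements of \<open>P\<close>: one factor \<open>f\<close> absorbs all elements of \<open>P\<close>.\<close>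
lemma cone_linear:
  assumes f: "f \<in> carrier G" and P: "P \<subseteq> carrier G"
  shows "cone ({f} <#> cone P) = {\<one>} \<union> ({f} <#> cone (insert f P))"
proof (intro equalityI subsetI)
  note Pc = cone_closed[OF P]
  have fP: "insert f P \<subseteq> carrier G" using f P by simp
  note fPc = cone_closed[OF fP]
  fix x assume "x \<in> cone ({f} <#> cone P)"
  then show "x \<in> {\<one>} \<union> ({f} <#> cone (insert f P))"
  proof induction
    case (cone_step x y)
    obtain c where c: "c \<in> cone P" "x = f \<otimes> c" using cone_step(1) by (auto elim: set_multE)
    have c': "c \<in> cone (insert f P)" using c(1) by (rule cone_mono) blast
    have "\<exists>c'\<in>cone (insert f P). x \<otimes> y = f \<otimes> c'"
    proof (cases "y = \<one>")
      case True
      then show ?thesis using c c' f Pc by auto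
    next
      case False
      then obtain b where b: "b \<in> cone (insert f P)" "y = f \<otimes> b"
        using cone_step(3) by (auto elim: set_multE)
      then have "x \<otimes> y = f \<otimes> (c \<otimes> (f \<otimes> b))" using c f Pc fPc by (simp add: m_assoc)
      moreover have "c \<otimes> (f \<otimes> b) \<in> cone (insert f P)"
        using b by (intro cone_mult[OF fP c']) (simp add: cone.cone_step)
      ultimately show ?thesis by blast
    qed
    then show ?case by (auto intro: set_multI)
  qed simp
next
  note Pc = cone_closed[OF P]
  have X: "{f} <#> cone P \<subseteq> carrier G" using f Pc by (auto elim: set_multE)
  fix x assume "x \<in> {\<one>} \<union> ({f} <#> cone (insert f P))"
  moreover have "f \<otimes> c \<in> cone ({f} <#> cone P)" if "c \<in> cone (insert f P)" for c
  proof -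
    have "c \<in> cone {f} <#> cone P" using that cone_Un[of "{f}" P] f P by simp
    then obtain a b where ab: "a \<in> cone {f}" "b \<in> cone P" "c = a \<otimes> b" by (rule set_multE)
    have "f \<in> {f} <#> cone P" using set_multI[of f "{f}" \<one> "cone P"] f by (simp add: cone_one)
    then have a: "a \<in> cone ({f} <#> cone P)" using ab(1) by (auto intro: cone_mono)
    have "a \<in> carrier G" using cone_closed[of "{f}"] ab(1) f by simp
    then have "f \<otimes> c = a \<otimes> (f \<otimes> b)" using ab f Pc by (simp add: m_lcomm)
    moreover have "f \<otimes> b \<in> cone ({f} <#> cone P)"
      using ab(2) by (intro cone_base[OF X] set_multI) simp_all
    ultimately show ?thesis using cone_mult[OF X a] by simp
  qed
  ultimately show "x \<in> cone ({f} <#> cone P)" by (auto intro: cone_one elim: set_multE)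
qed

text \<open>Union turns into product under the star, so the claim reduces to the linear sets of \<open>cone_linear\<close>.\<close>
lemma semilinear_cone:
  assumes "semilinear X" shows "semilinear (cone X)"
  using assms
proof induction
  case semilinear_empty
  show ?case by (auto simp: cone_empty intro!: semilinear_fg_set fg_set_finite)
next
  case (semilinear_insert X Y)
  obtain F P where F: "finite F" "F \<subseteq> carrier G" "finite P" "P \<subseteq> carrier G" "X = F <#> cone P"
    using semilinear_insert(1) unfolding fg_set_def by blast
  have "semilinear (cone (F <#> cone P))"
    using F(1,2)
  proof induction
    case empty
    show ?case by (auto simp: set_mult_empty_left cone_empty intro!: semilinear_fg_set fg_set_finite)
  next
    case (insert f F)
    have "semilinear (cone ({f} <#> cone P))"
      unfolding cone_linear[OF insert_subset[THEN iffD1, OF insert.prems, THEN conjunct1] F(4)]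
      using insert.prems F(3,4)
      by (intro semilinear_Un semilinear_fg_set fg_set_finite fg_setI[of "{f}" "insert f P"]) auto
    moreover have "semilinear (cone (F <#> cone P))" using insert by simp
    moreover have "{f} <#> cone P \<subseteq> carrier G" "F <#> cone P \<subseteq> carrier G"
      using insert.prems cone_closed[OF F(4)] by (auto elim!: set_multE)
    ultimately show ?case
      using set_mult_Un_left[of "{f}" F "cone P"] by (simp add: cone_Un semilinear_mult)
  qed
  then show ?case using semilinear_insert semilinear_mult fg_set_closed semilinear_closed
    by (simp add: cone_Un F(5)[symmetric])
qed

lemma semilinear_Int_saturated:
  assumes X: "semilinear X" and K: "K \<subseteq> carrier G" "\<one> \<in> K"
    and K_sat: "\<And>k l. k \<in> K \<Longrightarrow> l \<in> carrier G \<Longrightarrow> k \<otimes> l \<in> K \<longleftrightarrow> l \<in> K"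
    and V_sat: "\<And>x k. x \<in> V \<Longrightarrow> k \<in> carrier G \<Longrightarrow> x \<otimes> k \<in> V \<longleftrightarrow> k \<in> K"
  shows "semilinear (X \<inter> V)"
  using X
proof induction
  case (semilinear_insert X Y)
  have "fg_set (X \<inter> V)"
    by (rule fg_set_Int_saturated[where K = K]) (use assms semilinear_insert in auto)
  with semilinear_insert show ?case by (simp add: Int_Un_distrib2 semilinear.semilinear_insert)
qed (simp add: semilinear_empty)

end

text \<open>The equation \<open>f \<otimes> x = f' \<otimes> y\<close> with \<open>x \<in> cone P\<close> and \<open>y \<in> cone P'\<close> is a linear system for the joint
  exponent vector over the disjoint union of \<open>P\<close> and \<open>P'\<close>. Its homogeneous part \<open>x = y\<close> depends neither
  on \<open>f\<close> nor on \<open>f'\<close>, and saturation is exactly cancellation.\<close>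
lemma (in comm_monoid_cancel) fg_set_Int:
  assumes "fg_set X" "fg_set Y" shows "fg_set (X \<inter> Y)"
proof -
  obtain F P where F: "finite F" "F \<subseteq> carrier G" "finite P" "P \<subseteq> carrier G" "X = F <#> cone P"
    using assms(1) unfolding fg_set_def by blast
  obtain F' P' where F': "finite F'" "F' \<subseteq> carrier G" "finite P'" "P' \<subseteq> carrier G" "Y = F' <#> cone P'"
    using assms(2) unfolding fg_set_def by blast
  let ?I = "Inl ` P \<union> Inr ` P'"
  let ?p = "case_sum (\<lambda>x. x) (\<lambda>_. \<one>) :: 'a + 'a \<Rightarrow> 'a"
  let ?q = "case_sum (\<lambda>_. \<one>) (\<lambda>x. x) :: 'a + 'a \<Rightarrow> 'a"
  have p: "?p \<in> ?I \<rightarrow> carrier G" and q: "?q \<in> ?I \<rightarrow> carrier G" using F F' by auto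
  let ?N = "{u. set_mset u \<subseteq> ?I}"
  have pc: "mset_prod ?p u \<in> carrier G" and qc: "mset_prod ?q u \<in> carrier G" if "set_mset u \<subseteq> ?I" for u
    using mset_prod_closed[OF p that] mset_prod_closed[OF q that] .
  let ?Z = "\<lambda>(f, f'). {u \<in> ?N. f \<otimes> mset_prod ?p u = f' \<otimes> mset_prod ?q u}"
  let ?Zh = "{u \<in> ?N. mset_prod ?p u = mset_prod ?q u}"
  have sat: "f \<otimes> mset_prod ?p (u + w) = f' \<otimes> mset_prod ?q (u + w) \<longleftrightarrow> mset_prod ?p w = mset_prod ?q w"
    if "f \<in> carrier G" "f' \<in> carrier G" "set_mset u \<subseteq> ?I" "set_mset w \<subseteq> ?I"
      "f \<otimes> mset_prod ?p u = f' \<otimes> mset_prod ?q u" for f f' u w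
  proof -
    have "f \<otimes> mset_prod ?p (u + w) = f' \<otimes> mset_prod ?q u \<otimes> mset_prod ?p w"
      using that pc qc by (simp add: mset_prod_union[OF p] m_assoc flip: that(5))
    moreover have "f' \<otimes> mset_prod ?q (u + w) = f' \<otimes> mset_prod ?q u \<otimes> mset_prod ?q w"
      using that qc by (simp add: mset_prod_union[OF q] m_assoc)
    ultimately show ?thesis using that pc qc by (metis l_cancel m_closed)
  qed
  have one: "mset_prod r u = \<one>" if "\<And>i. i \<in># u \<Longrightarrow> r i = \<one>" for r :: "'a + 'a \<Rightarrow> 'a" and u
    unfolding mset_prod_def by (rule finprod_one_eqI) (simp add: that)
  have N: "mset_prod ?p u \<in> cone P" "mset_prod ?q u \<in> cone P'" if "u \<in> ?N" for u
  proof -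
    have "mset_prod ?p u \<in> cone (?p ` ?I)" "mset_prod ?q u \<in> cone (?q ` ?I)"
      unfolding cone_image[OF p] cone_image[OF q] using that by (rule imageI)+
    moreover have "?p ` ?I \<subseteq> insert \<one> P" "?q ` ?I \<subseteq> insert \<one> P'" by auto
    ultimately have "mset_prod ?p u \<in> cone (insert \<one> P)" "mset_prod ?q u \<in> cone (insert \<one> P')"
      by (auto intro: cone_mono)
    then show "mset_prod ?p u \<in> cone P" "mset_prod ?q u \<in> cone P'"
      by (simp_all only: cone_insert_one[OF F(4)] cone_insert_one[OF F'(4)])
  qed
  have p': "?p \<in> Inl ` P \<rightarrow> carrier G" and q': "?q \<in> Inr ` P' \<rightarrow> carrier G" using F(4) F'(4) by auto
  have coneP: "cone P = mset_prod ?p ` {u. set_mset u \<subseteq> Inl ` P}"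
    using cone_image[OF p'] by (simp add: image_image)
  have coneP': "cone P' = mset_prod ?q ` {u. set_mset u \<subseteq> Inr ` P'}"
    using cone_image[OF q'] by (simp add: image_image)
  have "X \<inter> Y = {(\<lambda>(f, f'). f) l \<otimes> mset_prod ?p u | l u. l \<in> F \<times> F' \<and> u \<in> ?Z l}"
  proof (intro equalityI subsetI)
    fix x assume "x \<in> X \<inter> Y"
    then obtain f a f' b where x: "f \<in> F" "f' \<in> F'" "a \<in> cone P" "b \<in> cone P'"
      "x = f \<otimes> a" "x = f' \<otimes> b"
      unfolding F(5) F'(5) set_mult_def by blast
    have "a \<in> mset_prod ?p ` {u. set_mset u \<subseteq> Inl ` P}"
      using x(3) coneP by blast
    then obtain u where u: "set_mset u \<subseteq> Inl ` P" "a = mset_prod ?p u" by blast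
    have "b \<in> mset_prod ?q ` {u. set_mset u \<subseteq> Inr ` P'}"
      using x(4) coneP' by blast
    then obtain w where w: "set_mset w \<subseteq> Inr ` P'" "b = mset_prod ?q w" by blast
    have uw: "set_mset u \<subseteq> ?I" "set_mset w \<subseteq> ?I" using u w by auto
    have "mset_prod ?p w = \<one>" "mset_prod ?q u = \<one>" using u(1) w(1) by (auto intro!: one)
    then have "mset_prod ?p (u + w) = a" "mset_prod ?q (u + w) = b"
      using u(2) w(2) pc[OF uw(1)] qc[OF uw(2)] by (simp_all add: mset_prod_union[OF p uw] mset_prod_union[OF q uw])
    then show "x \<in> {(\<lambda>(f, f'). f) l \<otimes> mset_prod ?p u | l u. l \<in> F \<times> F' \<and> u \<in> ?Z l}"
      using x uw by (intro CollectI exI[of _ "(f, f')"] exI[of _ "u + w"]) auto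
  next
    fix x assume "x \<in> {(\<lambda>(f, f'). f) l \<otimes> mset_prod ?p u | l u. l \<in> F \<times> F' \<and> u \<in> ?Z l}"
    then obtain f f' u where "f \<in> F" "f' \<in> F'" "u \<in> ?N" "x = f \<otimes> mset_prod ?p u" "x = f' \<otimes> mset_prod ?q u"
      by auto
    then show "x \<in> X \<inter> Y" unfolding F(5) F'(5) set_mult_def using N[of u] by blast
  qed
  moreover have "fg_set \<dots>"
  proof (rule fg_set_parametrized[where I = ?I and ?Z0.0 = ?Zh])
    fix l u w assume *: "l \<in> F \<times> F'" "u \<in> ?Z l" "set_mset w \<subseteq> ?I"
    obtain f f' where l: "l = (f, f')" by fastforce
    have "f \<in> carrier G" "f' \<in> carrier G" "set_mset u \<subseteq> ?I" "f \<otimes> mset_prod ?p u = f' \<otimes> mset_prod ?q u"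
      using * F F' l by auto
    with sat[OF this(1,2,3) *(3) this(4)] *(3) show "u + w \<in> ?Z l \<longleftrightarrow> w \<in> ?Zh"
      unfolding l by simp
  next
    fix u w assume "u \<in> ?Zh" "set_mset w \<subseteq> ?I"
    with sat[of \<one> \<one> u w] show "u + w \<in> ?Zh \<longleftrightarrow> w \<in> ?Zh" by (simp add: pc qc)
  qed (use F F' p in auto)
  ultimately show ?thesis by simp
qed

section \<open>Labels of walks in a finite graph\<close>

text \<open>Labels of the nonempty walks from \<open>p\<close> to \<open>q\<close> all of whose intermediate vertices lie in \<open>K\<close>. Concatenating
  two walks, instead of appending an edge, lets Kleene's decomposition be proved by one
  induction.\<close>
inductive path :: "('a, 'b) monoid_scheme \<Rightarrow> ('q \<times> 'a \<times> 'q) set \<Rightarrow> 'q set \<Rightarrow> 'q \<Rightarrow> 'a \<Rightarrow> 'q \<Rightarrow> bool"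
  for G D K where
  path_edge: "(p, a, q) \<in> D \<Longrightarrow> path G D K p a q"
| path_concat: "path G D K p a r \<Longrightarrow> r \<in> K \<Longrightarrow> path G D K r b q \<Longrightarrow> path G D K p (a \<otimes>\<^bsub>G\<^esub> b) q"

lemma path_mono: "path G D K p a q \<Longrightarrow> K \<subseteq> L \<Longrightarrow> path G D L p a q"
  by (induction rule: path.induct) (auto intro: path.intros)

context comm_monoid
begin

lemma path_closed:
  assumes "path G D K p a q" "D \<subseteq> UNIV \<times> carrier G \<times> UNIV"
  shows "a \<in> carrier G"
  using assms(1) by induction (use assms(2) in auto)

lemma path_cone:
  assumes D: "D \<subseteq> UNIV \<times> carrier G \<times> UNIV"
    and "c \<in> cone {a. path G D K k a k}" "path G D K k b q" "k \<in> K"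
  shows "path G D K k (c \<otimes> b) q"
  using assms(2)
proof induction
  case cone_one
  show ?case using assms(3) path_closed[OF assms(3) D] by simp
next
  case (cone_step x y)
  have "y \<in> carrier G" using cone_step path_closed[OF _ D] by (intro cone_closed[of "{a. path G D K k a k}"]) auto
  then have "x \<otimes> y \<otimes> b = x \<otimes> (y \<otimes> b)"
    using cone_step path_closed[OF _ D] path_closed[OF assms(3) D] by (simp add: m_assoc)
  with cone_step assms(4) show ?case by (auto intro: path_concat)
qed

text \<open>Kleene's decomposition of a walk at its visits to \<open>k\<close>.\<close>
lemma path_insert:
  assumes D: "D \<subseteq> UNIV \<times> carrier G \<times> UNIV"
  shows "{a. path G D (insert k K) p a q} = {a. path G D K p a q} \<union>
    ({a. path G D K p a k} <#> (cone {a. path G D K k a k} <#> {a. path G D K k a q}))"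
    (is "_ = ?R p q")
proof (intro equalityI subsetI)
  note pc = path_closed[OF _ D]
  let ?C = "cone {a. path G D K k a k}"
  have X: "{a. path G D K k a k} \<subseteq> carrier G" using pc by blast
  note cc = cone_closed[OF X]
  have RI: "a \<in> ?R p q"
    if "path G D K p x k" "c \<in> ?C" "path G D K k y q" "a = x \<otimes> (c \<otimes> y)" for p q x y c a
    using that by (auto intro: set_multI)
  have RE: "path G D K p a q \<or>
      (\<exists>x c y. path G D K p x k \<and> c \<in> ?C \<and> path G D K k y q \<and> a = x \<otimes> (c \<otimes> y))"
    if "a \<in> ?R p q" for p q a
    using that by (auto elim!: set_multE)
  fix a assume "a \<in> {a. path G D (insert k K) p a q}"
  then have "path G D (insert k K) p a q" by simp
  then show "a \<in> ?R p q"
  proof induction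
    case (path_edge p a q)
    then show ?case by (auto intro: path.path_edge)
  next
    case (path_concat p a r b q)
    from RE[OF path_concat.IH(1)] show ?case
    proof (elim disjE exE conjE)
      assume a: "path G D K p a r"
      from RE[OF path_concat.IH(2)] show ?case
      proof (elim disjE exE conjE)
        assume b: "path G D K r b q"
        show ?case
        proof (cases "r \<in> K")
          case True
          then show ?thesis using path.path_concat[OF a _ b] by simp
        next
          case False
          then have "r = k" using path_concat by simp
          then show ?thesis using a b pc by (intro RI[of p a \<one> b q]) (auto intro: cone_one)
        qed
      next
        fix x c y assume b: "path G D K r x k" "c \<in> ?C" "path G D K k y q" "b = x \<otimes> (c \<otimes> y)"
        have cl: "a \<in> carrier G" "x \<in> carrier G" "c \<in> carrier G" "y \<in> carrier G"
          using a b pc cc by auto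
        show ?case
        proof (cases "r \<in> K")
          case True
          then show ?thesis using path.path_concat[OF a _ b(1)] b cl
            by (intro RI[of p "a \<otimes> x" c y q]) (auto simp: m_assoc)
        next
          case False
          then have "r = k" using path_concat by simp
          then show ?thesis using a b cl
            by (intro RI[of p a "x \<otimes> c" y q]) (auto simp: m_assoc intro: cone_step)
        qed
      qed
    next
      fix x c y assume a: "path G D K p x k" "c \<in> ?C" "path G D K k y r" "a = x \<otimes> (c \<otimes> y)"
      have cl: "x \<in> carrier G" "c \<in> carrier G" "y \<in> carrier G" using a pc cc by auto
      from RE[OF path_concat.IH(2)] show ?case
      proof (elim disjE exE conjE)
        assume b: "path G D K r b q"
        then have bc: "b \<in> carrier G" using pc by auto
        show ?case
        proof (cases "r \<in> K")
          case True
          then show ?thesis using path.path_concat[OF a(3) _ b] a bc cl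
            by (intro RI[of p x c "y \<otimes> b" q]) (auto simp: m_assoc)
        next
          case False
          then have "r = k" using path_concat by simp
          then show ?thesis using a b cl bc cone_mult[OF X a(2) cone_base[OF X, of y]]
            by (intro RI[of p x "c \<otimes> y" b q]) (auto simp: m_assoc)
        qed
      next
        fix x' c' y' assume b: "path G D K r x' k" "c' \<in> ?C" "path G D K k y' q" "b = x' \<otimes> (c' \<otimes> y')"
        have cl': "x' \<in> carrier G" "c' \<in> carrier G" "y' \<in> carrier G" using b pc cc by auto
        \<comment> \<open>The piece between the last visit to \<open>k\<close> before \<open>r\<close> and the first one after it is a closed walk at \<open>k\<close>.\<close>
        have yx: "y \<otimes> x' \<in> ?C"
        proof (cases "r \<in> K")
          case True
          show ?thesis by (rule cone_base[OF X]) (use path.path_concat[OF a(3) True b(1)] in simp)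
        next
          case False
          then have "r = k" using path_concat by simp
          then show ?thesis using a b by (intro cone_mult[OF X] cone_base[OF X]) auto
        qed
        have "a \<otimes> b = x \<otimes> ((c \<otimes> ((y \<otimes> x') \<otimes> c')) \<otimes> y')"
          unfolding a b using cl cl' by (simp add: m_assoc)
        moreover have "c \<otimes> ((y \<otimes> x') \<otimes> c') \<in> ?C"
          by (intro cone_mult[OF X] a(2) b(2) yx)
        ultimately show ?case using a(1) b(3) by (intro RI[of p x _ y' q])
      qed
    qed
  qed
next
  fix a assume "a \<in> ?R p q"
  then consider "path G D K p a q" | x c y where "path G D K p x k"
    "c \<in> cone {a. path G D K k a k}" "path G D K k y q" "a = x \<otimes> (c \<otimes> y)"
    by (auto elim!: set_multE)
  then show "a \<in> {a. path G D (insert k K) p a q}"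
  proof cases
    case 1
    then show ?thesis by (auto intro: path_mono)
  next
    case 2
    have "c \<in> cone {a. path G D (insert k K) k a k}"
      using 2(2) by (rule cone_mono) (auto intro: path_mono)
    moreover have "path G D (insert k K) k y q" "path G D (insert k K) p x k"
      using 2 by (auto intro: path_mono)
    ultimately show ?thesis
      using 2(4) path_cone[OF D, of c "insert k K" k y q] by (auto intro!: path_concat[where r = k])
  qed
qed

lemma semilinear_paths:
  assumes D: "finite D" "D \<subseteq> UNIV \<times> carrier G \<times> UNIV" and K: "finite K"
  shows "semilinear {a. path G D K p a q}"
  using K
proof (induction arbitrary: p q)
  case empty
  have "{a. path G D {} p a q} = {a. (p, a, q) \<in> D}"
    by (auto intro: path_edge elim: path.cases)
  moreover have "finite {a. (p, a, q) \<in> D}"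
    by (rule finite_subset[OF _ finite_imageI[OF D(1), of "fst \<circ> snd"]]) force
  ultimately show ?case using D(2) by (auto intro!: semilinear_fg_set fg_set_finite)
next
  case (insert k K)
  show ?case unfolding path_insert[OF D(2)]
    by (intro insert.IH semilinear_Un semilinear_mult semilinear_cone)
qed

section \<open>Generating functions of finitely generated sets\<close>

lemma stable_cone:
  assumes X: "X \<subseteq> carrier G" and P: "P \<subseteq> carrier G"
    and stable: "\<And>p x. p \<in> P \<Longrightarrow> x \<in> X \<Longrightarrow> p \<otimes> x \<in> X"
    and c: "c \<in> cone P" and x: "x \<in> X"
  shows "x \<otimes> c \<in> X"
  using c
proof induction
  case cone_one
  then show ?case using X x by auto
next
  case (cone_step p c)
  then have "x \<otimes> (p \<otimes> c) = p \<otimes> (x \<otimes> c)"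
    using X x P cone_closed[OF P, of c] by (intro m_lcomm) auto
  with cone_step stable show ?case by simp
qed

text \<open>Finitely generated modules are Noetherian: for each generator \<open>f\<close> the exponent vectors that lead from
  \<open>f\<close> into the stable set \<open>X\<close> form an upward closed set, which has finitely many minimal elements.\<close>
lemma stable_subset_finitely_generated:
  assumes F: "finite F" "F \<subseteq> carrier G" and P: "finite P" "P \<subseteq> carrier G"
    and X: "X \<subseteq> F <#> cone P" and stable: "\<And>p x. p \<in> P \<Longrightarrow> x \<in> X \<Longrightarrow> p \<otimes> x \<in> X"
  obtains F' where "finite F'" "F' \<subseteq> carrier G" "X = F' <#> cone P"
proof -
  let ?v = "mset_prod (\<lambda>x. x)"
  have p: "(\<lambda>x. x) \<in> P \<rightarrow> carrier G" using P by auto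
  note mc = mset_prod_closed[OF p] and mu = mset_prod_union[OF p]
  have Xc: "X \<subseteq> carrier G" using X fg_set_closed[OF fg_setI[OF F P refl]] by blast
  let ?Z = "\<lambda>f. {u. set_mset u \<subseteq> P \<and> f \<otimes> ?v u \<in> X}"
  have "\<forall>f. \<exists>B. finite B \<and> B \<subseteq> ?Z f \<and> (\<forall>u\<in>?Z f. \<exists>b\<in>B. b \<subseteq># u)"
    by (intro allI dickson_multiset[OF P(1)]) simp
  from choice[OF this] obtain B where
    "\<forall>f. finite (B f) \<and> B f \<subseteq> ?Z f \<and> (\<forall>u\<in>?Z f. \<exists>b\<in>B f. b \<subseteq># u)" ..
  then have B: "\<And>f. finite (B f)" "\<And>f. B f \<subseteq> ?Z f" "\<And>f u. u \<in> ?Z f \<Longrightarrow> \<exists>b\<in>B f. b \<subseteq># u"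
    by simp_all
  let ?F = "\<Union>f\<in>F. (\<lambda>b. f \<otimes> ?v b) ` B f"
  have FX: "?F \<subseteq> X" using B(2) by blast
  have "X = ?F <#> cone P"
  proof (intro equalityI subsetI)
    fix x assume x: "x \<in> X"
    then obtain f u where u: "f \<in> F" "set_mset u \<subseteq> P" "x = f \<otimes> ?v u"
      using X unfolding cone_eq_mset_prod[OF P(2)] by (blast elim: set_multE)
    then have "u \<in> ?Z f" using x by simp
    then obtain b where b: "b \<in> B f" "b \<subseteq># u" using B(3) by blast
    then have bP: "set_mset b \<subseteq> P" and uP: "set_mset (u - b) \<subseteq> P"
      using u(2) by (auto dest: in_diffD mset_subset_eqD)
    have "?v u = ?v b \<otimes> ?v (u - b)" using mu[OF bP uP] b(2) by simp
    then have "x = (f \<otimes> ?v b) \<otimes> ?v (u - b)"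
      using u(1,3) F(2) bP uP by (auto simp: m_assoc mc)
    moreover have "?v (u - b) \<in> cone P" unfolding cone_eq_mset_prod[OF P(2)] using uP by blast
    moreover have "f \<otimes> ?v b \<in> ?F" using u(1) b(1) by blast
    ultimately show "x \<in> ?F <#> cone P" by (simp add: set_multI)
  next
    fix x assume "x \<in> ?F <#> cone P"
    then obtain y c where "y \<in> ?F" "c \<in> cone P" "x = y \<otimes> c" by (rule set_multE)
    then show "x \<in> X" using FX stable_cone[OF Xc P(2) stable] by blast
  qed
  moreover have "finite ?F" using F(1) B(1) by blast
  ultimately show thesis using that[of ?F] FX Xc by blast
qed

lemma cone_insertE:
  assumes x: "x \<in> cone (insert p P)" and P: "insert p P \<subseteq> carrier G"
  obtains "x \<in> cone P" | y where "y \<in> cone (insert p P)" "x = p \<otimes> y"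
proof -
  have "x \<in> cone P \<or> (\<exists>y\<in>cone (insert p P). x = p \<otimes> y)"
    using x
  proof induction
    case (cone_step q y)
    show ?case
    proof (cases "q = p")
      case False
      then have q: "q \<in> P" using cone_step by simp
      from cone_step.IH show ?thesis
      proof
        assume "y \<in> cone P"
        then show ?thesis using q by (simp add: cone.cone_step)
      next
        assume "\<exists>z\<in>cone (insert p P). y = p \<otimes> z"
        then obtain z where z: "z \<in> cone (insert p P)" "y = p \<otimes> z" ..
        have "q \<otimes> y = p \<otimes> (q \<otimes> z)"
          using z q P cone_closed[OF P z(1)] by (auto intro: m_lcomm)
        moreover have "q \<otimes> z \<in> cone (insert p P)" using z q by (simp add: cone.cone_step)
        ultimately show ?thesis by blast
      qed
    qed (use cone_step in blast)
  qed (simp add: cone_one)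
  with that show thesis by blast
qed

end

text \<open>A grading by exponent vectors in which only the unit has degree zero. This makes the exponent
  vectors \<open>wt p\<close> of generators \<open>p \<noteq> \<one>\<close> nonzero, so that one minus the monomial of \<open>p\<close> can be a denominator, and it makes
  the sets counted below finite.\<close>
locale graded_monoid = comm_monoid_cancel G for G :: "('a, 'b) monoid_scheme" (structure) +
  fixes wt :: "'a \<Rightarrow> nat \<Rightarrow>\<^sub>0 nat" and d :: nat
  assumes wt_mult: "x \<in> carrier G \<Longrightarrow> y \<in> carrier G \<Longrightarrow> wt (x \<otimes> y) = wt x + wt y"
    and wt_zero: "x \<in> carrier G \<Longrightarrow> wt x = 0 \<Longrightarrow> x = \<one>"
    and wt_keys: "x \<in> carrier G \<Longrightarrow> keys (wt x) \<subseteq> {1..d}"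
begin

definition total_degree :: "'a \<Rightarrow> nat" where
  "total_degree x = (\<Sum>i = 1..d. lookup (wt x) i)"

lemma total_degree_mult: "x \<in> carrier G \<Longrightarrow> y \<in> carrier G \<Longrightarrow> total_degree (x \<otimes> y) = total_degree x + total_degree y"
  by (simp add: total_degree_def wt_mult lookup_add sum.distrib)

lemma total_degree_pos: assumes "x \<in> carrier G" "x \<noteq> \<one>" shows "0 < total_degree x"
proof -
  have "wt x \<noteq> 0" using assms wt_zero by blast
  then obtain i where "i \<in> keys (wt x)" using keys_eq_empty by (metis all_not_in_conv)
  moreover have "i \<in> {1..d}" using calculation wt_keys[OF assms(1)] by blast
  ultimately show ?thesis unfolding total_degree_def
    by (intro sum_pos2[where i = i]) (auto simp: in_keys_iff)
qed

lemma finite_cone_total_degree: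
  assumes P: "finite P" "P \<subseteq> carrier G" "\<one> \<notin> P"
  shows "finite {x \<in> cone P. total_degree x < n}"
proof (induction n)
  case (Suc n)
  have "{x \<in> cone P. total_degree x < Suc n} \<subseteq> {\<one>} \<union> (\<Union>p\<in>P. (\<otimes>) p ` {x \<in> cone P. total_degree x < n})"
  proof
    fix x assume x: "x \<in> {x \<in> cone P. total_degree x < Suc n}"
    then have "x \<in> cone P" by simp
    then show "x \<in> {\<one>} \<union> (\<Union>p\<in>P. (\<otimes>) p ` {x \<in> cone P. total_degree x < n})"
    proof cases
      case (cone_step p y)
      then have c: "p \<in> carrier G" "y \<in> carrier G" using P cone_closed[OF P(2)] by auto
      have "0 < total_degree p" using c P cone_step by (intro total_degree_pos) auto
      then have "total_degree y < n" using x cone_step total_degree_mult[OF c] by simp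
      then show ?thesis using cone_step by blast
    qed simp
  qed
  then show ?case using Suc P(1) by (auto intro: finite_subset)
qed simp

lemma fg_set_nontrivialE:
  assumes "fg_set X"
  obtains F P where "finite F" "F \<subseteq> carrier G" "finite P" "P \<subseteq> carrier G" "\<one> \<notin> P" "X = F <#> cone P"
proof -
  obtain F P where F: "finite F" "F \<subseteq> carrier G" "finite P" "P \<subseteq> carrier G" "X = F <#> cone P"
    using assms unfolding fg_set_def by blast
  have "cone (insert \<one> (P - {\<one>})) = cone (P - {\<one>})" using F by (intro cone_insert_one) auto
  moreover have "cone (insert \<one> (P - {\<one>})) = cone P"
    by (cases "\<one> \<in> P") (use F(4) in \<open>simp_all add: insert_absorb cone_insert_one\<close>)
  ultimately show thesis using F by (intro that[of F "P - {\<one>}"]) auto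
qed

lemma finite_fg_set_weight:
  assumes "fg_set X" shows "finite {x \<in> X. wt x = e}"
proof -
  obtain F P where F: "finite F" "F \<subseteq> carrier G" "finite P" "P \<subseteq> carrier G" "\<one> \<notin> P" "X = F <#> cone P"
    using assms by (rule fg_set_nontrivialE)
  let ?n = "Suc (\<Sum>i = 1..d. lookup e i)"
  have "{x \<in> X. wt x = e} \<subseteq> (\<Union>f\<in>F. (\<otimes>) f ` {x \<in> cone P. total_degree x < ?n})"
  proof
    fix x assume x: "x \<in> {x \<in> X. wt x = e}"
    then obtain f c where c: "f \<in> F" "c \<in> cone P" "x = f \<otimes> c" unfolding F(6) by (auto elim: set_multE)
    have "total_degree x = (\<Sum>i = 1..d. lookup e i)" using x by (simp add: total_degree_def)
    moreover have "total_degree x = total_degree f + total_degree c" using c F cone_closed[OF F(4)] by (auto simp: total_degree_mult)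
    ultimately have "c \<in> {x \<in> cone P. total_degree x < ?n}" using c(2) by simp
    then show "x \<in> (\<Union>f\<in>F. (\<otimes>) f ` {x \<in> cone P. total_degree x < ?n})" using c by blast
  qed
  then show ?thesis by (rule finite_subset) (use F(1) finite_cone_total_degree[OF F(3-5)] in blast)
qed

lemma finite_semilinear_weight: "semilinear X \<Longrightarrow> finite {x \<in> X. wt x = e}"
  by (induction rule: semilinear.induct) (simp_all add: Collect_disj_eq conj_disj_distribR finite_fg_set_weight)

definition weight_series :: "'a set \<Rightarrow> mseries" where
  "weight_series X e = int (card {x \<in> X. wt x = e})"

lemma weight_series_Un:
  assumes "\<And>e. finite {x \<in> A. wt x = e}" "\<And>e. finite {x \<in> B. wt x = e}" "A \<inter> B = {}"
  shows "weight_series (A \<union> B) e = weight_series A e + weight_series B e"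
proof -
  have "{x \<in> A \<union> B. wt x = e} = {x \<in> A. wt x = e} \<union> {x \<in> B. wt x = e}" by blast
  moreover have "{x \<in> A. wt x = e} \<inter> {x \<in> B. wt x = e} = {}" using assms(3) by blast
  ultimately show ?thesis by (simp add: weight_series_def card_Un_disjoint assms)
qed

lemma weight_series_translate:
  assumes p: "p \<in> carrier G" and Z: "Z \<subseteq> carrier G"
  shows "weight_series ((\<otimes>) p ` Z) = mseries_times (lookup (Poly_Mapping.single (wt p) 1)) (weight_series Z)"
proof
  fix e
  have inj: "inj_on ((\<otimes>) p) Z" using p Z by (auto intro!: inj_onI dest: l_cancel)
  have w: "wt (p \<otimes> z) = wt p + wt z" if "z \<in> Z" for z using that p Z by (auto simp: wt_mult)
  show "weight_series ((\<otimes>) p ` Z) e = mseries_times (lookup (Poly_Mapping.single (wt p) 1)) (weight_series Z) e"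
  proof (cases "\<exists>b. wt p + b = e")
    case True
    then obtain b where b: "e = wt p + b" by blast
    have "{x \<in> (\<otimes>) p ` Z. wt x = e} = (\<otimes>) p ` {z \<in> Z. wt z = b}" using w by (auto simp: b)
    moreover have "inj_on ((\<otimes>) p) {z \<in> Z. wt z = b}" using inj by (rule inj_on_subset) blast
    ultimately have "weight_series ((\<otimes>) p ` Z) e = weight_series Z b" by (simp add: weight_series_def card_image)
    then show ?thesis unfolding mseries_times_monomial using b by simp
  next
    case False
    then have "{x \<in> (\<otimes>) p ` Z. wt x = e} = {}" using w by auto
    then have "weight_series ((\<otimes>) p ` Z) e = 0" unfolding weight_series_def by (simp only: card.empty of_nat_0)
    then show ?thesis unfolding mseries_times_monomial using False by simp
  qed
qed

lemma rational_weight_series_finite: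
  assumes "finite Y" "Y \<subseteq> carrier G" shows "rational_series d (weight_series Y)"
proof -
  have "weight_series Y e = (\<Sum>y\<in>Y. lookup (Poly_Mapping.single (wt y) 1) e)" for e
    using assms(1) by (simp add: weight_series_def lookup_single when_def sum.If_cases Int_def eq_commute[of e])
  then have "weight_series Y = (\<lambda>e. \<Sum>y\<in>Y. lookup (Poly_Mapping.single (wt y) 1) e)" ..
  moreover have "rational_series d \<dots>"
    using assms(2) by (intro rational_series_sum rational_series_lookup in_variables_single wt_keys) auto
  ultimately show ?thesis by (simp only:)
qed

text \<open>The Hilbert--Serre argument, by induction on the number of generators of the acting monoid. Differences
  \<open>X - X'\<close> of stable sets take the place of quotient modules. Let \<open>p\<close> be the new generator.

  If \<open>p\<close> annihilates the quotient, that is, \<open>p X \<subseteq> X'\<close>, then \<open>X - X'\<close> is already such a difference for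
  the monoid without \<open>p\<close>. In general, put \<open>Y = X - X'\<close> and let \<open>X2\<close> consist of the elements of \<open>X\<close> that
  \<open>p\<close> maps into \<open>X'\<close>. Then \<open>Y\<close> is the disjoint union of the cokernel \<open>X - (X' \<union> p X)\<close> and of
  \<open>p (X - X2)\<close>, and also that of the kernel \<open>X2 - X'\<close> and of \<open>X - X2\<close>. As \<open>p\<close> annihilates kernel and
  cokernel, this expresses \<open>(1 - z\<^sup>m) Y\<close>, where \<open>m\<close> is the weight of \<open>p\<close>, through two rational series.\<close>
theorem rational_series_stable_diff:
  assumes "finite P" "P \<subseteq> carrier G" "\<one> \<notin> P" "finite F" "F \<subseteq> carrier G"
    "X' \<subseteq> F <#> cone P" "\<And>p x. p \<in> P \<Longrightarrow> x \<in> X' \<Longrightarrow> p \<otimes> x \<in> X'"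
  shows "rational_series d (weight_series ((F <#> cone P) - X'))"
  using assms
proof (induction P arbitrary: F X')
  case empty
  have F0: "F <#> cone {} = F" unfolding cone_empty using empty(4) by (rule set_mult_one)
  show ?case using rational_weight_series_finite[of "F - X'"] empty(3,4) by (auto simp: F0)
next
  case (insert p P)
  note iP = insert.prems(1)
  have p: "p \<in> carrier G" "p \<noteq> \<one>" and P: "P \<subseteq> carrier G" "\<one> \<notin> P" using insert.prems by auto
  \<comment> \<open>The case in which \<open>p\<close> annihilates the quotient: an element with a factor \<open>p\<close> lies in \<open>Y\<close>.\<close>
  have killed: "rational_series d (weight_series ((F <#> cone (insert p P)) - Y))"
    if F: "finite F" "F \<subseteq> carrier G" and Y: "Y \<subseteq> F <#> cone (insert p P)"
      "\<And>q x. q \<in> insert p P \<Longrightarrow> x \<in> Y \<Longrightarrow> q \<otimes> x \<in> Y"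
      "\<And>x. x \<in> F <#> cone (insert p P) \<Longrightarrow> p \<otimes> x \<in> Y" for F Y
  proof -
    have "(F <#> cone (insert p P)) - Y = (F <#> cone P) - (F <#> cone P) \<inter> Y"
    proof (intro equalityI subsetI)
      fix x assume x: "x \<in> (F <#> cone (insert p P)) - Y"
      then obtain f c where c: "f \<in> F" "c \<in> cone (insert p P)" "x = f \<otimes> c" by (auto elim: set_multE)
      from c(2) iP show "x \<in> (F <#> cone P) - (F <#> cone P) \<inter> Y"
      proof (cases rule: cone_insertE)
        case 1
        then show ?thesis using c x by (auto intro: set_multI)
      next
        case (2 y)
        then have "x = p \<otimes> (f \<otimes> y)" using c p F cone_closed[OF iP] by (auto intro: m_lcomm)
        then have "x \<in> Y" using c(1) 2 Y(3) by (simp add: set_multI)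
        with x show ?thesis by simp
      qed
    next
      fix x assume "x \<in> (F <#> cone P) - (F <#> cone P) \<inter> Y"
      then show "x \<in> (F <#> cone (insert p P)) - Y"
        by (auto elim!: set_multE intro!: set_multI intro: cone_mono)
    qed
    moreover have "q \<otimes> x \<in> (F <#> cone P) \<inter> Y" if qx: "q \<in> P" "x \<in> (F <#> cone P) \<inter> Y" for q x
    proof -
      obtain f c where c: "f \<in> F" "c \<in> cone P" "x = f \<otimes> c"
        using IntD1[OF qx(2)] by (rule set_multE)
      then have "q \<otimes> x = f \<otimes> (q \<otimes> c)" using qx F P cone_closed[OF P(1)] by (auto intro: m_lcomm)
      then have "q \<otimes> x \<in> F <#> cone P" using qx c by (simp add: set_multI cone_step)
      then show ?thesis using qx Y(2)[of q x] by simp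
    qed
    ultimately show ?thesis using insert.IH[OF P F, of "(F <#> cone P) \<inter> Y"] by simp
  qed
  let ?X = "F <#> cone (insert p P)"
  have Xfg: "fg_set ?X" using insert by (intro fg_setI[OF _ _ _ _ refl]) auto
  then have Xc: "?X \<subseteq> carrier G" by (rule fg_set_closed)
  have Xst: "q \<otimes> x \<in> ?X" if qx: "q \<in> insert p P" "x \<in> ?X" for q x
  proof -
    obtain f c where c: "f \<in> F" "c \<in> cone (insert p P)" "x = f \<otimes> c" using qx(2) by (rule set_multE)
    then have "q \<otimes> x = f \<otimes> (q \<otimes> c)"
      using qx insert.prems(4) iP cone_closed[OF iP] by (auto intro: m_lcomm)
    then show ?thesis using qx c by (simp add: set_multI cone_step)
  qed
  have fin: "finite {x \<in> Y. wt x = e}" if "Y \<subseteq> ?X" for Y e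
    by (rule finite_subset[OF _ finite_fg_set_weight[OF Xfg, of e]]) (use that in auto)
  let ?X2 = "{x \<in> ?X. p \<otimes> x \<in> X'}" and ?W = "X' \<union> (\<otimes>) p ` ?X"
  have A: "rational_series d (weight_series (?X - ?W))"
  proof (rule killed)
    fix q x assume q: "q \<in> insert p P" "x \<in> ?W"
    show "q \<otimes> x \<in> ?W"
    proof (cases "x \<in> X'")
      case False
      then obtain y where y: "y \<in> ?X" "x = p \<otimes> y" using q by blast
      then have "q \<otimes> x = p \<otimes> (q \<otimes> y)" using q iP Xc by (auto intro: m_lcomm)
      then show ?thesis using Xst[OF q(1) y(1)] by blast
    qed (use q insert.prems(6) in blast)
  qed (use insert.prems Xst in auto)
  have stable2: "q \<otimes> x \<in> ?X2" if q: "q \<in> insert p P" "x \<in> ?X2" for q x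
  proof -
    have "p \<otimes> (q \<otimes> x) = q \<otimes> (p \<otimes> x)" using q iP Xc by (auto intro: m_lcomm)
    then show ?thesis using q Xst insert.prems(6) by simp
  qed
  obtain F2 where F2: "finite F2" "F2 \<subseteq> carrier G" "?X2 = F2 <#> cone (insert p P)"
    by (rule stable_subset_finitely_generated[of F "insert p P" ?X2])
      (use insert stable2 in auto)
  have X'2: "X' \<subseteq> ?X2" using insert.prems(5,6) by blast
  have B: "rational_series d (weight_series (?X2 - X'))"
    unfolding F2(3)
    by (rule killed) (use F2 X'2 insert.prems(6) in auto)
  let ?Y = "?X - X'"
  let ?T = "mseries_times (lookup (Poly_Mapping.single (wt p) (1 :: int)))"
  have Y1: "?Y = (?X - ?W) \<union> (\<otimes>) p ` (?X - ?X2)" using Xst by auto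
  have Y2: "?Y = (?X - ?X2) \<union> (?X2 - X')" using X'2 by blast
  have pX: "(\<otimes>) p ` (?X - ?X2) \<subseteq> ?X" using Xst by blast
  have 1: "weight_series ?Y e = weight_series (?X - ?W) e + ?T (weight_series (?X - ?X2)) e" for e
  proof -
    have "weight_series ((?X - ?W) \<union> (\<otimes>) p ` (?X - ?X2)) e = weight_series (?X - ?W) e + weight_series ((\<otimes>) p ` (?X - ?X2)) e"
      by (intro weight_series_Un fin pX) auto
    then show ?thesis unfolding Y1[symmetric] using p Xc by (subst (asm) weight_series_translate) auto
  qed
  have 2: "weight_series ?Y e = weight_series (?X - ?X2) e + weight_series (?X2 - X') e" for e
    by (subst Y2, intro weight_series_Un fin) auto
  have 3: "weight_series (?X - ?X2) = (\<lambda>e. weight_series ?Y e - weight_series (?X2 - X') e)" using 2 by (simp add: fun_eq_iff)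
  show ?case
  proof (rule rational_series_geometric)
    show "keys (wt p) \<subseteq> {1..d}" by (rule wt_keys[OF p(1)])
    show "wt p \<noteq> 0" using wt_zero p by blast
    have "weight_series ?Y e - ?T (weight_series ?Y) e = weight_series (?X - ?W) e - ?T (weight_series (?X2 - X')) e" for e
      using 1[of e] unfolding 3 mseries_times_diff_right by simp
    moreover have "rational_series d (\<lambda>e. weight_series (?X - ?W) e - ?T (weight_series (?X2 - X')) e)"
      by (intro rational_series_diff rational_series_times A B in_variables_single wt_keys[OF p(1)])
    ultimately show "rational_series d (\<lambda>e. weight_series ?Y e - ?T (weight_series ?Y) e)" by simp
  qed
qed

text \<open>Integer combinations of indicator functions; a constant multiple arises by repeated subtraction. Since
  intersections of finitely generated sets are finitely generated, these functions form a ring, which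
  replaces inclusion--exclusion.\<close>
inductive fg_span :: "('a \<Rightarrow> int) \<Rightarrow> bool" where
  fg_span_indicator: "fg_set X \<Longrightarrow> fg_span (\<lambda>x. of_bool (x \<in> X))"
| fg_span_diff: "fg_span f \<Longrightarrow> fg_span g \<Longrightarrow> fg_span (\<lambda>x. f x - g x)"

lemma fg_span_times:
  assumes "fg_span f" "fg_span g" shows "fg_span (\<lambda>x. f x * g x)"
  using assms(1)
proof induction
  case (fg_span_indicator X)
  from assms(2) show ?case
  proof induction
    case (fg_span_indicator Y)
    have "fg_span (\<lambda>x. of_bool (x \<in> X \<inter> Y))"
      by (intro fg_span.fg_span_indicator fg_set_Int fg_span_indicator \<open>fg_set X\<close>)
    then show ?case by (simp add: of_bool_conj)
  next
    case (fg_span_diff g h)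
    then show ?case by (simp add: right_diff_distrib fg_span.fg_span_diff)
  qed
next
  case (fg_span_diff f h)
  then show ?case by (simp add: left_diff_distrib fg_span.fg_span_diff)
qed

lemma fg_span_finite:
  assumes "fg_span f" shows "finite {x. wt x = e \<and> f x \<noteq> 0}"
  using assms
proof induction
  case (fg_span_indicator X)
  have "{x. wt x = e \<and> of_bool (x \<in> X) \<noteq> (0 :: int)} = {x \<in> X. wt x = e}" by auto
  then show ?case using finite_fg_set_weight[OF fg_span_indicator] by simp
next
  case (fg_span_diff f g)
  have "{x. wt x = e \<and> f x - g x \<noteq> 0} \<subseteq> {x. wt x = e \<and> f x \<noteq> 0} \<union> {x. wt x = e \<and> g x \<noteq> 0}"
    by auto
  then show ?case using fg_span_diff.IH by (auto intro: finite_subset)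
qed

lemma rational_fg_span:
  assumes "fg_span f" shows "rational_series d (\<lambda>e. \<Sum>x | wt x = e \<and> f x \<noteq> 0. f x)"
  using assms
proof induction
  case (fg_span_indicator X)
  obtain F P where F: "finite F" "F \<subseteq> carrier G" "finite P" "P \<subseteq> carrier G" "\<one> \<notin> P" "X = F <#> cone P"
    using fg_span_indicator by (rule fg_set_nontrivialE)
  have "(\<Sum>x | wt x = e \<and> of_bool (x \<in> X) \<noteq> (0 :: int). of_bool (x \<in> X)) = weight_series X e" for e
  proof -
    have "{x. wt x = e \<and> of_bool (x \<in> X) \<noteq> (0 :: int)} = {x \<in> X. wt x = e}" by auto
    then show ?thesis by (simp add: weight_series_def)
  qed
  moreover have "rational_series d (weight_series (X - {}))"
    unfolding F(6) using rational_series_stable_diff[OF F(3-5,1,2), of "{}"] by simp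
  ultimately show ?case by simp
next
  case (fg_span_diff f g)
  have "(\<Sum>x | wt x = e \<and> f x - g x \<noteq> 0. f x - g x) =
      (\<Sum>x | wt x = e \<and> f x \<noteq> 0. f x) - (\<Sum>x | wt x = e \<and> g x \<noteq> 0. g x)" for e
  proof -
    let ?A = "{x. wt x = e \<and> f x \<noteq> 0} \<union> {x. wt x = e \<and> g x \<noteq> 0}"
    have A: "finite ?A" using fg_span_finite fg_span_diff by blast
    have "(\<Sum>x | wt x = e \<and> f x - g x \<noteq> 0. f x - g x) = (\<Sum>x\<in>?A. f x - g x)"
      by (rule sum.mono_neutral_left[OF A]) auto
    also have "\<dots> = (\<Sum>x\<in>?A. f x) - (\<Sum>x\<in>?A. g x)" by (rule sum_subtractf)
    also have "(\<Sum>x\<in>?A. f x) = (\<Sum>x | wt x = e \<and> f x \<noteq> 0. f x)"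
      by (rule sum.mono_neutral_right[OF A]) auto
    also have "(\<Sum>x\<in>?A. g x) = (\<Sum>x | wt x = e \<and> g x \<noteq> 0. g x)"
      by (rule sum.mono_neutral_right[OF A]) auto
    finally show ?thesis .
  qed
  then show ?case using fg_span_diff.IH by (simp add: rational_series_diff)
qed

lemma fg_span_semilinear:
  assumes "semilinear X" shows "fg_span (\<lambda>x. of_bool (x \<in> X))"
  using assms
proof induction
  case semilinear_empty
  then show ?case by (intro fg_span_indicator fg_set_finite) auto
next
  case (semilinear_insert X Y)
  then have X: "fg_span (\<lambda>x. of_bool (x \<in> X))" by (intro fg_span_indicator)
  note Y = semilinear_insert.IH
  have "fg_span (\<lambda>x. of_bool (x \<in> X) - (of_bool (x \<in> X) * of_bool (x \<in> Y) - of_bool (x \<in> Y)))"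
    by (intro fg_span_diff fg_span_times X Y)
  moreover have "(\<lambda>x. of_bool (x \<in> X) - (of_bool (x \<in> X) * of_bool (x \<in> Y) - of_bool (x \<in> Y)) :: int) =
      (\<lambda>x. of_bool (x \<in> X \<union> Y))"
    by (auto simp: fun_eq_iff)
  ultimately show ?case by simp
qed

text \<open>The indicator function of \<open>X - Y\<close> is \<open>1\<^sub>X - 1\<^sub>X 1\<^sub>Y\<close>.\<close>
theorem rational_weight_series_semilinear_diff:
  assumes "semilinear X" "semilinear Y" shows "rational_series d (weight_series (X - Y))"
proof -
  have "fg_span (\<lambda>x. of_bool (x \<in> X) - of_bool (x \<in> X) * of_bool (x \<in> Y))"
    by (intro fg_span_diff fg_span_times fg_span_semilinear assms)
  moreover have "(\<lambda>x. of_bool (x \<in> X) - of_bool (x \<in> X) * of_bool (x \<in> Y) :: int) =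
      (\<lambda>x. of_bool (x \<in> X - Y))"
    by (auto simp: fun_eq_iff)
  ultimately have "fg_span (\<lambda>x. of_bool (x \<in> X - Y))" by simp
  from rational_fg_span[OF this]
  have "rational_series d (\<lambda>e. \<Sum>x | wt x = e \<and> of_bool (x \<in> X - Y) \<noteq> (0 :: int). of_bool (x \<in> X - Y))" .
  moreover have "(\<Sum>x | wt x = e \<and> of_bool (x \<in> X - Y) \<noteq> (0 :: int). of_bool (x \<in> X - Y)) = weight_series (X - Y) e" for e
  proof -
    have "{x. wt x = e \<and> of_bool (x \<in> X - Y) \<noteq> (0 :: int)} = {x \<in> X - Y. wt x = e}" by auto
    then show ?thesis by (simp add: weight_series_def)
  qed
  ultimately show ?thesis by simp
qed

end

section \<open>Representing group elements by weighted words\<close>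

lemma exponent_add_eq_0: "n + m = 0 \<longleftrightarrow> n = 0 \<and> m = 0" for n m :: "nat \<Rightarrow>\<^sub>0 nat"
  by (auto simp: poly_mapping_eq_iff fun_eq_iff lookup_add)

lemma keys_exponent_add: "keys (n + m) = keys n \<union> keys m" for n m :: "nat \<Rightarrow>\<^sub>0 nat"
  by (auto simp: in_keys_iff lookup_add)

text \<open>A group with an abelian subgroup \<open>N\<close> of finite index, given by the function \<open>rep\<close> that sends every element
  to the chosen representative of its coset, and a finite set \<open>T\<close> of steps with nonzero
  weights.\<close>
locale weighted_steps = group G for G :: "('a, 'b) monoid_scheme" (structure) +
  fixes N :: "'a set" and rep :: "'a \<Rightarrow> 'a"
    and T :: "((nat \<Rightarrow>\<^sub>0 nat) \<times> 'a) set" and d :: nat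
  assumes N: "subgroup N G" and N_comm: "\<And>a b. a \<in> N \<Longrightarrow> b \<in> N \<Longrightarrow> a \<otimes> b = b \<otimes> a"
    and rep_closed: "\<And>x. x \<in> carrier G \<Longrightarrow> rep x \<in> carrier G"
    and rep_coset: "\<And>x. x \<in> carrier G \<Longrightarrow> x \<otimes> inv (rep x) \<in> N"
    and rep_mult: "\<And>a x. a \<in> N \<Longrightarrow> x \<in> carrier G \<Longrightarrow> rep (a \<otimes> x) = rep x"
    and rep_one: "rep \<one> = \<one>"
    and finite_rep: "finite (rep ` carrier G)"
    and finite_T: "finite T"
    and T: "\<And>m s. (m, s) \<in> T \<Longrightarrow> s \<in> carrier G \<and> m \<noteq> 0 \<and> keys m \<subseteq> {1..d}"
begin

inductive represents :: "(nat \<Rightarrow>\<^sub>0 nat) \<Rightarrow> 'a \<Rightarrow> bool" where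
  represents_one: "represents 0 \<one>"
| represents_step: "represents n x \<Longrightarrow> (m, s) \<in> T \<Longrightarrow> represents (n + m) (x \<otimes> s)"

lemma represents_closed: "represents n x \<Longrightarrow> x \<in> carrier G \<and> keys n \<subseteq> {1..d}"
proof (induction rule: represents.induct)
  case (represents_step n x m s)
  then show ?case using T[of m s] Poly_Mapping.keys_add[of n m] by auto
qed simp

definition reps :: "'a set" where "reps = rep ` carrier G"

text \<open>The \<open>N\<close>-part of \<open>x = offset x \<otimes> rep x\<close>.\<close>
definition offset :: "'a \<Rightarrow> 'a" where "offset x = x \<otimes> inv (rep x)"

lemma reps_closed: "q \<in> reps \<Longrightarrow> q \<in> carrier G"
  using rep_closed by (auto simp: reps_def)

lemma N_closed: "a \<in> N \<Longrightarrow> a \<in> carrier G"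
  using subgroup.mem_carrier[OF N] .

lemma offset_in: "x \<in> carrier G \<Longrightarrow> offset x \<in> N"
  by (simp add: offset_def rep_coset)

lemma offset_rep: "x \<in> carrier G \<Longrightarrow> offset x \<otimes> rep x = x"
  by (simp add: offset_def rep_closed m_assoc)

lemma rep_idem: assumes "q \<in> reps" shows "rep q = q"
proof -
  obtain x where x: "x \<in> carrier G" "q = rep x" using assms unfolding reps_def by blast
  have "rep (offset x \<otimes> rep x) = rep (rep x)"
    using x by (intro rep_mult offset_in rep_closed)
  then show ?thesis using x by (simp add: offset_rep)
qed

lemma rep_N_reps: "a \<in> N \<Longrightarrow> q \<in> reps \<Longrightarrow> rep (a \<otimes> q) = q"
  by (simp add: rep_mult reps_closed rep_idem)

lemma offset_N_reps: "a \<in> N \<Longrightarrow> q \<in> reps \<Longrightarrow> offset (a \<otimes> q) = a"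
  unfolding offset_def by (simp add: rep_N_reps m_assoc N_closed reps_closed)

text \<open>Requiring \<open>a = \<one>\<close> whenever \<open>n = 0\<close> makes the first component a grading in which only the unit has
  degree zero. No label is lost, because every step has nonzero weight.\<close>
definition M :: "((nat \<Rightarrow>\<^sub>0 nat) \<times> 'a) monoid" where
  "M = \<lparr>carrier = {(n, a). keys n \<subseteq> {1..d} \<and> a \<in> N \<and> (n = 0 \<longrightarrow> a = \<one>)},
        monoid.mult = (\<lambda>(n, a) (m, b). (n + m, a \<otimes> b)), one = (0, \<one>)\<rparr>"

lemma carrier_M: "(n, a) \<in> carrier M \<longleftrightarrow> keys n \<subseteq> {1..d} \<and> a \<in> N \<and> (n = 0 \<longrightarrow> a = \<one>)"
  by (simp add: M_def)

lemma mult_M: "(n, a) \<otimes>\<^bsub>M\<^esub> (m, b) = (n + m, a \<otimes> b)"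
  by (simp add: M_def)

lemma one_M: "\<one>\<^bsub>M\<^esub> = (0, \<one>)"
  by (simp add: M_def)

sublocale M: graded_monoid M fst d
proof (intro graded_monoid.intro comm_monoid_cancelI comm_monoidI graded_monoid_axioms.intro)
  fix x y z
  assume x: "x \<in> carrier M" and y: "y \<in> carrier M"
  obtain n a m b where xy: "x = (n, a)" "y = (m, b)" by fastforce
  note c = x[unfolded xy carrier_M] y[unfolded xy carrier_M]
  show "x \<otimes>\<^bsub>M\<^esub> y \<in> carrier M"
    unfolding xy mult_M carrier_M using c N
    by (simp add: keys_exponent_add exponent_add_eq_0 subgroup.m_closed)
  show "x \<otimes>\<^bsub>M\<^esub> y = y \<otimes>\<^bsub>M\<^esub> x" unfolding xy mult_M using c N_comm by (simp add: add.commute)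
  show "fst (x \<otimes>\<^bsub>M\<^esub> y) = fst x + fst y" unfolding xy mult_M by simp
  assume z: "z \<in> carrier M"
  obtain k e where z': "z = (k, e)" by fastforce
  note c = c z[unfolded z' carrier_M]
  show "x \<otimes>\<^bsub>M\<^esub> y \<otimes>\<^bsub>M\<^esub> z = x \<otimes>\<^bsub>M\<^esub> (y \<otimes>\<^bsub>M\<^esub> z)"
    unfolding xy z' mult_M using c N_closed by (simp add: m_assoc add.assoc)
next
  fix x y z assume "x \<in> carrier M" "y \<in> carrier M" "z \<in> carrier M" "x \<otimes>\<^bsub>M\<^esub> z = y \<otimes>\<^bsub>M\<^esub> z"
  then show "x = y" using N_closed by (cases x; cases y; cases z) (auto simp: carrier_M mult_M)
next
  show "\<one>\<^bsub>M\<^esub> \<in> carrier M" using subgroup.one_closed[OF N] by (simp add: one_M carrier_M)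
next
  fix x assume "x \<in> carrier M"
  then show "\<one>\<^bsub>M\<^esub> \<otimes>\<^bsub>M\<^esub> x = x" "fst x = 0 \<Longrightarrow> x = \<one>\<^bsub>M\<^esub>" "keys (fst x) \<subseteq> {1..d}"
    using N_closed by (cases x; auto simp: carrier_M mult_M one_M)+
qed

text \<open>The Schreier graph of the cosets of \<open>N\<close>. The label of the edge from \<open>q\<close> along \<open>s\<close> carries the Schreier
  element \<open>offset (q \<otimes> s)\<close>, which satisfies \<open>q \<otimes> s = offset (q \<otimes> s) \<otimes> rep (q \<otimes> s)\<close>.\<close>
definition edges :: "('a \<times> ((nat \<Rightarrow>\<^sub>0 nat) \<times> 'a) \<times> 'a) set" where
  "edges = (\<lambda>(q, m, s). (q, (m, offset (q \<otimes> s)), rep (q \<otimes> s))) ` (reps \<times> T)"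

lemma edges_closed: "edges \<subseteq> UNIV \<times> carrier M \<times> UNIV"
  using T reps_closed by (auto simp: edges_def carrier_M offset_in)

lemma finite_edges: "finite edges"
  using finite_T finite_rep by (simp add: edges_def reps_def)

lemma represents_path:
  "represents n x \<Longrightarrow> (n, x) = (0, \<one>) \<or> path M edges reps \<one> (n, offset x) (rep x)"
proof (induction rule: represents.induct)
  case (represents_step n x m s)
  have x: "x \<in> carrier G" and s: "s \<in> carrier G"
    using represents_closed[OF represents_step(1)] T[OF represents_step(2)] by auto
  have eq: "x \<otimes> s = offset x \<otimes> (rep x \<otimes> s)"
    using x s by (simp add: offset_rep N_closed offset_in rep_closed flip: m_assoc)
  have rep: "rep (x \<otimes> s) = rep (rep x \<otimes> s)"
    unfolding eq using x s by (intro rep_mult offset_in m_closed rep_closed)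
  have off: "offset (x \<otimes> s) = offset x \<otimes> offset (rep x \<otimes> s)"
    unfolding offset_def[of "x \<otimes> s"] offset_def[of "rep x \<otimes> s"] rep
    unfolding eq using x s by (simp add: m_assoc N_closed offset_in rep_closed)
  have "(rep x, (m, offset (rep x \<otimes> s)), rep (rep x \<otimes> s)) \<in> edges"
    unfolding edges_def reps_def using x represents_step(2) by force
  then have e: "path M edges reps (rep x) (m, offset (rep x \<otimes> s)) (rep (x \<otimes> s))"
    unfolding rep by (rule path_edge)
  from represents_step.IH show ?case
  proof
    assume "(n, x) = (0, \<one>)"
    moreover have "offset \<one> = \<one>" by (simp add: offset_def rep_one)
    ultimately show ?thesis using e s by (simp add: rep_one)
  next
    assume "path M edges reps \<one> (n, offset x) (rep x)"
    from path_concat[OF this _ e] x show ?thesis by (simp add: reps_def mult_M off)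
  qed
qed simp

text \<open>Stated for a start at an arbitrary represented element \<open>y \<otimes> p\<close> instead of \<open>\<one>\<close>, so that the induction
  can pass to the second part of a concatenated walk.\<close>
lemma path_represents:
  assumes "path M edges reps p a q" "represents k (y \<otimes> p)" "y \<in> carrier G"
  shows "represents (k + fst a) (y \<otimes> snd a \<otimes> q)"
  using assms
proof (induction arbitrary: k y)
  case (path_edge p a q)
  then obtain m s where e: "p \<in> reps" "(m, s) \<in> T" "a = (m, offset (p \<otimes> s))" "q = rep (p \<otimes> s)"
    by (auto simp: edges_def)
  have c: "p \<in> carrier G" "s \<in> carrier G" using e reps_closed T by auto
  have "y \<otimes> offset (p \<otimes> s) \<otimes> rep (p \<otimes> s) = y \<otimes> p \<otimes> s"
    using c path_edge.prems(2) by (simp add: m_assoc N_closed offset_in rep_closed offset_rep)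
  then show ?case using represents_step[OF path_edge.prems(1) e(2)] e by simp
next
  case (path_concat p a r b q)
  have a: "a \<in> carrier M" and b: "b \<in> carrier M"
    using M.path_closed[OF _ edges_closed] path_concat.hyps by auto
  then have c: "snd a \<in> carrier G" "snd b \<in> carrier G"
    using N_closed by (cases a; cases b; simp add: carrier_M)+
  have "represents (k + fst a + fst b) (y \<otimes> snd a \<otimes> snd b \<otimes> q)"
    using path_concat c by (intro path_concat.IH(2)[OF path_concat.IH(1)]) auto
  then show ?case
    using c path_concat.prems by (cases a; cases b) (simp add: mult_M m_assoc add.assoc)
qed

lemma semilinear_represents:
  assumes q: "q \<in> reps"
  shows "M.semilinear {(n, a). a \<in> N \<and> represents n (a \<otimes> q)}"
proof -
  let ?O = "if q = \<one> then {\<one>\<^bsub>M\<^esub>} else {}"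
  have "{(n, a). a \<in> N \<and> represents n (a \<otimes> q)} = ?O \<union> {a. path M edges reps \<one> a q}"
  proof (intro equalityI subsetI)
    fix x assume "x \<in> {(n, a). a \<in> N \<and> represents n (a \<otimes> q)}"
    then obtain n a where a: "x = (n, a)" "a \<in> N" "represents n (a \<otimes> q)" by auto
    from represents_path[OF a(3)] show "x \<in> ?O \<union> {a. path M edges reps \<one> a q}"
    proof
      assume *: "(n, a \<otimes> q) = (0, \<one>)"
      then have "q = \<one>" using rep_N_reps[OF a(2) q] by (simp add: rep_one)
      then show ?thesis using * a N_closed by (simp add: one_M)
    next
      assume "path M edges reps \<one> (n, offset (a \<otimes> q)) (rep (a \<otimes> q))"
      then show ?thesis using a q by (simp add: rep_N_reps offset_N_reps)
    qed
  next
    fix x assume "x \<in> ?O \<union> {a. path M edges reps \<one> a q}"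
    then show "x \<in> {(n, a). a \<in> N \<and> represents n (a \<otimes> q)}"
    proof
      assume "x \<in> ?O"
      then show ?thesis
        using subgroup.one_closed[OF N] represents_one by (auto simp: one_M split: if_splits)
    next
      assume "x \<in> {a. path M edges reps \<one> a q}"
      then obtain n a where p: "x = (n, a)" "path M edges reps \<one> (n, a) q" by (cases x) simp
      have "a \<in> N" using M.path_closed[OF p(2) edges_closed] by (simp add: carrier_M)
      then show ?thesis
        using path_represents[OF p(2), of 0 \<one>] represents_one N_closed q reps_closed p(1)
        by simp
    qed
  qed
  moreover have "M.semilinear ?O"
    by (auto intro: M.semilinear_fg_set M.fg_set_finite M.semilinear_empty)
  moreover have "M.semilinear {a. path M edges reps \<one> a q}"
    using finite_rep by (intro M.semilinear_paths finite_edges edges_closed) (simp add: reps_def)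
  ultimately show ?thesis by (simp add: M.semilinear_Un)
qed

text \<open>Fix one \<open>a0 \<otimes> q \<in> U\<close>. The elements of \<open>U\<close> in the coset of \<open>q\<close> are then the \<open>k \<otimes> a0 \<otimes> q\<close> with \<open>k\<close> in a
  subgroup \<open>?K\<close> of \<open>N\<close>, and commutativity of \<open>N\<close> allows the comparison from any other starting point.\<close>
lemma semilinear_represents_Int:
  assumes q: "q \<in> reps" and U: "\<And>x. x \<in> U \<Longrightarrow> subgroup {a \<in> N. a \<otimes> x \<in> U} G"
  shows "M.semilinear {(n, a). a \<in> N \<and> represents n (a \<otimes> q) \<and> a \<otimes> q \<in> U}"
proof (cases "\<exists>a\<in>N. a \<otimes> q \<in> U")
  case False
  then have *: "{(n, a). a \<in> N \<and> represents n (a \<otimes> q) \<and> a \<otimes> q \<in> U} = {}" by auto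
  show ?thesis unfolding * by (rule M.semilinear_empty)
next
  case True
  then obtain a0 where a0: "a0 \<in> N" "a0 \<otimes> q \<in> U" by blast
  let ?x = "a0 \<otimes> q"
  let ?K = "{a \<in> N. a \<otimes> ?x \<in> U}"
  have K: "subgroup ?K G" by (rule U[OF a0(2)])
  have qc: "q \<in> carrier G" and a0c: "a0 \<in> carrier G" using q reps_closed a0 N_closed by auto
  have Ksat: "k \<otimes> l \<in> ?K \<longleftrightarrow> l \<in> ?K" if "k \<in> ?K" "l \<in> N" for k l
  proof
    assume kl: "k \<otimes> l \<in> ?K"
    have "inv k \<otimes> (k \<otimes> l) \<in> ?K" 
      by (rule subgroup.m_closed[OF K subgroup.m_inv_closed[OF K that(1)] kl])
    moreover have "inv k \<otimes> (k \<otimes> l) = l" using that N_closed by (simp flip: m_assoc)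
    ultimately show "l \<in> ?K" by simp
  qed (use that in \<open>intro subgroup.m_closed[OF K]\<close>)
  have Vsat: "a \<otimes> k \<otimes> q \<in> U \<longleftrightarrow> k \<in> ?K" if a: "a \<in> N" "a \<otimes> q \<in> U" and k: "k \<in> N" for a k
  proof -
    have ac: "a \<in> carrier G" and kc: "k \<in> carrier G" using a k N_closed by auto
    \<comment> \<open>The translation from \<open>a0 \<otimes> q\<close> to \<open>a \<otimes> q\<close>, itself in \<open>?K\<close>; it commutes with \<open>k\<close>.\<close>
    let ?c = "a \<otimes> inv a0"
    have cN: "?c \<in> N" using a a0 N by (simp add: subgroup.m_closed subgroup.m_inv_closed)
    have "?c \<otimes> ?x = a \<otimes> q" using ac a0c qc by (simp add: m_assoc inv_solve_left')
    then have c: "?c \<in> ?K" using a(2) cN by simp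
    have "?c \<otimes> k \<otimes> ?x = k \<otimes> ?c \<otimes> ?x" using N_comm[OF cN k] by simp
    also have "\<dots> = k \<otimes> a \<otimes> q" using ac a0c qc kc by (simp add: m_assoc inv_solve_left')
    also have "\<dots> = a \<otimes> k \<otimes> q" using N_comm[OF a(1) k] by simp
    finally have "a \<otimes> k \<otimes> q \<in> U \<longleftrightarrow> ?c \<otimes> k \<in> ?K"
      using cN k by (simp add: subgroup.m_closed[OF N])
    with Ksat[OF c k] show ?thesis by simp
  qed
  let ?V = "{(n, a). (n, a) \<in> carrier M \<and> a \<otimes> q \<in> U}"
  let ?R = "{(n, a). a \<in> N \<and> represents n (a \<otimes> q)}"
  have "M.semilinear (?R \<inter> ?V)"
  proof (rule M.semilinear_Int_saturated[where K = "{(n, k) \<in> carrier M. k \<in> ?K}"])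
    show "\<one>\<^bsub>M\<^esub> \<in> {(n, k) \<in> carrier M. k \<in> ?K}"
      using subgroup.one_closed[OF K] subgroup.one_closed[OF N] by (simp add: one_M carrier_M)
  next
    fix k l assume kl: "k \<in> {(n, k) \<in> carrier M. k \<in> ?K}" "l \<in> carrier M"
    then have "k \<otimes>\<^bsub>M\<^esub> l \<in> carrier M" by auto
    with kl show "k \<otimes>\<^bsub>M\<^esub> l \<in> {(n, k) \<in> carrier M. k \<in> ?K} \<longleftrightarrow> l \<in> {(n, k) \<in> carrier M. k \<in> ?K}"
      using Ksat[of "snd k" "snd l"] by (cases k; cases l) (simp add: mult_M carrier_M)
  next
    fix x k assume xk: "x \<in> ?V" "k \<in> carrier M"
    then have "x \<otimes>\<^bsub>M\<^esub> k \<in> carrier M" by auto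
    with xk show "x \<otimes>\<^bsub>M\<^esub> k \<in> ?V \<longleftrightarrow> k \<in> {(n, k) \<in> carrier M. k \<in> ?K}"
      using Vsat[of "snd x" "snd k"] by (cases x; cases k) (simp add: mult_M carrier_M)
  qed (use semilinear_represents[OF q] in auto)
  moreover have "?R \<inter> ?V = {(n, a). a \<in> N \<and> represents n (a \<otimes> q) \<and> a \<otimes> q \<in> U}"
    using M.semilinear_closed[OF semilinear_represents[OF q]] by auto
  ultimately show ?thesis by simp
qed

text \<open>The ideal of the non-unit monomials is generated by the variables.\<close>
lemma semilinear_nonzero_weights:
  "M.semilinear {(m :: nat \<Rightarrow>\<^sub>0 nat, \<one>) | m. m \<noteq> 0 \<and> keys m \<subseteq> {1..d}}"
proof -
  let ?F = "(\<lambda>k. (Poly_Mapping.single k 1, \<one>)) ` {1..d}"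
  have one: "\<one> \<in> N" using subgroup.one_closed[OF N] .
  have F: "finite ?F" "?F \<subseteq> carrier M" using one by (auto simp: carrier_M)
  have split: "\<exists>k m'. k \<in> {1..d} \<and> m = Poly_Mapping.single k 1 + m' \<and> keys m' \<subseteq> {1..d}"
    if "m \<noteq> 0" "keys m \<subseteq> {1..d}" for m :: "nat \<Rightarrow>\<^sub>0 nat"
  proof -
    obtain k where k: "k \<in> keys m" using \<open>m \<noteq> 0\<close> keys_eq_empty by (metis all_not_in_conv)
    then have "m = Poly_Mapping.single k 1 + (m - Poly_Mapping.single k 1)"
      by (auto simp: poly_mapping_eq_iff fun_eq_iff lookup_add lookup_minus lookup_single when_def in_keys_iff)
    moreover from this have "keys (m - Poly_Mapping.single k 1) \<subseteq> keys m"
      by (metis keys_exponent_add Un_upper2)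
    ultimately show ?thesis using k that(2) by blast
  qed
  have cone: "(m, \<one>) \<in> M.cone ?F" if "keys m \<subseteq> {1..d}" for m
    using that
  proof (induction "\<Sum>i = 1..d. lookup m i" arbitrary: m rule: less_induct)
    case less
    show ?case
    proof (cases "m = 0")
      case True
      then show ?thesis using M.cone_one[of ?F] by (simp add: one_M)
    next
      case False
      then obtain k m' where k: "k \<in> {1..d}" "m = Poly_Mapping.single k 1 + m'" "keys m' \<subseteq> {1..d}"
        using split less.prems by blast
      have "(\<Sum>i = 1..d. lookup m i) = (\<Sum>i = 1..d. lookup (Poly_Mapping.single k (1::nat)) i) + (\<Sum>i = 1..d. lookup m' i)"
        by (simp add: k(2) lookup_add sum.distrib)
      also have "(\<Sum>i = 1..d. lookup (Poly_Mapping.single k (1::nat)) i) = 1"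
        using k(1) by (simp add: lookup_single when_def)
      finally have "(m', \<one>) \<in> M.cone ?F" using less.hyps[of m'] k by simp
      then have "(Poly_Mapping.single k 1, \<one>) \<otimes>\<^bsub>M\<^esub> (m', \<one>) \<in> M.cone ?F"
        using k by (intro M.cone_step) auto
      then show ?thesis by (simp add: mult_M k)
    qed
  qed
  have sub: "\<exists>m. x = (m, \<one>) \<and> keys m \<subseteq> {1..d}" if "x \<in> M.cone ?F" for x
    using that by induction (auto simp: one_M mult_M keys_exponent_add)
  have "{(m :: nat \<Rightarrow>\<^sub>0 nat, \<one>) | m. m \<noteq> 0 \<and> keys m \<subseteq> {1..d}} = ?F <#>\<^bsub>M\<^esub> M.cone ?F"
  proof (intro equalityI subsetI)
    fix x assume "x \<in> {(m :: nat \<Rightarrow>\<^sub>0 nat, \<one>) | m. m \<noteq> 0 \<and> keys m \<subseteq> {1..d}}"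
    then obtain k m' where k: "k \<in> {1..d}" "x = (Poly_Mapping.single k 1 + m', \<one>)" "keys m' \<subseteq> {1..d}"
      using split by blast
    then have "x = (Poly_Mapping.single k 1, \<one>) \<otimes>\<^bsub>M\<^esub> (m', \<one>)" by (simp add: mult_M)
    then show "x \<in> ?F <#>\<^bsub>M\<^esub> M.cone ?F" using k cone by (auto intro: M.set_multI)
  next
    fix x assume "x \<in> ?F <#>\<^bsub>M\<^esub> M.cone ?F"
    then obtain k y where k: "k \<in> {1..d}" "y \<in> M.cone ?F" "x = (Poly_Mapping.single k 1, \<one>) \<otimes>\<^bsub>M\<^esub> y"
      by (auto elim: M.set_multE)
    from sub[OF k(2)] obtain m where "y = (m, \<one>)" "keys m \<subseteq> {1..d}" by blast
    moreover have "Poly_Mapping.single k (1 :: nat) \<noteq> 0"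
      by (metis keys_single keys_zero insert_not_empty one_neq_zero)
    ultimately show "x \<in> {(m :: nat \<Rightarrow>\<^sub>0 nat, \<one>) | m. m \<noteq> 0 \<and> keys m \<subseteq> {1..d}}"
      using k by (auto simp: mult_M keys_exponent_add exponent_add_eq_0)
  qed
  then show ?thesis using F by (intro M.semilinear_fg_set M.fg_setI[of ?F ?F])
qed

text \<open>An element of \<open>U\<close> is counted at \<open>e\<close> if \<open>e\<close> is minimal among the exponent vectors that represent it.
  In the coset of \<open>q\<close> these are the elements of \<open>?X q\<close> outside the product of \<open>?X q\<close> with the nonzero weights,
  and the cosets are finite in number.\<close>
theorem rational_minimal_weights:
  assumes U: "\<And>x. x \<in> U \<Longrightarrow> subgroup {a \<in> N. a \<otimes> x \<in> U} G"
  shows "rational_series d (\<lambda>e. int (card {x \<in> U. represents e x \<and>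
    (\<forall>n m. represents n x \<longrightarrow> e = n + m \<longrightarrow> m = 0)}))"
proof -
  let ?X = "\<lambda>q. {(n, a). a \<in> N \<and> represents n (a \<otimes> q) \<and> a \<otimes> q \<in> U}"
  let ?C = "{(m :: nat \<Rightarrow>\<^sub>0 nat, \<one>) | m. m \<noteq> 0 \<and> keys m \<subseteq> {1..d}}"
  let ?Y = "\<lambda>q. ?X q - (?X q <#>\<^bsub>M\<^esub> ?C)"
  let ?A = "\<lambda>e. {x \<in> U. represents e x \<and> (\<forall>n m. represents n x \<longrightarrow> e = n + m \<longrightarrow> m = 0)}"
  have rat: "rational_series d (M.weight_series (?Y q))" if "q \<in> reps" for q
    by (intro M.rational_weight_series_semilinear_diff M.semilinear_mult semilinear_represents_Int
        semilinear_nonzero_weights U that)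
  have Y: "(e, a) \<in> ?Y q \<longleftrightarrow> a \<in> N \<and> a \<otimes> q \<in> ?A e" if "q \<in> reps" for e a q
  proof -
    have "(e, a) \<in> ?X q <#>\<^bsub>M\<^esub> ?C \<longleftrightarrow> a \<in> N \<and> a \<otimes> q \<in> U \<and> (\<exists>n m. represents n (a \<otimes> q) \<and> e = n + m \<and> m \<noteq> 0)"
      if "represents e (a \<otimes> q)"
    proof
      assume "(e, a) \<in> ?X q <#>\<^bsub>M\<^esub> ?C"
      then obtain n b m where "b \<in> N" "represents n (b \<otimes> q)" "b \<otimes> q \<in> U" "m \<noteq> 0"
        "(e, a) = (n, b) \<otimes>\<^bsub>M\<^esub> (m, \<one>)"
        by (auto elim!: M.set_multE)
      then show "a \<in> N \<and> a \<otimes> q \<in> U \<and> (\<exists>n m. represents n (a \<otimes> q) \<and> e = n + m \<and> m \<noteq> 0)"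
        using N_closed by (auto simp: mult_M)
    next
      assume "a \<in> N \<and> a \<otimes> q \<in> U \<and> (\<exists>n m. represents n (a \<otimes> q) \<and> e = n + m \<and> m \<noteq> 0)"
      then obtain n m where a: "a \<in> N" "a \<otimes> q \<in> U" "represents n (a \<otimes> q)" "e = n + m" "m \<noteq> 0" by blast
      have "keys m \<subseteq> {1..d}" using represents_closed[OF that] a(4) by (simp add: keys_exponent_add)
      then have "(n, a) \<otimes>\<^bsub>M\<^esub> (m, \<one>) \<in> ?X q <#>\<^bsub>M\<^esub> ?C" using a by (intro M.set_multI) auto
      then show "(e, a) \<in> ?X q <#>\<^bsub>M\<^esub> ?C" using a N_closed by (simp add: mult_M)
    qed
    then show ?thesis by auto
  qed
  have fin: "finite {x \<in> ?Y q. fst x = e}" if "q \<in> reps" for q e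
    by (rule finite_subset[OF _ M.finite_semilinear_weight[OF semilinear_represents_Int[OF that U], of e]]) auto
  have img: "{x \<in> ?A e. rep x = q} = (\<lambda>y. snd y \<otimes> q) ` {x \<in> ?Y q. fst x = e}" if q: "q \<in> reps" for q e
  proof (intro equalityI subsetI)
    fix x assume x: "x \<in> {x \<in> ?A e. rep x = q}"
    then have xc: "x \<in> carrier G" using represents_closed by blast
    then have "offset x \<otimes> q = x" using offset_rep[OF xc] x by simp
    with x have "(e, offset x) \<in> ?Y q" using Y[OF q, of e "offset x"] offset_in[OF xc] by simp
    then show "x \<in> (\<lambda>y. snd y \<otimes> q) ` {x \<in> ?Y q. fst x = e}"
      using \<open>offset x \<otimes> q = x\<close> by (intro image_eqI[of _ _ "(e, offset x)"]) simp_all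
  next
    fix x assume "x \<in> (\<lambda>y. snd y \<otimes> q) ` {x \<in> ?Y q. fst x = e}"
    then obtain a where "(e, a) \<in> ?Y q" "x = a \<otimes> q" by auto
    with Y[OF q, of e a] show "x \<in> {x \<in> ?A e. rep x = q}" using rep_N_reps[OF _ q] by simp
  qed
  have "inj_on (\<lambda>y. snd y \<otimes> q) {x \<in> ?Y q. fst x = e}" if q: "q \<in> reps" for q e
    using N_closed reps_closed[OF q] by (auto intro!: inj_onI)
  then have card: "card {x \<in> ?A e. rep x = q} = card {x \<in> ?Y q. fst x = e}" if "q \<in> reps" for q e
    unfolding img[OF that] using that by (intro card_image) blast
  have finA: "finite {x \<in> ?A e. rep x = q}" if "q \<in> reps" for q e
    unfolding img[OF that] by (intro finite_imageI fin that)
  have reps: "finite reps" using finite_rep by (simp add: reps_def)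
  have "int (card (?A e)) = (\<Sum>q\<in>reps. M.weight_series (?Y q) e)" for e
  proof -
    have "?A e = (\<Union>q\<in>reps. {x \<in> ?A e. rep x = q})"
      using represents_closed by (auto simp: reps_def)
    moreover have "card (\<Union>q\<in>reps. {x \<in> ?A e. rep x = q}) = (\<Sum>q\<in>reps. card {x \<in> ?A e. rep x = q})"
      by (rule card_UN_disjoint[OF reps]) (use finA in blast)+
    moreover have "(\<Sum>q\<in>reps. card {x \<in> ?A e. rep x = q}) = (\<Sum>q\<in>reps. card {x \<in> ?Y q. fst x = e})"
      by (intro sum.cong refl card)
    ultimately have "card (?A e) = (\<Sum>q\<in>reps. card {x \<in> ?Y q. fst x = e})" by (simp only:)
    then show ?thesis by (simp only: M.weight_series_def of_nat_sum)
  qed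
  then have "(\<lambda>e. int (card (?A e))) = (\<lambda>e. \<Sum>q\<in>reps. M.weight_series (?Y q) e)" by (rule ext)
  moreover have "rational_series d (\<lambda>e. \<Sum>q\<in>reps. M.weight_series (?Y q) e)"
    by (rule rational_series_sum) (rule rat)
  ultimately show ?thesis by (simp only:)
qed

end

section \<open>Systems of equations within one coset\<close>

lemma free_group_letter_inverse:
  assumes "i \<in> I"
  shows "word_class (I \<times> UNIV) (free_group_rels I) [(i, False)] = inv\<^bsub>free_group I\<^esub> free_group_gen I i"
proof -
  interpret F: Group.group "free_group I" by (rule group_free_group)
  let ?c = "word_class (I \<times> UNIV) (free_group_rels I)"
  have "([(i, False), (i, \<not> False)], []) \<in> free_group_rels I"
    using assms unfolding free_group_rels_def by blast
  from word_cong_step[OF this, of "I \<times> UNIV" "[]" "[]"]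
  have "?c [(i, False), (i, True)] = ?c []" using assms by (subst word_class_eq_iff) auto
  then have "?c [(i, False)] \<otimes>\<^bsub>free_group I\<^esub> free_group_gen I i = \<one>\<^bsub>free_group I\<^esub>"
    using assms by (simp add: free_group_def free_group_gen_def presented_mult presented_one)
  then show ?thesis
    using assms by (intro F.inv_equality[symmetric] free_group_gen_closed)
      (auto simp: free_group_def intro!: word_class_in_carrier)
qed

lemma presented_induct [consumes 1, case_names Nil Cons]:
  assumes "X \<in> carrier (presented A R)"
    and "P \<one>\<^bsub>presented A R\<^esub>"
    and "\<And>a X. a \<in> A \<Longrightarrow> X \<in> carrier (presented A R) \<Longrightarrow> P X \<Longrightarrow>
      P (word_class A R [a] \<otimes>\<^bsub>presented A R\<^esub> X)"
  shows "P X"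
proof -
  obtain u where u: "u \<in> lists A" "X = word_class A R u" using assms(1) by (rule presented_carrierE)
  have "P (word_class A R u)" using u(1)
  proof induction
    case Nil
    then show ?case using assms(2) by (simp add: presented_one)
  next
    case (Cons a u)
    then have "word_class A R (a # u) = word_class A R [a] \<otimes>\<^bsub>presented A R\<^esub> word_class A R u"
      by (subst presented_mult) auto
    then show ?case using Cons assms(3) by (simp add: word_class_in_carrier)
  qed
  then show ?thesis by (simp add: u)
qed

lemma equation_group_induct [consumes 2, case_names const var mult inv]:
  assumes G: "Group.group G" and w: "w \<in> carrier (equation_group G d)"
    and const: "\<And>a. a \<in> carrier G \<Longrightarrow> P (equation_const G d a)"
    and var: "\<And>i. i \<in> {1..d} \<Longrightarrow> P (equation_var G d i)"
    and mult: "\<And>u v. u \<in> carrier (equation_group G d) \<Longrightarrow> v \<in> carrier (equation_group G d) \<Longrightarrow>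
      P u \<Longrightarrow> P v \<Longrightarrow> P (u \<otimes>\<^bsub>equation_group G d\<^esub> v)"
    and inv: "\<And>u. u \<in> carrier (equation_group G d) \<Longrightarrow> P u \<Longrightarrow> P (inv\<^bsub>equation_group G d\<^esub> u)"
  shows "P w"
proof -
  let ?F = "free_group {1..d}" and ?E = "equation_group G d"
  note F = group_free_group[of "{1..d}"]
  have E: "Group.group ?E" unfolding equation_group_def by (rule group_free_product[OF G F])
  interpret G: Group.group G by (rule G)
  interpret F: Group.group ?F by (rule F)
  interpret E: Group.group ?E by (rule E)
  let ?l = "free_product_inl G ?F" and ?r = "free_product_inr G ?F"
  have l: "group_hom G ?E ?l" unfolding equation_group_def
    by (intro group_hom.intro group_hom_axioms.intro G group_free_product F free_product_inl_hom)
  have r: "group_hom ?F ?E ?r" unfolding equation_group_def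
    by (intro group_hom.intro group_hom_axioms.intro G group_free_product F free_product_inr_hom)
  have one: "P \<one>\<^bsub>?E\<^esub>"
    using const[OF G.one_closed] group_hom.hom_one[OF l] by (simp add: equation_const_def)
  have right: "P (?r y)" if "y \<in> carrier ?F" for y
    using that
  proof (induction rule: presented_induct[of _ "{1..d} \<times> UNIV" "free_group_rels {1..d}",
        folded free_group_def, consumes 1, case_names Nil Cons])
    case Nil
    show ?case using one group_hom.hom_one[OF r] by simp
  next
    case (Cons a y)
    obtain i b where a: "a = (i, b)" "i \<in> {1..d}" using Cons(1) by auto
    let ?y = "word_class ({1..d} \<times> UNIV) (free_group_rels {1..d}) [a]"
    have gen: "free_group_gen {1..d} i \<in> carrier ?F" by (rule free_group_gen_closed[OF a(2)])
    have y: "?y = (if b then free_group_gen {1..d} i else inv\<^bsub>?F\<^esub> free_group_gen {1..d} i)"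
      using a free_group_letter_inverse[OF a(2)] by (simp add: free_group_gen_def)
    have yc: "?y \<in> carrier ?F" unfolding y using gen F.inv_closed[OF gen] by (cases b) simp_all
    have v: "?r (free_group_gen {1..d} i) \<in> carrier ?E" using group_hom.hom_closed[OF r gen] .
    have "P (?r ?y)"
      unfolding y using var[OF a(2)] inv[OF v] group_hom.hom_inv[OF r gen]
      by (simp add: equation_var_def)
    moreover have "?r (?y \<otimes>\<^bsub>?F\<^esub> y) = ?r ?y \<otimes>\<^bsub>?E\<^esub> ?r y"
      using yc Cons(2) by (rule group_hom.hom_mult[OF r])
    moreover have "?r ?y \<in> carrier ?E" "?r y \<in> carrier ?E"
      by (rule group_hom.hom_closed[OF r yc] group_hom.hom_closed[OF r Cons(2)])+
    ultimately show ?case using mult Cons.IH by simp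
  qed
  have Pl: "P (word_class (carrier G <+> carrier ?F) (free_product_rels G ?F) [a])"
    if "a \<in> carrier G <+> carrier ?F" for a
    using that const right by (auto simp: equation_const_def free_product_inl_def free_product_inr_def)
  show ?thesis
    using w
  proof (induction rule: presented_induct[of _ "carrier G <+> carrier ?F" "free_product_rels G ?F",
        folded free_product_def equation_group_def, consumes 1, case_names Nil Cons])
    case Nil
    show ?case by (rule one)
  next
    case (Cons a X)
    have "word_class (carrier G <+> carrier ?F) (free_product_rels G ?F) [a] \<in> carrier ?E"
      unfolding equation_group_def free_product_def using Cons(1) by (intro word_class_in_carrier) simp
    then show ?case using Cons by (intro mult Pl)
  qed
qed

lemma substitution_hom:
  assumes G: "Group.group G" and g: "g \<in> {1..d} \<rightarrow> carrier G"
  shows "group_hom (equation_group G d) G (substitution G d g)"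
    and "a \<in> carrier G \<Longrightarrow> substitution G d g (equation_const G d a) = a"
    and "i \<in> {1..d} \<Longrightarrow> substitution G d g (equation_var G d i) = g i"
proof -
  have s: "is_substitution G d g (substitution G d g)"
    unfolding substitution_def by (rule theI'[OF ex1_substitution[OF G g]])
  then show "group_hom (equation_group G d) G (substitution G d g)"
    unfolding is_substitution_def equation_group_def
    by (intro group_hom.intro group_hom_axioms.intro G group_free_product group_free_group) blast
  show "a \<in> carrier G \<Longrightarrow> substitution G d g (equation_const G d a) = a"
    "i \<in> {1..d} \<Longrightarrow> substitution G d g (equation_var G d i) = g i"
    using s unfolding is_substitution_def by blast+
qed

abbreviation power_group :: "('a, 'b) monoid_scheme \<Rightarrow> nat \<Rightarrow> (nat \<Rightarrow> 'a) monoid" where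
  "power_group G d \<equiv> product_group {1..d} (\<lambda>_. G)"

lemma power_subgroup:
  assumes G: "Group.group G" and N: "subgroup N G"
  shows "subgroup ({1..d} \<rightarrow>\<^sub>E N) (power_group G d)"
proof -
  interpret G: Group.group G by (rule G)
  show ?thesis
  proof (rule group.subgroupI)
    show "{1..d} \<rightarrow>\<^sub>E N \<noteq> {}" using subgroup.one_closed[OF N] by (auto simp: PiE_eq_empty_iff)
    fix a assume a: "a \<in> {1..d} \<rightarrow>\<^sub>E N"
    then have "a \<in> (\<Pi>\<^sub>E i\<in>{1..d}. carrier G)" using subgroup.mem_carrier[OF N] by auto
    then show "inv\<^bsub>power_group G d\<^esub> a \<in> {1..d} \<rightarrow>\<^sub>E N"
      using a subgroup.m_inv_closed[OF N] by (subst inv_product_group) (auto simp: G)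
    fix b assume "b \<in> {1..d} \<rightarrow>\<^sub>E N"
    with a show "a \<otimes>\<^bsub>power_group G d\<^esub> b \<in> {1..d} \<rightarrow>\<^sub>E N"
      using subgroup.m_closed[OF N] by (auto simp: PiE_iff)
  qed (use G subgroup.mem_carrier[OF N] in \<open>auto simp: PiE_iff\<close>)
qed

text \<open>The word \<open>w(a x)\<close> differs from \<open>w(x)\<close> by a homomorphism \<open>\<delta>\<close> of \<open>a\<close>. For a variable, \<open>\<delta>\<close> is a coordinate;
  for a product \<open>u v\<close>, the contribution of \<open>v\<close> has to be moved past \<open>u(x)\<close>, which conjugates it within \<open>N\<close>,
  and the product of the two homomorphisms is a homomorphism because \<open>N\<close> is abelian.\<close>
lemma substitution_displacement:
  assumes NG: "N \<lhd> G" and comm: "\<And>a b. a \<in> N \<Longrightarrow> b \<in> N \<Longrightarrow> a \<otimes>\<^bsub>G\<^esub> b = b \<otimes>\<^bsub>G\<^esub> a"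
    and x: "x \<in> {1..d} \<rightarrow>\<^sub>E carrier G" and w: "w \<in> carrier (equation_group G d)"
  shows "\<exists>\<delta>. (\<forall>a \<in> {1..d} \<rightarrow>\<^sub>E N. \<delta> a \<in> N \<and>
        substitution G d (a \<otimes>\<^bsub>power_group G d\<^esub> x) w = \<delta> a \<otimes>\<^bsub>G\<^esub> substitution G d x w) \<and>
      (\<forall>a \<in> {1..d} \<rightarrow>\<^sub>E N. \<forall>b \<in> {1..d} \<rightarrow>\<^sub>E N. \<delta> (a \<otimes>\<^bsub>power_group G d\<^esub> b) = \<delta> a \<otimes>\<^bsub>G\<^esub> \<delta> b)"
    (is "\<exists>\<delta>. ?P w \<delta>")
proof -
  have G: "Group.group G" using NG by (simp add: normal_def)
  interpret G: Group.group G by (rule G)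
  interpret N: normal N G by (rule NG)
  let ?E = "power_group G d" and ?N = "{1..d} \<rightarrow>\<^sub>E N"
  let ?s = "\<lambda>a. substitution G d (a \<otimes>\<^bsub>?E\<^esub> x)" and ?t = "substitution G d x"
  have NE: "subgroup ?N ?E" by (rule power_subgroup[OF G N.is_subgroup])
  have x': "x \<in> {1..d} \<rightarrow> carrier G" using x by auto
  have ax: "a \<otimes>\<^bsub>?E\<^esub> x \<in> {1..d} \<rightarrow> carrier G" if "a \<in> ?N" for a
    using that x by (auto simp: PiE_iff)
  note s = substitution_hom[OF G ax] and t = substitution_hom[OF G x']
  have mN: "a \<otimes>\<^bsub>?E\<^esub> b \<in> ?N" if "a \<in> ?N" "b \<in> ?N" for a b using subgroup.m_closed[OF NE that] .
  have cancel: "inv\<^bsub>G\<^esub> y \<otimes>\<^bsub>G\<^esub> (y \<otimes>\<^bsub>G\<^esub> z) = z" "y \<otimes>\<^bsub>G\<^esub> (inv\<^bsub>G\<^esub> y \<otimes>\<^bsub>G\<^esub> z) = z"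
    if "y \<in> carrier G" "z \<in> carrier G" for y z
    using that by (simp_all flip: G.m_assoc)
  have exchange: "p \<otimes>\<^bsub>G\<^esub> q \<otimes>\<^bsub>G\<^esub> (r \<otimes>\<^bsub>G\<^esub> t) = p \<otimes>\<^bsub>G\<^esub> r \<otimes>\<^bsub>G\<^esub> (q \<otimes>\<^bsub>G\<^esub> t)"
    if "p \<in> carrier G" "q \<in> carrier G" "r \<in> carrier G" "t \<in> carrier G" "q \<otimes>\<^bsub>G\<^esub> r = r \<otimes>\<^bsub>G\<^esub> q" for p q r t
  proof -
    have "p \<otimes>\<^bsub>G\<^esub> q \<otimes>\<^bsub>G\<^esub> (r \<otimes>\<^bsub>G\<^esub> t) = p \<otimes>\<^bsub>G\<^esub> (q \<otimes>\<^bsub>G\<^esub> r) \<otimes>\<^bsub>G\<^esub> t" using that(1-4) by (simp add: G.m_assoc)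
    also have "\<dots> = p \<otimes>\<^bsub>G\<^esub> r \<otimes>\<^bsub>G\<^esub> (q \<otimes>\<^bsub>G\<^esub> t)" unfolding that(5) using that(1-4) by (simp add: G.m_assoc)
    finally show ?thesis .
  qed
  note mult_product_group [simp del] One_nat_def [simp del]
  show ?thesis using G w
  proof (induction rule: equation_group_induct)
    case (const g)
    show ?case
      by (intro exI[of _ "\<lambda>_. \<one>\<^bsub>G\<^esub>"]) (use const in \<open>simp add: s t\<close>)
  next
    case (var i)
    have "(a \<otimes>\<^bsub>?E\<^esub> y) i = a i \<otimes>\<^bsub>G\<^esub> y i" for a y using var by (simp add: mult_product_group)
    then show ?case
      by (intro exI[of _ "\<lambda>a. a i"]) (use var in \<open>auto simp: s t\<close>)
  next
    case (mult u v)
    then obtain \<delta> \<epsilon> where d: "?P u \<delta>" and e: "?P v \<epsilon>" by blast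
    let ?c = "?t u"
    have c: "?c \<in> carrier G" "?t v \<in> carrier G" using group_hom.hom_closed[OF t(1)] mult by auto
    let ?\<zeta> = "\<lambda>a. ?c \<otimes>\<^bsub>G\<^esub> \<epsilon> a \<otimes>\<^bsub>G\<^esub> inv\<^bsub>G\<^esub> ?c"
    have zN: "?\<zeta> a \<in> N" if "a \<in> ?N" for a using N.inv_op_closed2[OF c(1)] e that by blast
    show ?case
    proof (rule exI[of _ "\<lambda>a. \<delta> a \<otimes>\<^bsub>G\<^esub> ?\<zeta> a"], intro conjI ballI)
      fix a assume a: "a \<in> ?N"
      show "\<delta> a \<otimes>\<^bsub>G\<^esub> ?\<zeta> a \<in> N" using a d zN by blast
      have "?s a (u \<otimes>\<^bsub>equation_group G d\<^esub> v) = (\<delta> a \<otimes>\<^bsub>G\<^esub> ?c) \<otimes>\<^bsub>G\<^esub> (\<epsilon> a \<otimes>\<^bsub>G\<^esub> ?t v)"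
        using group_hom.hom_mult[OF s(1)[OF a] mult(1,2)] a d e by simp
      also have "\<dots> = \<delta> a \<otimes>\<^bsub>G\<^esub> ?\<zeta> a \<otimes>\<^bsub>G\<^esub> (?c \<otimes>\<^bsub>G\<^esub> ?t v)"
        using c a d e by (simp add: G.m_assoc cancel)
      also have "?c \<otimes>\<^bsub>G\<^esub> ?t v = ?t (u \<otimes>\<^bsub>equation_group G d\<^esub> v)"
        using group_hom.hom_mult[OF t(1) mult(1,2)] by simp
      finally show "?s a (u \<otimes>\<^bsub>equation_group G d\<^esub> v) =
          \<delta> a \<otimes>\<^bsub>G\<^esub> ?\<zeta> a \<otimes>\<^bsub>G\<^esub> ?t (u \<otimes>\<^bsub>equation_group G d\<^esub> v)" .
      fix b assume b: "b \<in> ?N"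
      have N: "\<delta> a \<in> N" "\<delta> b \<in> N" "\<epsilon> a \<in> N" "\<epsilon> b \<in> N" using a b d e by auto
      then have Nc: "\<delta> a \<in> carrier G" "\<delta> b \<in> carrier G" "\<epsilon> a \<in> carrier G" "\<epsilon> b \<in> carrier G" by auto
      have z: "?\<zeta> (a \<otimes>\<^bsub>?E\<^esub> b) = ?\<zeta> a \<otimes>\<^bsub>G\<^esub> ?\<zeta> b"
        using a b e c Nc by (simp add: G.m_assoc cancel)
      have zc: "?\<zeta> a \<in> carrier G" "?\<zeta> b \<in> carrier G" using zN a b by auto
      show "\<delta> (a \<otimes>\<^bsub>?E\<^esub> b) \<otimes>\<^bsub>G\<^esub> ?\<zeta> (a \<otimes>\<^bsub>?E\<^esub> b) = \<delta> a \<otimes>\<^bsub>G\<^esub> ?\<zeta> a \<otimes>\<^bsub>G\<^esub> (\<delta> b \<otimes>\<^bsub>G\<^esub> ?\<zeta> b)"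
      proof -
        have "\<delta> (a \<otimes>\<^bsub>?E\<^esub> b) = \<delta> a \<otimes>\<^bsub>G\<^esub> \<delta> b" using a b d by blast
        moreover have "\<delta> b \<otimes>\<^bsub>G\<^esub> ?\<zeta> a = ?\<zeta> a \<otimes>\<^bsub>G\<^esub> \<delta> b" by (rule comm[OF N(2) zN[OF a]])
        ultimately show ?thesis unfolding z by (simp only: exchange[OF Nc(1,2) zc])
      qed
    qed
  next
    case (inv u)
    then obtain \<delta> where d: "?P u \<delta>" by blast
    let ?c = "?t u"
    have c: "?c \<in> carrier G" using group_hom.hom_closed[OF t(1)] inv by auto
    let ?\<zeta> = "\<lambda>a. inv\<^bsub>G\<^esub> ?c \<otimes>\<^bsub>G\<^esub> inv\<^bsub>G\<^esub> \<delta> a \<otimes>\<^bsub>G\<^esub> ?c"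
    show ?case
    proof (rule exI[of _ ?\<zeta>], intro conjI ballI)
      fix a assume a: "a \<in> ?N"
      then have da: "\<delta> a \<in> N" using d by blast
      then show "?\<zeta> a \<in> N" by (intro N.inv_op_closed1[OF c] N.m_inv_closed)
      have "?s a (inv\<^bsub>equation_group G d\<^esub> u) = inv\<^bsub>G\<^esub> (\<delta> a \<otimes>\<^bsub>G\<^esub> ?c)"
        using group_hom.hom_inv[OF s(1)[OF a] inv(1)] a d by simp
      also have "\<dots> = ?\<zeta> a \<otimes>\<^bsub>G\<^esub> inv\<^bsub>G\<^esub> ?c" using da c by (simp add: G.inv_mult_group G.m_assoc)
      also have "\<dots> = ?\<zeta> a \<otimes>\<^bsub>G\<^esub> ?t (inv\<^bsub>equation_group G d\<^esub> u)"
        using group_hom.hom_inv[OF t(1) inv(1)] by simp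
      finally show "?s a (inv\<^bsub>equation_group G d\<^esub> u) = ?\<zeta> a \<otimes>\<^bsub>G\<^esub> ?t (inv\<^bsub>equation_group G d\<^esub> u)" .
      fix b assume b: "b \<in> ?N"
      then have db: "\<delta> b \<in> N" using d by blast
      have "inv\<^bsub>G\<^esub> \<delta> (a \<otimes>\<^bsub>?E\<^esub> b) = inv\<^bsub>G\<^esub> \<delta> a \<otimes>\<^bsub>G\<^esub> inv\<^bsub>G\<^esub> \<delta> b"
        using d a b da db comm[OF N.m_inv_closed[OF da] N.m_inv_closed[OF db]]
        by (simp add: G.inv_mult_group)
      then show "?\<zeta> (a \<otimes>\<^bsub>?E\<^esub> b) = ?\<zeta> a \<otimes>\<^bsub>G\<^esub> ?\<zeta> b"
        using da db c by (simp add: G.m_assoc cancel)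
    qed
  qed
qed

text \<open>Since \<open>w(x) = \<one>\<close> for the equations \<open>w\<close> of \<open>U\<close>, these translations form the common kernel of the
  homomorphisms \<open>\<delta>\<close> of \<open>substitution_displacement\<close>.\<close>
lemma algebraic_set_translations:
  assumes NG: "N \<lhd> G" and comm: "\<And>a b. a \<in> N \<Longrightarrow> b \<in> N \<Longrightarrow> a \<otimes>\<^bsub>G\<^esub> b = b \<otimes>\<^bsub>G\<^esub> a"
    and U: "algebraic_set G d U" and x: "x \<in> U"
  shows "subgroup {a \<in> {1..d} \<rightarrow>\<^sub>E N. a \<otimes>\<^bsub>power_group G d\<^esub> x \<in> U} (power_group G d)"
proof -
  have G: "Group.group G" using NG by (simp add: normal_def)
  interpret G: Group.group G by (rule G)
  interpret N: normal N G by (rule NG)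
  let ?E = "power_group G d" and ?N = "{1..d} \<rightarrow>\<^sub>E N"
  have EG: "Group.group ?E" using G by simp
  interpret E: Group.group ?E by (rule EG)
  have NE: "subgroup ?N ?E" by (rule power_subgroup[OF G N.is_subgroup])
  obtain W where W: "W \<subseteq> carrier (equation_group G d)" "U = solutions G d W"
    using U unfolding algebraic_set_def by blast
  have xc: "x \<in> {1..d} \<rightarrow>\<^sub>E carrier G" and x1: "\<And>w. w \<in> W \<Longrightarrow> substitution G d x w = \<one>\<^bsub>G\<^esub>"
    using x unfolding W(2) solutions_def by auto
  have "\<forall>w\<in>W. \<exists>\<delta>. (\<forall>a\<in>?N. \<delta> a \<in> N \<and> substitution G d (a \<otimes>\<^bsub>?E\<^esub> x) w = \<delta> a) \<and>
      (\<forall>a\<in>?N. \<forall>b\<in>?N. \<delta> (a \<otimes>\<^bsub>?E\<^esub> b) = \<delta> a \<otimes>\<^bsub>G\<^esub> \<delta> b)"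
  proof
    fix w assume w: "w \<in> W"
    from substitution_displacement[OF NG comm xc, of w] w W(1) obtain \<delta> where d:
      "\<forall>a\<in>?N. \<delta> a \<in> N \<and> substitution G d (a \<otimes>\<^bsub>?E\<^esub> x) w = \<delta> a \<otimes>\<^bsub>G\<^esub> substitution G d x w"
      "\<forall>a\<in>?N. \<forall>b\<in>?N. \<delta> (a \<otimes>\<^bsub>?E\<^esub> b) = \<delta> a \<otimes>\<^bsub>G\<^esub> \<delta> b" by blast
    have "\<forall>a\<in>?N. \<delta> a \<in> N \<and> substitution G d (a \<otimes>\<^bsub>?E\<^esub> x) w = \<delta> a"
      using d(1) x1[OF w] N.mem_carrier G.r_one by metis
    with d(2) show "\<exists>\<delta>. (\<forall>a\<in>?N. \<delta> a \<in> N \<and> substitution G d (a \<otimes>\<^bsub>?E\<^esub> x) w = \<delta> a) \<and>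
      (\<forall>a\<in>?N. \<forall>b\<in>?N. \<delta> (a \<otimes>\<^bsub>?E\<^esub> b) = \<delta> a \<otimes>\<^bsub>G\<^esub> \<delta> b)" by blast
  qed
  from bchoice[OF this] obtain \<delta> where
    "\<forall>w\<in>W. (\<forall>a\<in>?N. \<delta> w a \<in> N \<and> substitution G d (a \<otimes>\<^bsub>?E\<^esub> x) w = \<delta> w a) \<and>
      (\<forall>a\<in>?N. \<forall>b\<in>?N. \<delta> w (a \<otimes>\<^bsub>?E\<^esub> b) = \<delta> w a \<otimes>\<^bsub>G\<^esub> \<delta> w b)" ..
  then have dN: "\<And>w a. w \<in> W \<Longrightarrow> a \<in> ?N \<Longrightarrow> \<delta> w a \<in> N"
    and ds: "\<And>w a. w \<in> W \<Longrightarrow> a \<in> ?N \<Longrightarrow> substitution G d (a \<otimes>\<^bsub>?E\<^esub> x) w = \<delta> w a"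
    and dm: "\<And>w a b. w \<in> W \<Longrightarrow> a \<in> ?N \<Longrightarrow> b \<in> ?N \<Longrightarrow> \<delta> w (a \<otimes>\<^bsub>?E\<^esub> b) = \<delta> w a \<otimes>\<^bsub>G\<^esub> \<delta> w b"
    by blast+
  have ax: "a \<otimes>\<^bsub>?E\<^esub> x \<in> {1..d} \<rightarrow>\<^sub>E carrier G" if "a \<in> ?N" for a
    using that xc by (auto simp: PiE_iff)
  have mem: "a \<in> {a \<in> ?N. a \<otimes>\<^bsub>?E\<^esub> x \<in> U} \<longleftrightarrow> a \<in> ?N \<and> (\<forall>w\<in>W. \<delta> w a = \<one>\<^bsub>G\<^esub>)" for a
    unfolding W(2) solutions_def using ax ds by auto
  have one: "\<one>\<^bsub>?E\<^esub> \<in> ?N" by (rule subgroup.one_closed[OF NE])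
  have d1: "\<delta> w \<one>\<^bsub>?E\<^esub> = \<one>\<^bsub>G\<^esub>" if "w \<in> W" for w
  proof -
    have "\<delta> w \<one>\<^bsub>?E\<^esub> \<otimes>\<^bsub>G\<^esub> \<delta> w \<one>\<^bsub>?E\<^esub> = \<delta> w \<one>\<^bsub>?E\<^esub>"
      using dm[OF that one one] by (metis E.l_one E.one_closed)
    then show ?thesis using dN[OF that one] by (metis G.l_cancel_one N.mem_carrier)
  qed
  show ?thesis
  proof (rule E.subgroupI)
    show "{a \<in> ?N. a \<otimes>\<^bsub>?E\<^esub> x \<in> U} \<subseteq> carrier ?E" using subgroup.subset[OF NE] by blast
    show "{a \<in> ?N. a \<otimes>\<^bsub>?E\<^esub> x \<in> U} \<noteq> {}" using mem one d1 by blast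
  next
    fix a assume a: "a \<in> {a \<in> ?N. a \<otimes>\<^bsub>?E\<^esub> x \<in> U}"
    then have aN: "a \<in> ?N" by simp
    then have iN: "inv\<^bsub>?E\<^esub> a \<in> ?N" by (rule subgroup.m_inv_closed[OF NE])
    have "\<delta> w (inv\<^bsub>?E\<^esub> a) = \<one>\<^bsub>G\<^esub>" if w: "w \<in> W" for w
    proof -
      have "\<delta> w a \<otimes>\<^bsub>G\<^esub> \<delta> w (inv\<^bsub>?E\<^esub> a) = \<one>\<^bsub>G\<^esub>"
        unfolding dm[OF w aN iN, symmetric] E.r_inv[OF subgroup.mem_carrier[OF NE aN]] by (rule d1[OF w])
      moreover have "\<delta> w a = \<one>\<^bsub>G\<^esub>" using a mem w by blast
      ultimately show ?thesis using G.l_one[OF N.mem_carrier[OF dN[OF w iN]]] by simp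
    qed
    then show "inv\<^bsub>?E\<^esub> a \<in> {a \<in> ?N. a \<otimes>\<^bsub>?E\<^esub> x \<in> U}" using mem iN by blast
  next
    fix a b assume a: "a \<in> {a \<in> ?N. a \<otimes>\<^bsub>?E\<^esub> x \<in> U}" and b: "b \<in> {a \<in> ?N. a \<otimes>\<^bsub>?E\<^esub> x \<in> U}"
    then have N: "a \<in> ?N" "b \<in> ?N" by auto
    have "\<delta> w (a \<otimes>\<^bsub>?E\<^esub> b) = \<one>\<^bsub>G\<^esub>" if "w \<in> W" for w
    proof -
      have "\<delta> w a = \<one>\<^bsub>G\<^esub>" "\<delta> w b = \<one>\<^bsub>G\<^esub>" using a b mem that by blast+
      then show ?thesis unfolding dm[OF that N] by simp
    qed
    then show "a \<otimes>\<^bsub>?E\<^esub> b \<in> {a \<in> ?N. a \<otimes>\<^bsub>?E\<^esub> x \<in> U}"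
      using mem subgroup.m_closed[OF NE N] by blast
  qed
qed

section \<open>Cosets and coordinates\<close>

text \<open>The intersection of the conjugates of \<open>H\<close> is the kernel of the action of \<open>G\<close> on the finitely many cosets
  of \<open>H\<close>, so its cosets are distinguished by the permutations \<open>act x\<close>.\<close>
lemma finite_index_normal_core:
  assumes G: "Group.group G" and H: "subgroup H G" and fin: "finite (rcosets\<^bsub>G\<^esub> H)"
  obtains N where "N \<lhd> G" "N \<subseteq> H" "finite (rcosets\<^bsub>G\<^esub> N)"
proof -
  interpret G: Group.group G by (rule G)
  interpret H: subgroup H G by (rule H)
  let ?c = "\<lambda>x n. x \<otimes>\<^bsub>G\<^esub> n \<otimes>\<^bsub>G\<^esub> inv\<^bsub>G\<^esub> x"
  let ?N = "{n \<in> carrier G. \<forall>x\<in>carrier G. ?c x n \<in> H}"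
  have cm: "?c x (n \<otimes>\<^bsub>G\<^esub> m) = ?c x n \<otimes>\<^bsub>G\<^esub> ?c x m" if "x \<in> carrier G" "n \<in> carrier G" "m \<in> carrier G" for x n m
    using that by (simp add: G.m_assoc G.inv_solve_left)
  have N: "subgroup ?N G"
  proof (rule G.subgroupI)
    have "\<one>\<^bsub>G\<^esub> \<in> ?N" by simp
    then show "?N \<noteq> {}" by blast
    fix n assume n: "n \<in> ?N"
    have "?c x (inv\<^bsub>G\<^esub> n) = inv\<^bsub>G\<^esub> (?c x n)" if "x \<in> carrier G" for x
      using that n by (simp add: G.inv_mult_group G.m_assoc)
    then show "inv\<^bsub>G\<^esub> n \<in> ?N" using n by simp
    fix m assume "m \<in> ?N"
    with n show "n \<otimes>\<^bsub>G\<^esub> m \<in> ?N" using cm by simp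
  qed auto
  have "?N \<lhd> G"
    unfolding G.normal_inv_iff
  proof (intro conjI N ballI)
    fix y n assume y: "y \<in> carrier G" and n: "n \<in> ?N"
    have "?c x (?c y n) = ?c (x \<otimes>\<^bsub>G\<^esub> y) n" if "x \<in> carrier G" for x
      using that y n by (simp add: G.inv_mult_group G.m_assoc)
    then show "?c y n \<in> ?N" using y n by simp
  qed
  moreover have "?N \<subseteq> H"
  proof
    fix n assume n: "n \<in> ?N"
    then have "?c \<one>\<^bsub>G\<^esub> n \<in> H" using G.one_closed by blast
    then show "n \<in> H" using n by simp
  qed
  moreover have "finite (rcosets\<^bsub>G\<^esub> ?N)"
  proof -
    \<comment> \<open>The permutation action on the right cosets of \<open>H\<close>; the core is its kernel.\<close>
    define act where "act x = (\<lambda>C\<in>rcosets\<^bsub>G\<^esub> H. C #>\<^bsub>G\<^esub> x)" for x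
    have same: "?N #>\<^bsub>G\<^esub> x = ?N #>\<^bsub>G\<^esub> y"
      if xy: "x \<in> carrier G" "y \<in> carrier G" and eq: "act x = act y" for x y
    proof -
      have "?c g (x \<otimes>\<^bsub>G\<^esub> inv\<^bsub>G\<^esub> y) \<in> H" if g: "g \<in> carrier G" for g
      proof -
        have "H #>\<^bsub>G\<^esub> g \<in> rcosets\<^bsub>G\<^esub> H" using g H.subset by (rule G.rcosetsI[rotated])
        then have "H #>\<^bsub>G\<^esub> g #>\<^bsub>G\<^esub> x = H #>\<^bsub>G\<^esub> g #>\<^bsub>G\<^esub> y"
          using fun_cong[OF eq, of "H #>\<^bsub>G\<^esub> g"] by (simp add: act_def)
        then have "H #>\<^bsub>G\<^esub> (g \<otimes>\<^bsub>G\<^esub> x) = H #>\<^bsub>G\<^esub> (g \<otimes>\<^bsub>G\<^esub> y)"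
          using g xy H.subset by (simp add: G.coset_mult_assoc)
        moreover have "g \<otimes>\<^bsub>G\<^esub> x \<in> H #>\<^bsub>G\<^esub> (g \<otimes>\<^bsub>G\<^esub> x)" using g xy by (intro G.rcos_self H) simp
        ultimately have "g \<otimes>\<^bsub>G\<^esub> x \<in> H #>\<^bsub>G\<^esub> (g \<otimes>\<^bsub>G\<^esub> y)" by simp
        then obtain h where h: "h \<in> H" "g \<otimes>\<^bsub>G\<^esub> x = h \<otimes>\<^bsub>G\<^esub> (g \<otimes>\<^bsub>G\<^esub> y)" unfolding r_coset_def by blast
        then have "g \<otimes>\<^bsub>G\<^esub> x \<otimes>\<^bsub>G\<^esub> inv\<^bsub>G\<^esub> (g \<otimes>\<^bsub>G\<^esub> y) = h" using g xy by (simp add: G.m_assoc)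
        moreover have "g \<otimes>\<^bsub>G\<^esub> x \<otimes>\<^bsub>G\<^esub> inv\<^bsub>G\<^esub> (g \<otimes>\<^bsub>G\<^esub> y) = ?c g (x \<otimes>\<^bsub>G\<^esub> inv\<^bsub>G\<^esub> y)"
          using g xy by (simp add: G.inv_mult_group G.m_assoc)
        ultimately show ?thesis using h(1) by simp
      qed
      then have "x \<otimes>\<^bsub>G\<^esub> inv\<^bsub>G\<^esub> y \<in> ?N" using xy by simp
      moreover have "x = x \<otimes>\<^bsub>G\<^esub> inv\<^bsub>G\<^esub> y \<otimes>\<^bsub>G\<^esub> y" using xy by (simp add: G.m_assoc)
      ultimately have "x \<in> ?N #>\<^bsub>G\<^esub> y" unfolding r_coset_def by blast
      from G.repr_independence[OF this xy(2) N] show ?thesis by (rule sym)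
    qed
    have "C #>\<^bsub>G\<^esub> x \<in> rcosets\<^bsub>G\<^esub> H" if C: "C \<in> rcosets\<^bsub>G\<^esub> H" and x: "x \<in> carrier G" for C x
    proof -
      obtain a where a: "a \<in> carrier G" "C = H #>\<^bsub>G\<^esub> a" using C unfolding RCOSETS_def by blast
      then show ?thesis
        using x H.subset by (simp add: G.coset_mult_assoc G.rcosetsI)
    qed
    then have "act ` carrier G \<subseteq> (\<Pi>\<^sub>E C\<in>rcosets\<^bsub>G\<^esub> H. rcosets\<^bsub>G\<^esub> H)"
      by (auto simp: act_def)
    then have fa: "finite (act ` carrier G)" by (rule finite_subset) (intro finite_PiE fin)
    obtain f where f: "\<And>x. x \<in> carrier G \<Longrightarrow> f (act x) = ?N #>\<^bsub>G\<^esub> x"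
    proof
      fix x assume x: "x \<in> carrier G"
      let ?y = "inv_into (carrier G) act (act x)"
      have "?y \<in> carrier G" "act ?y = act x" using x by (auto intro: inv_into_into f_inv_into_f)
      then have "?N #>\<^bsub>G\<^esub> ?y = ?N #>\<^bsub>G\<^esub> x" using x by (intro same)
      then show "(\<lambda>a. ?N #>\<^bsub>G\<^esub> inv_into (carrier G) act a) (act x) = ?N #>\<^bsub>G\<^esub> x" .
    qed
    have "rcosets\<^bsub>G\<^esub> ?N \<subseteq> f ` act ` carrier G" using f by (force simp: RCOSETS_def)
    then show ?thesis using fa by (auto intro: finite_subset)
  qed
  ultimately show thesis by (rule that)
qed

lemma finite_transversal:
  assumes G: "Group.group G" and N: "subgroup N G" and fin: "finite (rcosets\<^bsub>G\<^esub> N)"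
  obtains rep where "\<And>x. x \<in> carrier G \<Longrightarrow> rep x \<in> carrier G"
    "\<And>x. x \<in> carrier G \<Longrightarrow> x \<otimes>\<^bsub>G\<^esub> inv\<^bsub>G\<^esub> rep x \<in> N"
    "\<And>a x. a \<in> N \<Longrightarrow> x \<in> carrier G \<Longrightarrow> rep (a \<otimes>\<^bsub>G\<^esub> x) = rep x"
    "rep \<one>\<^bsub>G\<^esub> = \<one>\<^bsub>G\<^esub>" "finite (rep ` carrier G)"
proof -
  interpret G: Group.group G by (rule G)
  interpret N: subgroup N G by (rule N)
  define r where "r C = (if C = N then \<one>\<^bsub>G\<^esub> else SOME y. y \<in> C)" for C
  have r: "r (N #>\<^bsub>G\<^esub> x) \<in> N #>\<^bsub>G\<^esub> x" if "x \<in> carrier G" for x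
    using G.rcos_self[OF that N] by (auto simp: r_def intro: someI)
  show thesis
  proof (rule that[of "\<lambda>x. r (N #>\<^bsub>G\<^esub> x)"])
    fix x assume x: "x \<in> carrier G"
    obtain h where h: "h \<in> N" "r (N #>\<^bsub>G\<^esub> x) = h \<otimes>\<^bsub>G\<^esub> x" using r[OF x] unfolding r_coset_def by blast
    then show "r (N #>\<^bsub>G\<^esub> x) \<in> carrier G" using x by simp
    have "x \<otimes>\<^bsub>G\<^esub> inv\<^bsub>G\<^esub> r (N #>\<^bsub>G\<^esub> x) = inv\<^bsub>G\<^esub> h" using h x by (simp add: G.inv_mult_group flip: G.m_assoc)
    then show "x \<otimes>\<^bsub>G\<^esub> inv\<^bsub>G\<^esub> r (N #>\<^bsub>G\<^esub> x) \<in> N" using h by simp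
    fix a assume a: "a \<in> N"
    then show "r (N #>\<^bsub>G\<^esub> (a \<otimes>\<^bsub>G\<^esub> x)) = r (N #>\<^bsub>G\<^esub> x)"
      using x N.subset by (simp add: N.rcos_const flip: G.coset_mult_assoc)
  next
    show "r (N #>\<^bsub>G\<^esub> \<one>\<^bsub>G\<^esub>) = \<one>\<^bsub>G\<^esub>" using N.subset by (simp add: r_def)
    have "(\<lambda>x. r (N #>\<^bsub>G\<^esub> x)) ` carrier G = r ` (rcosets\<^bsub>G\<^esub> N)" by (auto simp: RCOSETS_def)
    then show "finite ((\<lambda>x. r (N #>\<^bsub>G\<^esub> x)) ` carrier G)" using fin by simp
  qed
qed

lemma weight_eq_enat_iff:
  "weight G S \<omega> g = enat k \<longleftrightarrow>
     (\<exists>ws\<in>lists S. word_prod G ws = g \<and> sum_list (map \<omega> ws) = k) \<and>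
     (\<forall>ws\<in>lists S. word_prod G ws = g \<longrightarrow> k \<le> sum_list (map \<omega> ws))"
    (is "?l \<longleftrightarrow> ?r")
proof
  assume l: ?l
  have "k \<le> sum_list (map \<omega> ws)" if "ws \<in> lists S" "word_prod G ws = g" for ws
  proof -
    have "weight G S \<omega> g \<le> enat (sum_list (map \<omega> ws))"
      unfolding weight_def by (rule INF_lower) (use that in simp)
    then show ?thesis using l by simp
  qed
  with weight_eq_enatE[OF l] show ?r by metis
next
  assume r: ?r
  show ?l unfolding weight_def
  proof (rule antisym)
    show "(INF ws\<in>{ws \<in> lists S. word_prod G ws = g}. enat (sum_list (map \<omega> ws))) \<le> enat k"
      using r by (metis (mono_tags, lifting) INF_lower mem_Collect_eq)
    show "enat k \<le> (INF ws\<in>{ws \<in> lists S. word_prod G ws = g}. enat (sum_list (map \<omega> ws)))"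
      by (rule INF_greatest) (use r in auto)
  qed
qed

text \<open>The image of \<open>s\<close> under the embedding of \<open>G\<close> as the \<open>i\<close>-th factor of \<open>G\<^sup>d\<close>.\<close>
definition coordinate :: "('a, 'b) monoid_scheme \<Rightarrow> nat \<Rightarrow> nat \<Rightarrow> 'a \<Rightarrow> nat \<Rightarrow> 'a" where
  "coordinate G d i s = (\<lambda>j\<in>{1..d}. if j = i then s else \<one>\<^bsub>G\<^esub>)"

definition coordinate_steps ::
  "('a, 'b) monoid_scheme \<Rightarrow> 'a set \<Rightarrow> ('a \<Rightarrow> nat) \<Rightarrow> nat \<Rightarrow> ((nat \<Rightarrow>\<^sub>0 nat) \<times> (nat \<Rightarrow> 'a)) set" where
  "coordinate_steps G S \<omega> d =
     (\<lambda>(i, s). (Poly_Mapping.single i (\<omega> s), coordinate G d i s)) ` ({1..d} \<times> S)"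

lemma weighted_steps_power:
  assumes NG: "N \<lhd> G" and comm: "\<And>a b. a \<in> N \<Longrightarrow> b \<in> N \<Longrightarrow> a \<otimes>\<^bsub>G\<^esub> b = b \<otimes>\<^bsub>G\<^esub> a"
    and rep: "\<And>x. x \<in> carrier G \<Longrightarrow> rep x \<in> carrier G"
    "\<And>x. x \<in> carrier G \<Longrightarrow> x \<otimes>\<^bsub>G\<^esub> inv\<^bsub>G\<^esub> rep x \<in> N"
    "\<And>a x. a \<in> N \<Longrightarrow> x \<in> carrier G \<Longrightarrow> rep (a \<otimes>\<^bsub>G\<^esub> x) = rep x"
    "rep \<one>\<^bsub>G\<^esub> = \<one>\<^bsub>G\<^esub>" "finite (rep ` carrier G)"
    and S: "S \<subseteq> carrier G" "finite S" "\<And>s. s \<in> S \<Longrightarrow> 0 < \<omega> s"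
  shows "weighted_steps (power_group G d) ({1..d} \<rightarrow>\<^sub>E N) (\<lambda>x. \<lambda>i\<in>{1..d}. rep (x i))
    (coordinate_steps G S \<omega> d) d"
proof -
  have G: "Group.group G" using NG by (simp add: normal_def)
  interpret G: Group.group G by (rule G)
  interpret N: normal N G by (rule NG)
  let ?E = "power_group G d" and ?r = "\<lambda>x. \<lambda>i\<in>{1..d}. rep (x i)"
  show ?thesis
  proof (intro weighted_steps.intro weighted_steps_axioms.intro)
    show "Group.group ?E" using G by simp
    show "subgroup ({1..d} \<rightarrow>\<^sub>E N) ?E" by (rule power_subgroup[OF G N.is_subgroup])
  next
    fix a b assume "a \<in> {1..d} \<rightarrow>\<^sub>E N" "b \<in> {1..d} \<rightarrow>\<^sub>E N"
    then show "a \<otimes>\<^bsub>?E\<^esub> b = b \<otimes>\<^bsub>?E\<^esub> a" using comm by (auto simp: PiE_iff intro!: restrict_ext)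
  next
    fix x assume x: "x \<in> carrier ?E"
    then have rc: "?r x \<in> (\<Pi>\<^sub>E i\<in>{1..d}. carrier G)" using rep(1) by (auto simp: PiE_iff)
    then show "?r x \<in> carrier ?E" by simp
    have "inv\<^bsub>?E\<^esub> ?r x = (\<lambda>i\<in>{1..d}. inv\<^bsub>G\<^esub> ?r x i)" by (rule inv_product_group[OF rc]) (rule G)
    then show "x \<otimes>\<^bsub>?E\<^esub> inv\<^bsub>?E\<^esub> ?r x \<in> {1..d} \<rightarrow>\<^sub>E N" using x rep(2) by (auto simp: PiE_iff)
    fix a assume "a \<in> {1..d} \<rightarrow>\<^sub>E N"
    then show "?r (a \<otimes>\<^bsub>?E\<^esub> x) = ?r x" using x rep(3) by (auto simp: PiE_iff intro!: restrict_ext)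
  next
    show "?r \<one>\<^bsub>?E\<^esub> = \<one>\<^bsub>?E\<^esub>" using rep(4) by (auto intro!: restrict_ext)
    have "?r ` carrier ?E \<subseteq> (\<Pi>\<^sub>E i\<in>{1..d}. rep ` carrier G)" by (auto simp: PiE_iff)
    then show "finite (?r ` carrier ?E)" by (rule finite_subset) (intro finite_PiE finite_atLeastAtMost rep(5))
    show "finite (coordinate_steps G S \<omega> d)" using S(2) by (simp add: coordinate_steps_def)
  next
    fix m s assume "(m, s) \<in> coordinate_steps G S \<omega> d"
    then obtain i t where i: "i \<in> {1..d}" "t \<in> S" "m = Poly_Mapping.single i (\<omega> t)" "s = coordinate G d i t"
      by (auto simp: coordinate_steps_def)
    have "keys m = {i}" using S(3)[OF i(2)] i(3) by simp
    then have "m \<noteq> 0" "keys m \<subseteq> {1..d}" using i(1) by auto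
    moreover have "s \<in> carrier ?E" using i S(1) by (auto simp: coordinate_def)
    ultimately show "s \<in> carrier ?E \<and> m \<noteq> 0 \<and> keys m \<subseteq> {1..d}" by blast
  qed
qed

text \<open>Steps in different coordinates commute, so a word in coordinate steps is the same as one word over \<open>S\<close>
  for each coordinate. Conversely, words for the coordinates are run one coordinate after the other.\<close>
lemma represents_coordinates:
  assumes ws: "weighted_steps (power_group G d) N rep (coordinate_steps G S \<omega> d) d"
    and G: "Group.group G" and S: "S \<subseteq> carrier G"
  shows "weighted_steps.represents (power_group G d) (coordinate_steps G S \<omega> d) n x \<longleftrightarrow>
    x \<in> {1..d} \<rightarrow>\<^sub>E carrier G \<and> keys n \<subseteq> {1..d} \<and>
    (\<forall>i\<in>{1..d}. \<exists>ws\<in>lists S. word_prod G ws = x i \<and> sum_list (map \<omega> ws) = lookup n i)"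
    (is "?rep n x \<longleftrightarrow> _ \<and> _ \<and> (\<forall>i\<in>_. ?word n x i)")
proof -
  interpret W: weighted_steps "power_group G d" N rep "coordinate_steps G S \<omega> d" d by (rule ws)
  interpret G: Group.group G by (rule G)
  let ?E = "power_group G d"
  have c: "coordinate G d i s \<in> carrier ?E" if "s \<in> carrier G" for i s
    using that by (auto simp: coordinate_def)
  show ?thesis
  proof
    assume n: "?rep n x"
    have "?word n x i" if i: "i \<in> {1..d}" for i
      using n
    proof (induction rule: W.represents.induct)
      case represents_one
      show ?case using i by (intro bexI[of _ "[]"]) (auto simp: word_prod_def)
    next
      case (represents_step n x m s)
      obtain w where w: "w \<in> lists S" "word_prod G w = x i" "sum_list (map \<omega> w) = lookup n i"
        using represents_step.IH by blast
      obtain j t where j: "j \<in> {1..d}" "t \<in> S" "m = Poly_Mapping.single j (\<omega> t)" "s = coordinate G d j t"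
        using represents_step(2) by (auto simp: coordinate_steps_def)
      have xi: "x i \<in> carrier G" using W.represents_closed[OF represents_step(1)] i by auto
      show ?case
      proof (cases "i = j")
        case True
        have t: "t \<in> carrier G" using j S by auto
        have "word_prod G (w @ [t]) = word_prod G w \<otimes>\<^bsub>G\<^esub> word_prod G [t]"
          using w(1) j(2) S by (intro word_prod_append[OF G.is_monoid]) auto
        then show ?thesis using True w j t i
          by (intro bexI[of _ "w @ [t]"]) (auto simp: word_prod_def coordinate_def lookup_add lookup_single)
      next
        case False
        then show ?thesis using w j xi i
          by (intro bexI[of _ w]) (auto simp: coordinate_def lookup_add lookup_single)
      qed
    qed
    with W.represents_closed[OF n] show "x \<in> {1..d} \<rightarrow>\<^sub>E carrier G \<and> keys n \<subseteq> {1..d} \<and> (\<forall>i\<in>{1..d}. ?word n x i)"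
      by simp
  next
    assume R: "x \<in> {1..d} \<rightarrow>\<^sub>E carrier G \<and> keys n \<subseteq> {1..d} \<and> (\<forall>i\<in>{1..d}. ?word n x i)"
    have mult: "?rep (k + m) (y \<otimes>\<^bsub>?E\<^esub> z)" if "?rep k y" "?rep m z" for k m y z
      using that(2)
    proof (induction rule: W.represents.induct)
      case represents_one
      show ?case using that(1) W.represents_closed[OF that(1)] W.r_one by simp
    next
      case (represents_step m z l s)
      have "y \<in> carrier ?E" "z \<in> carrier ?E" "s \<in> carrier ?E"
        using W.represents_closed that(1) represents_step W.T by blast+
      then have "y \<otimes>\<^bsub>?E\<^esub> (z \<otimes>\<^bsub>?E\<^esub> s) = y \<otimes>\<^bsub>?E\<^esub> z \<otimes>\<^bsub>?E\<^esub> s" using W.m_assoc by metis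
      with W.represents_step[OF represents_step.IH represents_step(2)] show ?case
        by (simp add: add.assoc del: mult_product_group)
    qed
    have coord: "?rep (Poly_Mapping.single i (sum_list (map \<omega> w))) (coordinate G d i (word_prod G w))"
      if "i \<in> {1..d}" "w \<in> lists S" for i w
      using that(2)
    proof induction
      case Nil
      have one: "coordinate G d i (word_prod G []) = \<one>\<^bsub>?E\<^esub>"
        by (auto simp: coordinate_def word_prod_def intro!: restrict_ext)
      show ?case unfolding one using W.represents_one by (simp del: one_product_group)
    next
      case (Cons s w)
      have s: "s \<in> carrier G" and w: "word_prod G w \<in> carrier G"
        using Cons S by (auto intro!: word_prod_closed G.is_monoid)
      have "?rep (0 + Poly_Mapping.single i (\<omega> s)) (\<one>\<^bsub>?E\<^esub> \<otimes>\<^bsub>?E\<^esub> coordinate G d i s)"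
        using Cons(1) that(1) by (intro W.represents_step W.represents_one) (force simp: coordinate_steps_def)
      then have "?rep (Poly_Mapping.single i (\<omega> s)) (coordinate G d i s)"
        by (simp only: W.l_one[OF c[OF s]] add_0)
      from mult[OF this Cons.IH] have "?rep (Poly_Mapping.single i (\<omega> s) + Poly_Mapping.single i (sum_list (map \<omega> w)))
          (coordinate G d i s \<otimes>\<^bsub>?E\<^esub> coordinate G d i (word_prod G w))" .
      moreover have "coordinate G d i s \<otimes>\<^bsub>?E\<^esub> coordinate G d i (word_prod G w) = coordinate G d i (word_prod G (s # w))"
        using s w by (auto simp: coordinate_def word_prod_def intro!: restrict_ext)
      ultimately show ?case by (simp only: list.map sum_list.Cons single_add)
    qed
    have "?rep (\<Sum>i\<in>J. Poly_Mapping.single i (lookup n i)) (\<lambda>i\<in>{1..d}. if i \<in> J then x i else \<one>\<^bsub>G\<^esub>)"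
      if "finite J" "J \<subseteq> {1..d}" for J
      using that
    proof induction
      case empty
      show ?case
        using W.represents_one by (simp only: sum.empty empty_iff if_False one_product_group)
    next
      case (insert i J)
      then obtain w where w: "w \<in> lists S" "word_prod G w = x i" "sum_list (map \<omega> w) = lookup n i"
        using R by blast
      have i: "i \<in> {1..d}" using insert by simp
      have "?rep ((\<Sum>i\<in>J. Poly_Mapping.single i (lookup n i)) + Poly_Mapping.single i (lookup n i))
        ((\<lambda>i\<in>{1..d}. if i \<in> J then x i else \<one>\<^bsub>G\<^esub>) \<otimes>\<^bsub>?E\<^esub> coordinate G d i (x i))"
        using mult[OF insert.IH coord[OF i w(1)]] insert.prems w(2,3) by simp
      moreover have "(\<lambda>i\<in>{1..d}. if i \<in> J then x i else \<one>\<^bsub>G\<^esub>) \<otimes>\<^bsub>?E\<^esub> coordinate G d i (x i) =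
          (\<lambda>k\<in>{1..d}. if k \<in> insert i J then x k else \<one>\<^bsub>G\<^esub>)"
        using R insert(2) i by (auto simp: coordinate_def PiE_iff intro!: restrict_ext)
      ultimately show ?case by (simp only: sum.insert[OF insert(1,2)] add.commute)
    qed
    from this[of "{1..d}"] have *: "?rep (\<Sum>i = 1..d. Poly_Mapping.single i (lookup n i))
        (\<lambda>i\<in>{1..d}. if i \<in> {1..d} then x i else \<one>\<^bsub>G\<^esub>)" by simp
    have "(\<Sum>i = 1..d. Poly_Mapping.single i (lookup n i)) = n"
      using R by (intro poly_mapping_eqI) (auto simp: Poly_Mapping.lookup_sum lookup_single when_def in_keys_iff)
    moreover have "(\<lambda>i\<in>{1..d}. if i \<in> {1..d} then x i else \<one>\<^bsub>G\<^esub>) = x"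
      using R by (auto simp: PiE_iff extensional_def)
    ultimately show "?rep n x" using * by (simp only:)
  qed
qed

text \<open>The exponent vectors that represent a tuple form a product of sets of numbers, so a minimal one consists
  of the minima in the coordinates: a shorter word in one coordinate would give a smaller vector.\<close>
lemma weights_eq_iff_minimal:
  assumes ws: "weighted_steps (power_group G d) N rep (coordinate_steps G S \<omega> d) d"
    and G: "Group.group G" and S: "S \<subseteq> carrier G"
    and x: "x \<in> {1..d} \<rightarrow>\<^sub>E carrier G" and e: "keys e \<subseteq> {1..d}"
  defines "R \<equiv> weighted_steps.represents (power_group G d) (coordinate_steps G S \<omega> d)"
  shows "(\<forall>i\<in>{1..d}. weight G S \<omega> (x i) = enat (lookup e i)) \<longleftrightarrow>
    R e x \<and> (\<forall>n m. R n x \<longrightarrow> e = n + m \<longrightarrow> m = 0)"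
proof
  note R = represents_coordinates[OF ws G S, folded R_def]
  assume w: "\<forall>i\<in>{1..d}. weight G S \<omega> (x i) = enat (lookup e i)"
  then have "R e x" unfolding R weight_eq_enat_iff using x e by blast
  moreover have "m = 0" if n: "R n x" and m: "e = n + m" for n m
  proof (rule poly_mapping_eqI)
    fix i
    show "lookup m i = lookup 0 i"
    proof (cases "i \<in> {1..d}")
      case True
      then have "lookup e i \<le> lookup n i" using w n unfolding R weight_eq_enat_iff by metis
      then show ?thesis using m by (simp add: lookup_add)
    next
      case False
      then have "lookup e i = 0" using e by (auto simp: in_keys_iff)
      then show ?thesis using m by (simp add: lookup_add)
    qed
  qed
  ultimately show "R e x \<and> (\<forall>n m. R n x \<longrightarrow> e = n + m \<longrightarrow> m = 0)" by blast
next
  note R = represents_coordinates[OF ws G S, folded R_def]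
  assume A: "R e x \<and> (\<forall>n m. R n x \<longrightarrow> e = n + m \<longrightarrow> m = 0)"
  show "\<forall>i\<in>{1..d}. weight G S \<omega> (x i) = enat (lookup e i)"
    unfolding weight_eq_enat_iff
  proof (intro ballI conjI impI)
    fix i assume i: "i \<in> {1..d}"
    show "\<exists>ws\<in>lists S. word_prod G ws = x i \<and> sum_list (map \<omega> ws) = lookup e i"
      using A i unfolding R by blast
    fix w assume w: "w \<in> lists S" "word_prod G w = x i"
    show "lookup e i \<le> sum_list (map \<omega> w)"
    proof (rule ccontr)
      assume less: "\<not> lookup e i \<le> sum_list (map \<omega> w)"
      \<comment> \<open>Replacing the word in coordinate \<open>i\<close> lowers \<open>e\<close> by a nonzero vector.\<close>
      let ?m = "Poly_Mapping.single i (lookup e i - sum_list (map \<omega> w))"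
      have lk: "lookup (e - ?m) j = (if j = i then sum_list (map \<omega> w) else lookup e j)" for j
        using less by (simp add: lookup_minus lookup_single when_def)
      have "keys (e - ?m) \<subseteq> {1..d}" using e i unfolding subset_iff in_keys_iff lk by (simp split: if_splits)
      moreover have "\<exists>ws\<in>lists S. word_prod G ws = x j \<and> sum_list (map \<omega> ws) = lookup (e - ?m) j"
        if "j \<in> {1..d}" for j
        using A w that unfolding R lk by (cases "j = i") auto
      ultimately have "R (e - ?m) x" unfolding R using x by blast
      moreover have "e = (e - ?m) + ?m"
      proof (rule poly_mapping_eqI)
        fix k show "lookup e k = lookup (e - ?m + ?m) k"
          using less by (cases "k = i") (simp_all add: lookup_add lk lookup_single)
      qed
      ultimately have "?m = 0" using A by blast
      then have "lookup ?m i = 0" by simp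
      then show False using less by simp
    qed
  qed
qed

theorem theorem1p1:
  fixes G :: "('a, 'b) monoid_scheme"
    and S :: "'a set"
    and \<omega> :: "'a \<Rightarrow> nat"
    and d :: nat
    and U :: "(nat \<Rightarrow> 'a) set"
  assumes "Group.group G"
    and "finitely_generated G"
    and "virtually_abelian G"
    and "S \<subseteq> carrier G"
    and "finite S"
    and "\<forall>s \<in> S. 0 < \<omega> s"
    and "0 < d"
    and "algebraic_set G d U"
  shows "rational_series d (growth_series G S \<omega> d U)"
proof -
  note G = assms(1)
  obtain H where H: "subgroup H G" "comm_group (G\<lparr>carrier := H\<rparr>)" "finite (rcosets\<^bsub>G\<^esub> H)"
    using assms(3) unfolding virtually_abelian_def by blast
  obtain N where N: "N \<lhd> G" "N \<subseteq> H" "finite (rcosets\<^bsub>G\<^esub> N)"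
    using finite_index_normal_core[OF G H(1,3)] by blast
  have comm: "a \<otimes>\<^bsub>G\<^esub> b = b \<otimes>\<^bsub>G\<^esub> a" if "a \<in> N" "b \<in> N" for a b
    using comm_monoid.m_comm[of "G\<lparr>carrier := H\<rparr>" a b] H(2) that N(2) by (auto simp: comm_group_def)
  obtain rep where rep: "\<And>x. x \<in> carrier G \<Longrightarrow> rep x \<in> carrier G"
    "\<And>x. x \<in> carrier G \<Longrightarrow> x \<otimes>\<^bsub>G\<^esub> inv\<^bsub>G\<^esub> rep x \<in> N"
    "\<And>a x. a \<in> N \<Longrightarrow> x \<in> carrier G \<Longrightarrow> rep (a \<otimes>\<^bsub>G\<^esub> x) = rep x"
    "rep \<one>\<^bsub>G\<^esub> = \<one>\<^bsub>G\<^esub>" "finite (rep ` carrier G)"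
    using finite_transversal[OF G normal_imp_subgroup[OF N(1)] N(3)] by blast
  have W: "weighted_steps (power_group G d) ({1..d} \<rightarrow>\<^sub>E N) (\<lambda>x. \<lambda>i\<in>{1..d}. rep (x i)) (coordinate_steps G S \<omega> d) d"
    by (rule weighted_steps_power[OF N(1) comm rep assms(4,5)]) (use assms(6) in auto)
  let ?R = "weighted_steps.represents (power_group G d) (coordinate_steps G S \<omega> d)"
  let ?A = "\<lambda>e. {x \<in> U. ?R e x \<and> (\<forall>n m. ?R n x \<longrightarrow> e = n + m \<longrightarrow> m = 0)}"
  have U: "x \<in> {1..d} \<rightarrow>\<^sub>E carrier G" if "x \<in> U" for x
    using assms(8) that unfolding algebraic_set_def solutions_def by blast
  have "growth_series G S \<omega> d U e = int (card (?A e))" for e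
  proof (cases "keys e \<subseteq> {1..d}")
    case True
    have "{x \<in> U. \<forall>i\<in>{1..d}. weight G S \<omega> (x i) = enat (lookup e i)} = ?A e"
      by (rule Collect_cong) (use weights_eq_iff_minimal[OF W G assms(4) U True] in blast)
    then show ?thesis unfolding growth_series_eq_card using True by (simp only: if_True)
  next
    case False
    then have "?A e = {}" using weighted_steps.represents_closed[OF W] by blast
    then show ?thesis unfolding growth_series_eq_card using False by (simp only: if_False card.empty of_nat_0)
  qed
  then have "growth_series G S \<omega> d U = (\<lambda>e. int (card (?A e)))" by (rule ext)
  moreover have "rational_series d (\<lambda>e. int (card (?A e)))"
    by (rule weighted_steps.rational_minimal_weights[OF W algebraic_set_translations[OF N(1) comm assms(8)]])
  ultimately show ?thesis by (simp only:)
qed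

end
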